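(* Let $\lambda\ge 0$, let $K$ be a coagulation kernel for which there are $k_2>k_1>0$ such that $$k_1\left(x^\lambda+y^\lambda\right)\le K(x,y)\le k_2\left(x^\lambda+y^\lambda\right),\qquad (x,y)\in(0,\infty)^2,$$ and let $S\in X_0^+$. (a) Assume further that $K(x-y,y)\le K(x,y)$ for $0<y\le x$, that $S\in\bigcap_{m\in(0,1)}X_m$, and that $S\not\equiv 0$. If $\lambda\in[0,1)$, then there is at least one stationary solution $\varphi$ to the coagulation equation with source $S$ such that $$\varphi\in X_m \ \text{ for all } 0\le m<\frac{1+\lambda}{2},\qquad \varphi\notin X_{(1+\lambda)/2}.$$ In addition, if $S\in X_m$ for some $m\in(-\infty,0)$, then $\varphi\in X_m$. (b) If $\lambda\ge 1$ and $\varphi$ is a stationary solution to the coagulation equation with source $S$, then $\varphi=S\equiv 0$.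
   Context: For $m\in\mathbb{R}$, $X_m:=L^1((0,\infty),x^m\,\mathrm{d}x)$, $X_{0,m}:=X_0\cap X_m$, and $X_m^+$, $X_{0,m}^+$ denote their positive cones (functions non-negative almost everywhere). A coagulation kernel is a measurable, non-negative and symmetric function $K$ on $(0,\infty)^2$, i.e. $K(x,y)=K(y,x)\ge 0$. The coagulation equation with source is $\partial_t f=\mathcal{C}f+S$ on $(0,\infty)^2$, where $\mathcal{C}f(x)=\frac12\int_0^x K(y,x-y)f(y)f(x-y)\,\mathrm{d}y-\int_0^\infty K(x,y)f(x)f(y)\,\mathrm{d}y$. A stationary solution to it (with source $S\in X_0^+$ and kernel $K$ satisfying, for some $\lambda\ge 0$ and $k_2>k_1>0$, the two-sided bound $k_1\left(x^\lambda+y^\lambda\right)\le K(x,y)\le k_2\left(x^\lambda+y^\lambda\right)$ for all $(x,y)\in(0,\infty)^2$) is a function $\varphi\in X_{0,\lambda}^+$ such that $$\frac12\int_0^\infty\int_0^\infty \chi_\vartheta(x,y)K(x,y)\varphi(x)\varphi(y)\,\mathrm{d}y\,\mathrm{d}x+\int_0^\infty S(x)\vartheta(x)\,\mathrm{d}x=0$$ for all $\vartheta\in L^\infty(0,\infty)$, where $\chi_\vartheta(x,y):=\vartheta(x+y)-\vartheta(x)-\vartheta(y)$ for $(x,y)\in(0,\infty)^2$. *)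

theory Defs
  imports "HOL-Analysis.Analysis"
begin

text \<open>
  Functions on \<open>(0,\<infinity>)\<close> are represented by functions on \<open>real\<close> whose values outside
  \<open>(0,\<infinity>)\<close> are irrelevant, and functions on \<open>(0,\<infinity>)\<^sup>2\<close> likewise. Elements of
  \<open>L\<^sup>1\<close> and \<open>L\<^sup>\<infinity>\<close> are represented by arbitrary Lebesgue measurable representatives;
  accordingly, identities and inequalities between them are stated almost everywhere.
\<close>

text \<open>The space \<open>X\<^sub>m = L\<^sup>1((0,\<infinity>), x\<^sup>m dx)\<close>.\<close>

definition wL1 :: "real \<Rightarrow> (real \<Rightarrow> real) set" where
  "wL1 m = {f. set_integrable lebesgue {0<..} (\<lambda>x. x powr m * f x)}"

definition pos_cone :: "(real \<Rightarrow> real) set \<Rightarrow> (real \<Rightarrow> real) set" where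
  "pos_cone A = {f \<in> A. AE x\<in>{0<..} in lebesgue. 0 \<le> f x}"

definition L_infty :: "(real \<Rightarrow> real) set" where
  "L_infty = {\<theta>. set_borel_measurable lebesgue {0<..} \<theta> \<and>
                 (\<exists>C. AE x\<in>{0<..} in lebesgue. \<bar>\<theta> x\<bar> \<le> C)}"

definition coagulation_kernel :: "(real \<Rightarrow> real \<Rightarrow> real) \<Rightarrow> bool" where
  "coagulation_kernel K \<longleftrightarrow>
     set_borel_measurable lebesgue ({0<..} \<times> {0<..}) (\<lambda>(x, y). K x y) \<and>
     (\<forall>x>0. \<forall>y>0. 0 \<le> K x y \<and> K x y = K y x)"

definition chi :: "(real \<Rightarrow> real) \<Rightarrow> real \<Rightarrow> real \<Rightarrow> real" where
  "chi \<theta> x y = \<theta> (x + y) - \<theta> x - \<theta> y"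

text \<open>
  Stationary solutions with source \<open>S\<close>, for a kernel \<open>K\<close> comparable to
  \<open>x powr lam + y powr lam\<close>. The upper bound on \<open>K\<close> and \<open>\<phi> \<in> wL1 0 \<inter> wL1 lam\<close> make the
  integrals below absolutely convergent for bounded \<open>\<theta>\<close>, so the convention that the
  integral of a non-integrable function is zero plays no role.
\<close>

definition stationary_solution ::
  "real \<Rightarrow> (real \<Rightarrow> real \<Rightarrow> real) \<Rightarrow> (real \<Rightarrow> real) \<Rightarrow> (real \<Rightarrow> real) \<Rightarrow> bool" where
  "stationary_solution lam K S \<phi> \<longleftrightarrow>
     \<phi> \<in> pos_cone (wL1 0 \<inter> wL1 lam) \<and>
     (\<forall>\<theta>\<in>L_infty.
        1 / 2 * (LINT x:{0<..}|lebesgue. (LINT y:{0<..}|lebesgue.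
                   chi \<theta> x y * K x y * \<phi> x * \<phi> y))
        + (LINT x:{0<..}|lebesgue. S x * \<theta> x) = 0)"

end

theory Submission
  imports Defs
begin

text \<open>
  Take Borel representatives of all functions. Testing the weak formulation with
  \<open>min x A\<close> bounds \<open>A\<^sup>1\<^sup>+\<^sup>\<lambda> (\<integral>\<^sub>A\<^sup>\<infinity> \<phi>)\<^sup>2\<close> by \<open>\<integral> S min(x, A)\<close>, which gives all moments below
  \<open>(1 + \<lambda>) / 2\<close>; letting \<open>A\<close> tend to infinity shows that the critical moment (or \<open>\<lambda> \<ge> 1\<close>) would force
  \<open>\<integral> x S = 0\<close>. Nonincreasing test functions control small sizes and negative moments. Testing with the
  indicator of \<open>\<phi> > N\<close> and using the monotonicity of \<open>K\<close> bounds \<open>\<integral> \<phi>\<close> over \<open>\<phi> > N\<close> by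
  the integral of \<open>S\<close> over the same set, so that solutions are uniformly integrable.

  Existence therefore follows by weak \<open>L\<^sup>1\<close> compactness from the problem with bounded sizes, a bounded source
  vanishing near zero, and an additional removal rate \<open>\<eta> > 0\<close>. That problem is a fixed point equation
  \<open>\<phi> = (S + gain \<phi>) / (\<eta> + loss \<phi>)\<close> whose right-hand side is weakly continuous and leaves the order
  interval below an exponential supersolution invariant; a Galerkin scheme reduces it to Brouwer's theorem.
\<close>

section \<open>Brouwer's theorem on the cube of variable dimension\<close>

text \<open>The bounds for nonincreasing test functions and for superlevel sets carry the factor
  \<open>k1\<close> times the moment of order \<open>lam\<close> of the solution. Existence
  therefore hinges on a positive lower bound for this moment, uniform along the approximation, and
  on its not losing mass in the limit. The latter is where \<open>lam < 1\<close> enters: it means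
  \<open>lam < (1 + lam) / 2\<close>, so the available moments reach strictly beyond
  \<open>lam\<close>. The removal rate keeps the denominator of the fixed point equation away from
  zero while no lower bound on the loss is known; it is sent to zero together with the other
  cutoffs. The critical exponent comes from the flux to large sizes. The test function
  \<open>min x A\<close> measures the loss across size \<open>A\<close>, and
  \<open>min x y * (x powr lam + y powr lam)\<close> is at most twice the product of
  \<open>x powr ((1 + lam) / 2)\<close> and \<open>y powr ((1 + lam) / 2)\<close>. A finite critical
  moment would thus make the flux vanish as \<open>A\<close> grows, whereas a nonzero source has to
  be balanced by it.\<close>

text \<open>The dimension \<open>n\<close> grows along the Galerkin scheme, so it is a term and not
  the index of a type. Points are sequences of which only the first \<open>n\<close> coordinates
  count; accordingly continuity is required sequentially and in these coordinates alone. Kuhn's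
  combinatorial lemma supplies labelled cells, and compactness of the product a limit point of
  them.\<close>

lemma brouwer_cube_nat:
  fixes G :: "(nat \<Rightarrow> real) \<Rightarrow> nat \<Rightarrow> real" and n :: nat
  defines "C \<equiv> (\<Pi>\<^sub>E i\<in>UNIV. {0..1::real})"
  assumes rng: "\<And>t i. t \<in> C \<Longrightarrow> i < n \<Longrightarrow> G t i \<in> {0..1}"
    and cont: "\<And>X t i. (\<And>k. X k \<in> C) \<Longrightarrow> t \<in> C \<Longrightarrow> (\<And>j. j < n \<Longrightarrow> (\<lambda>k. X k j) \<longlonglongrightarrow> t j)
        \<Longrightarrow> i < n \<Longrightarrow> (\<lambda>k. G (X k) i) \<longlonglongrightarrow> G t i"
  obtains t where "t \<in> C" "\<And>i. i < n \<Longrightarrow> G t i = t i"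
proof -
  define sc where "sc p x = (\<lambda>j. if j < n then real (x j) / real (Suc p) else 0)" for p and x :: "nat \<Rightarrow> nat"
  have scC: "sc p x \<in> C" if "\<forall>i<n. x i \<le> Suc p" for p x
    using that by (auto simp: sc_def C_def PiE_iff divide_simps)
  \<comment> \<open>Label 0 entails \<open>sc p x i \<le> G (sc p x) i\<close>, label 1 the reverse
    inequality. The values that Kuhn's lemma prescribes on the faces \<open>x i = 0\<close> and
    \<open>x i = Suc p\<close> respect this, since \<open>G\<close> takes values in [0, 1].\<close>
  define label where "label p x i =
     (if x i = Suc p \<or> (x i \<noteq> 0 \<and> G (sc p x) i < sc p x i) then 1 else 0::nat)" for p x i
  \<comment> \<open>\<open>q\<close> is the lower corner of a unit cell of the integer grid; for
    each \<open>i\<close> the vertices \<open>r i\<close> and \<open>s i\<close> of that cell have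
    \<open>i\<close>-th labels 0 and 1. After scaling, the mesh tends to 0, so along a subsequence
    all of them converge to the same point.\<close>
  define good where "good p q r s \<longleftrightarrow> (\<forall>i<n. q i < Suc p) \<and> (\<forall>i<n. (\<forall>j<n. q j \<le> r i j \<and> r i j \<le> q j + 1) \<and>
            (\<forall>j<n. q j \<le> s i j \<and> s i j \<le> q j + 1) \<and> label p (r i) i = 0 \<and> label p (s i) i = 1)" for p q r s
  have "\<exists>f. good p (fst f) (fst (snd f)) (snd (snd f))" for p
  proof -
    have lab: "label p x i = 0 \<or> label p x i = 1" for x i by (simp add: label_def)
    have l1: "\<forall>x. (\<forall>i<n. x i \<le> Suc p) \<longrightarrow> (\<forall>i<n. label p x i = 0 \<or> label p x i = 1)"
      using lab by blast
    have l2: "\<forall>x. (\<forall>i<n. x i \<le> Suc p) \<longrightarrow> (\<forall>i<n. x i = 0 \<longrightarrow> label p x i = 0)"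
      by (simp add: label_def)
    have l3: "\<forall>x. (\<forall>i<n. x i \<le> Suc p) \<longrightarrow> (\<forall>i<n. x i = Suc p \<longrightarrow> label p x i = 1)"
      by (simp add: label_def)
    obtain q where q1: "\<forall>i<n. q i < Suc p" and
      q2: "\<forall>i<n. \<exists>r s. (\<forall>j<n. q j \<le> r j \<and> r j \<le> q j + 1) \<and> (\<forall>j<n. q j \<le> s j \<and> s j \<le> q j + 1) \<and> label p r i \<noteq> label p s i"
      by (rule kuhn_lemma[of "Suc p" n "label p", OF _ l1 l2 l3]) (simp, rule that)
    have "\<exists>rs. (\<forall>j<n. q j \<le> fst rs j \<and> fst rs j \<le> q j + 1) \<and> (\<forall>j<n. q j \<le> snd rs j \<and> snd rs j \<le> q j + 1) \<and> label p (fst rs) i = 0 \<and> label p (snd rs) i = 1" if "i < n" for i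
    proof -
      have "\<exists>r s. (\<forall>j<n. q j \<le> r j \<and> r j \<le> q j + 1) \<and> (\<forall>j<n. q j \<le> s j \<and> s j \<le> q j + 1) \<and> label p r i \<noteq> label p s i"
        by (rule q2[THEN spec, THEN mp, OF that])
      then obtain r s where r: "\<forall>j<n. q j \<le> r j \<and> r j \<le> q j + 1"
        and s: "\<forall>j<n. q j \<le> s j \<and> s j \<le> q j + 1" and ne: "label p r i \<noteq> label p s i"
        by (elim exE conjE)
      consider "label p r i = 0" "label p s i = 1" | "label p s i = 0" "label p r i = 1"
        using ne lab[of r i] lab[of s i] by linarith
      then show ?thesis
      proof cases
        case 1
        show ?thesis
          by (intro exI[of _ "(r,s)"] conjI) (simp_all only: fst_conv snd_conv 1, rule r, rule s)
      next
        case 2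
        show ?thesis
          by (intro exI[of _ "(s,r)"] conjI) (simp_all only: fst_conv snd_conv 2, rule s, rule r)
      qed
    qed
    then have "\<forall>i\<in>{..<n}. \<exists>rs. (\<forall>j<n. q j \<le> fst rs j \<and> fst rs j \<le> q j + 1) \<and> (\<forall>j<n. q j \<le> snd rs j \<and> snd rs j \<le> q j + 1) \<and> label p (fst rs) i = 0 \<and> label p (snd rs) i = 1"
      by - (rule ballI, simp only: lessThan_iff)
    from bchoice[OF this]
    obtain rs where rs: "\<forall>i\<in>{..<n}. (\<forall>j<n. q j \<le> fst (rs i) j \<and> fst (rs i) j \<le> q j + 1) \<and> (\<forall>j<n. q j \<le> snd (rs i) j \<and> snd (rs i) j \<le> q j + 1) \<and> label p (fst (rs i)) i = 0 \<and> label p (snd (rs i)) i = 1"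
      by (elim exE)
    have "good p q (\<lambda>i. fst (rs i)) (\<lambda>i. snd (rs i))"
      unfolding good_def
    proof (intro conjI allI impI)
      fix i assume "i < n"
      then have *: "i \<in> {..<n}" by simp
      note rsi = bspec[OF rs *]
      show "label p (fst (rs i)) i = 0" "label p (snd (rs i)) i = 1" using rsi by - (elim conjE, assumption)+
      fix j assume j: "j < n"
      show "q j \<le> fst (rs i) j" "fst (rs i) j \<le> q j + 1" "q j \<le> snd (rs i) j" "snd (rs i) j \<le> q j + 1"
        using rsi[THEN conjunct1, THEN spec, THEN mp, OF j] rsi[THEN conjunct2, THEN conjunct1, THEN spec, THEN mp, OF j]
        by - (elim conjE, assumption)+
    qed (use q1 in blast)
    then show ?thesis
      by (intro exI[of _ "(q, \<lambda>i. fst (rs i), \<lambda>i. snd (rs i))"]) (simp only: fst_conv snd_conv)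
  qed
  then obtain f where f: "\<And>p. good p (fst (f p)) (fst (snd (f p))) (snd (snd (f p)))"
    using choice[of "\<lambda>p f. good p (fst f) (fst (snd f)) (snd (snd f))"] by blast
  define q r s where "q p = fst (f p)" and "r p = fst (snd (f p))" and "s p = snd (snd (f p))" for p
  note qrs = this
  have q: "\<And>p i. i < n \<Longrightarrow> q p i < Suc p"
    and r: "\<And>p i j. i < n \<Longrightarrow> j < n \<Longrightarrow> q p j \<le> r p i j \<and> r p i j \<le> q p j + 1"
    and s: "\<And>p i j. i < n \<Longrightarrow> j < n \<Longrightarrow> q p j \<le> s p i j \<and> s p i j \<le> q p j + 1"
    and lr: "\<And>p i. i < n \<Longrightarrow> label p (r p i) i = 0" and ls: "\<And>p i. i < n \<Longrightarrow> label p (s p i) i = 1"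
    using f unfolding good_def qrs by simp_all
  have r_le: "\<forall>j<n. r p i j \<le> Suc p" and s_le: "\<forall>j<n. s p i j \<le> Suc p" if "i < n" for p i
  proof -
    have "r p i j \<le> Suc p \<and> s p i j \<le> Suc p" if "j < n" for j
      using q[OF that, of p] r[OF \<open>i < n\<close> that, of p] s[OF \<open>i < n\<close> that, of p] by linarith
    then show "\<forall>j<n. r p i j \<le> Suc p" "\<forall>j<n. s p i j \<le> Suc p" by auto
  qed
  have "compact C"
    using compactin_PiE[of "\<lambda>_. euclidean" UNIV "\<lambda>_. {0..1::real}"]
    by (simp add: C_def euclidean_product_topology compactin_euclidean_iff)
  then have "seq_compact C" by (rule compact_imp_seq_compact)
  moreover have "\<forall>p. sc p (q p) \<in> C" using q by (auto intro!: scC less_imp_le)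
  ultimately obtain t \<sigma> where t: "t \<in> C" and \<sigma>: "strict_mono \<sigma>" and lim: "(\<lambda>k. sc (\<sigma> k) (q (\<sigma> k))) \<longlonglongrightarrow> t"
    by (force simp: seq_compact_def o_def)
  have limc: "(\<lambda>k. sc (\<sigma> k) (q (\<sigma> k)) j) \<longlonglongrightarrow> t j" for j
    using continuous_on_tendsto_compose[OF continuous_on_product_coordinates[of j] lim] by auto
  have inv0: "(\<lambda>k. 1 / real (Suc (\<sigma> k))) \<longlonglongrightarrow> 0"
    using LIMSEQ_subseq_LIMSEQ[OF lim_inverse_n' [THEN LIMSEQ_Suc] \<sigma>] by (simp add: o_def)
  have near: "(\<lambda>k. sc (\<sigma> k) (w (\<sigma> k)) j) \<longlonglongrightarrow> t j"
    if "\<And>p j. j < n \<Longrightarrow> q p j \<le> w p j \<and> w p j \<le> q p j + 1" "j < n" for w j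
  proof (rule tendsto_sandwich[OF always_eventually always_eventually])
    show "\<forall>k. sc (\<sigma> k) (q (\<sigma> k)) j \<le> sc (\<sigma> k) (w (\<sigma> k)) j"
      using that by (auto simp: sc_def divide_simps)
    show "\<forall>k. sc (\<sigma> k) (w (\<sigma> k)) j \<le> sc (\<sigma> k) (q (\<sigma> k)) j + 1 / real (Suc (\<sigma> k))"
    proof
      fix k
      have "w (\<sigma> k) j \<le> q (\<sigma> k) j + 1" using that by auto
      then have "real (w (\<sigma> k) j) \<le> real (q (\<sigma> k) j) + 1" by linarith
      then show "sc (\<sigma> k) (w (\<sigma> k)) j \<le> sc (\<sigma> k) (q (\<sigma> k)) j + 1 / real (Suc (\<sigma> k))"
        using that(2) by (simp add: sc_def divide_simps)
    qed
    show "(\<lambda>k. sc (\<sigma> k) (q (\<sigma> k)) j + 1 / real (Suc (\<sigma> k))) \<longlonglongrightarrow> t j"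
      using tendsto_add[OF limc[of j] inv0] by simp
  qed (rule limc)
  show thesis
  proof (rule that[OF t])
    fix i assume i: "i < n"
    have ge: "t i \<le> G t i"
    proof (rule LIMSEQ_le)
      show "(\<lambda>k. sc (\<sigma> k) (r (\<sigma> k) i) i) \<longlonglongrightarrow> t i" by (rule near) (use r i in auto)
      show "(\<lambda>k. G (sc (\<sigma> k) (r (\<sigma> k) i)) i) \<longlonglongrightarrow> G t i"
        by (rule cont[OF _ t _ i]) (use r_le[OF i] in \<open>auto intro!: scC near r i\<close>)
      have "sc p (r p i) i \<le> G (sc p (r p i)) i" for p
        using lr[OF i, of p] rng[OF scC[OF r_le[OF i, of p]] i] i
        by (auto simp: label_def sc_def split: if_splits)
      then show "\<exists>N. \<forall>k\<ge>N. sc (\<sigma> k) (r (\<sigma> k) i) i \<le> G (sc (\<sigma> k) (r (\<sigma> k) i)) i" by blast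
    qed
    have le: "G t i \<le> t i"
    proof (rule LIMSEQ_le)
      show "(\<lambda>k. sc (\<sigma> k) (s (\<sigma> k) i) i) \<longlonglongrightarrow> t i" by (rule near) (use s i in auto)
      show "(\<lambda>k. G (sc (\<sigma> k) (s (\<sigma> k) i)) i) \<longlonglongrightarrow> G t i"
        by (rule cont[OF _ t _ i]) (use s_le[OF i] in \<open>auto intro!: scC near s i\<close>)
      have "G (sc p (s p i)) i \<le> sc p (s p i) i" for p
        using ls[OF i, of p] rng[OF scC[OF s_le[OF i, of p]] i] i
        by (auto simp: label_def sc_def split: if_splits)
      then show "\<exists>N. \<forall>k\<ge>N. G (sc (\<sigma> k) (s (\<sigma> k) i)) i \<le> sc (\<sigma> k) (s (\<sigma> k) i) i" by blast
    qed
    show "G t i = t i" using ge le by simp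
  qed
qed

section \<open>Weak compactness in \<open>L\<^sup>1\<close>\<close>

text \<open>Lebesgue measure on the line is infinite, so weak compactness needs tightness besides
  equi-integrability; the single bound \<open>N\<close>, on both the argument and the value,
  expresses the two at once.\<close>

definition unif_int :: "(nat \<Rightarrow> real \<Rightarrow> real) \<Rightarrow> bool" where
  "unif_int u \<longleftrightarrow> (\<forall>n. integrable lborel (u n) \<and> (\<forall>x. 0 \<le> u n x)) \<and>
     (\<forall>\<epsilon>>0. \<exists>N>0. \<forall>n. (LINT x|lborel. (if \<bar>x\<bar> \<le> N \<and> u n x \<le> N then 0 else u n x)) < \<epsilon>)"

text \<open>The pairing is with all bounded Borel functions and not only continuous ones: later
  tests use indicators of Borel sets and expressions that contain the merely measurable
  kernel.\<close>

definition weak_lim :: "(nat \<Rightarrow> real \<Rightarrow> real) \<Rightarrow> (real \<Rightarrow> real) \<Rightarrow> bool" where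
  "weak_lim u v \<longleftrightarrow> (\<forall>g\<in>borel_measurable borel. (\<exists>C. \<forall>x. \<bar>g x\<bar> \<le> C) \<longrightarrow>
     (\<lambda>n. LINT x|lborel. u n x * g x) \<longlonglongrightarrow> (LINT x|lborel. v x * g x))"

lemma integrable_mult_bounded:
  fixes u f :: "'a \<Rightarrow> real"
  assumes u: "integrable M u" and f: "f \<in> borel_measurable M" and C: "\<And>x. \<bar>f x\<bar> \<le> C"
  shows "integrable M (\<lambda>x. u x * f x)"
proof (rule Bochner_Integration.integrable_bound[of M "\<lambda>x. C * u x"])
  show "AE x in M. norm (u x * f x) \<le> norm (C * u x)"
    using C by (intro AE_I2) (simp add: abs_mult mult.commute[of C] mult_left_mono order_trans[OF _ abs_ge_self])
qed (use u f in auto)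

lemma unif_intD:
  assumes "unif_int u" "0 < \<epsilon>"
  obtains N where "0 < N" "\<And>n. (LINT x|lborel. (if \<bar>x\<bar> \<le> N \<and> u n x \<le> N then 0 else u n x)) < \<epsilon>"
proof -
  have "\<exists>N>0. \<forall>n. (LINT x|lborel. (if \<bar>x\<bar> \<le> N \<and> u n x \<le> N then 0 else u n x)) < \<epsilon>"
    using assms(1)[unfolded unif_int_def, THEN conjunct2, THEN spec, THEN mp, OF assms(2)] .
  then show thesis by (elim exE conjE) (rule that, assumption, erule spec)
qed

lemma integrable_indicator_Icc: "integrable lborel (indicator {a..b::real} :: real \<Rightarrow> real)"
  by (cases "a \<le> b") (auto simp: integrable_indicator_iff emeasure_lborel_Icc_eq)

lemma unif_int_integrable: "unif_int u \<Longrightarrow> integrable lborel (u n)"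
  by (simp add: unif_int_def)

lemma unif_int_compose: "unif_int u \<Longrightarrow> unif_int (\<lambda>n. u (\<sigma> n))"
  unfolding unif_int_def
proof (elim conjE, intro conjI allI impI)
  fix \<epsilon> :: real
  assume *: "\<forall>\<epsilon>>0. \<exists>N>0. \<forall>n. (LINT x|lborel. (if \<bar>x\<bar> \<le> N \<and> u n x \<le> N then 0 else u n x)) < \<epsilon>"
    and e: "0 < \<epsilon>"
  from *[THEN spec, THEN mp, OF e]
  show "\<exists>N>0. \<forall>n. (LINT x|lborel. (if \<bar>x\<bar> \<le> N \<and> u (\<sigma> n) x \<le> N then 0 else u (\<sigma> n) x)) < \<epsilon>"
    by (elim exE conjE, intro exI conjI allI) (assumption, erule spec)
qed auto

text \<open>Where \<open>\<bar>x\<bar> \<le> N\<close> and \<open>v x \<le> N\<close>, the factor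
  \<open>v x\<close> is replaced by \<open>N\<close>; elsewhere \<open>\<bar>f x\<bar>\<close> is
  replaced by \<open>C\<close>. The first term no longer depends on \<open>v\<close>, which yields
  uniformity over a family.\<close>

lemma integral_truncation_bound:
  fixes v f :: "real \<Rightarrow> real"
  assumes v: "integrable lborel v" "\<And>x. 0 \<le> v x" and f[measurable]: "f \<in> borel_measurable borel"
    and C: "\<And>x. \<bar>f x\<bar> \<le> C" and N: "N > 0"
  shows "(LINT x|lborel. v x * \<bar>f x\<bar>) \<le> N * (LINT x|lborel. indicator {-N..N} x * \<bar>f x\<bar>)
           + C * (LINT x|lborel. (if \<bar>x\<bar> \<le> N \<and> v x \<le> N then 0 else v x))"
proof -
  have [measurable]: "v \<in> borel_measurable borel" using v(1) by auto
  have i1: "integrable lborel (\<lambda>x. indicator {-N..N} x * \<bar>f x\<bar>)"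
    using C by (intro integrable_mult_bounded[where C=C] integrable_indicator_Icc) auto
  have i2: "integrable lborel (\<lambda>x. if \<bar>x\<bar> \<le> N \<and> v x \<le> N then 0 else v x)"
    by (rule Bochner_Integration.integrable_bound[OF v(1)]) auto
  have i3: "integrable lborel (\<lambda>x. v x * \<bar>f x\<bar>)"
    using C by (intro integrable_mult_bounded[OF v(1), where C=C]) auto
  have "(LINT x|lborel. v x * \<bar>f x\<bar>) \<le> (LINT x|lborel. N * (indicator {-N..N} x * \<bar>f x\<bar>)
           + C * (if \<bar>x\<bar> \<le> N \<and> v x \<le> N then 0 else v x))"
  proof (rule integral_mono)
    fix x
    have C0: "0 \<le> C" using C[of x] by linarith
    show "v x * \<bar>f x\<bar> \<le> N * (indicator {-N..N} x * \<bar>f x\<bar>) + C * (if \<bar>x\<bar> \<le> N \<and> v x \<le> N then 0 else v x)"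
    proof (cases "\<bar>x\<bar> \<le> N \<and> v x \<le> N")
      case True then show ?thesis by (auto simp: indicator_def mult_right_mono)
    next
      case False
      have "v x * \<bar>f x\<bar> \<le> C * v x" using mult_left_mono[OF C[of x] v(2)[of x]] by (simp add: mult.commute)
      moreover have "0 \<le> N * (indicator {-N..N} x * \<bar>f x\<bar>)" using N by simp
      ultimately show ?thesis using False by auto
    qed
  qed (use i1 i2 i3 in \<open>auto intro!: Bochner_Integration.integrable_add\<close>)
  also have "\<dots> = N * (LINT x|lborel. indicator {-N..N} x * \<bar>f x\<bar>)
           + C * (LINT x|lborel. (if \<bar>x\<bar> \<le> N \<and> v x \<le> N then 0 else v x))"
    using i1 i2 by (subst Bochner_Integration.integral_add) auto
  finally show ?thesis .
qed

lemma unif_int_bounded: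
  assumes "unif_int u"
  obtains M where "0 \<le> M" "\<And>n. (LINT x|lborel. u n x) \<le> M"
proof -
  obtain N where N: "N > 0" "\<And>n. (LINT x|lborel. (if \<bar>x\<bar> \<le> N \<and> u n x \<le> N then 0 else u n x)) < 1"
    using unif_intD[OF assms zero_less_one] by blast
  have "(LINT x|lborel. u n x) \<le> N * (2 * N) + 1" for n
  proof -
    have "(LINT x|lborel. u n x * \<bar>1\<bar>) \<le> N * (LINT x|lborel. indicator {-N..N} x * \<bar>1\<bar>)
           + 1 * (LINT x|lborel. (if \<bar>x\<bar> \<le> N \<and> u n x \<le> N then 0 else u n x))"
      using assms N(1) by (intro integral_truncation_bound) (auto simp: unif_int_def)
    then show ?thesis using N(2)[of n] N(1) by simp
  qed
  moreover have "0 \<le> N * (2*N) + 1" using N(1) by simp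
  ultimately show thesis using that by blast
qed

text \<open>After truncation \<open>u n\<close> survives only in a remainder that is small for all
  \<open>n\<close>; the main term is an integral over a fixed bounded interval and tends to 0 by
  dominated convergence. So one index \<open>k0\<close> serves every \<open>n\<close>.\<close>

lemma unif_int_integral_tendsto_0:
  assumes u: "unif_int u" and f[measurable]: "\<And>k. f k \<in> borel_measurable borel"
    and C: "\<And>k x. \<bar>f k x\<bar> \<le> C" and lim: "\<And>x. (\<lambda>k. f k x) \<longlonglongrightarrow> 0" and e: "0 < \<epsilon>"
  obtains k0 where "\<And>n k. k \<ge> k0 \<Longrightarrow> (LINT x|lborel. u n x * \<bar>f k x\<bar>) < \<epsilon>"
proof -
  have C0: "0 \<le> C" using C[of 0 0] by linarith
  obtain N where N: "N > 0" "\<And>n. (LINT x|lborel. (if \<bar>x\<bar> \<le> N \<and> u n x \<le> N then 0 else u n x)) < \<epsilon> / (2 * (C+1))"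
  proof -
    have "\<epsilon> / (2 * (C+1)) > 0" using e C0 by simp
    then show ?thesis by (rule unif_intD[OF u]) (rule that)
  qed
  have "(\<lambda>k. LINT x|lborel. indicator {-N..N} x * \<bar>f k x\<bar>) \<longlonglongrightarrow> (LINT x::real|lborel. (0::real))"
  proof (rule integral_dominated_convergence[where w="\<lambda>x. C * indicator {-N..N} x"])
    show "AE x in lborel. (\<lambda>k. indicator {-N..N} x * \<bar>f k x\<bar>) \<longlonglongrightarrow> 0"
      using lim by (intro AE_I2 tendsto_mult_right_zero tendsto_rabs_zero)
    show "AE x in lborel. norm (indicator {-N..N} x * \<bar>f k x\<bar>) \<le> C * indicator {-N..N} x" for k
      using C by (intro AE_I2) (auto simp: indicator_def)
  qed (use integrable_indicator_Icc in auto)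
  then have "(\<lambda>k. N * (LINT x|lborel. indicator {-N..N} x * \<bar>f k x\<bar>)) \<longlonglongrightarrow> N * 0"
    by (intro tendsto_mult_left) simp
  then obtain k0 where k0: "\<And>k. k \<ge> k0 \<Longrightarrow> N * (LINT x|lborel. indicator {-N..N} x * \<bar>f k x\<bar>) < \<epsilon> / 2"
    using order_tendstoD(2)[of _ "0::real" sequentially "\<epsilon>/2"] e unfolding eventually_sequentially by auto
  show thesis
  proof (rule that[of k0])
    fix n k assume k: "k0 \<le> k"
    have "(LINT x|lborel. u n x * \<bar>f k x\<bar>) \<le> N * (LINT x|lborel. indicator {-N..N} x * \<bar>f k x\<bar>)
           + C * (LINT x|lborel. (if \<bar>x\<bar> \<le> N \<and> u n x \<le> N then 0 else u n x))"
      using u C N(1) by (intro integral_truncation_bound) (auto simp: unif_int_def)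
    also have "\<dots> < \<epsilon> / 2 + C * (\<epsilon> / (2 * (C+1))) + \<epsilon> / (2 * (C+1))"
    proof -
      have "C * (LINT x|lborel. (if \<bar>x\<bar> \<le> N \<and> u n x \<le> N then 0 else u n x)) \<le> C * (\<epsilon> / (2 * (C+1)))"
        using C0 N(2)[of n] by (intro mult_left_mono) auto
      moreover have "0 < \<epsilon> / (2 * (C+1))" using C0 e by simp
      ultimately show ?thesis using k0[OF k] by linarith
    qed
    also have "\<dots> = \<epsilon> / 2 + (C + 1) * (\<epsilon> / (2 * (C+1)))" by (simp only: distrib_right mult_1 add.assoc)
    also have "\<dots> = \<epsilon>" using C0 by (simp add: field_simps)
    finally show "(LINT x|lborel. u n x * \<bar>f k x\<bar>) < \<epsilon>" .
  qed
qed

text \<open>Write \<open>f k = (f k - g) + g\<close>: the first part is negligible, uniformly over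
  all members of \<open>u\<close>, by uniform integrability, and the second part is weak
  convergence.\<close>

lemma weak_lim_mult:
  assumes u: "unif_int u" and w: "weak_lim u v" and v: "integrable lborel v"
    and f[measurable]: "\<And>k. f k \<in> borel_measurable borel" "g \<in> borel_measurable borel"
    and C: "\<And>k x. \<bar>f k x\<bar> \<le> C" and lim: "\<And>x. (\<lambda>k. f k x) \<longlonglongrightarrow> g x"
  shows "(\<lambda>k. LINT x|lborel. u k x * f k x) \<longlonglongrightarrow> (LINT x|lborel. v x * g x)"
proof -
  have gC: "\<bar>g x\<bar> \<le> C" for x
    using tendsto_rabs[OF lim[of x]] C by (intro LIMSEQ_le_const2) auto
  have int: "integrable lborel (u k)" and nn: "0 \<le> u k x" for k x using u by (auto simp: unif_int_def)
  have 1: "(\<lambda>k. LINT x|lborel. u k x * (f k x - g x)) \<longlonglongrightarrow> 0"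
  proof (rule LIMSEQ_I)
    fix \<epsilon> :: real assume e: "0 < \<epsilon>"
    have lim0: "(\<lambda>k. f k x - g x) \<longlonglongrightarrow> 0" for x using lim[of x] by (simp add: LIM_zero)
    have b: "\<bar>f k x - g x\<bar> \<le> C + C" for k x using C[of k x] gC[of x] by linarith
    obtain k0 where k0: "\<And>n k. k \<ge> k0 \<Longrightarrow> (LINT x|lborel. u n x * \<bar>f k x - g x\<bar>) < \<epsilon>"
      by (rule unif_int_integral_tendsto_0[where f="\<lambda>k x. f k x - g x", OF u _ b lim0 e])
        (measurable, rule that)
    have "norm ((LINT x|lborel. u k x * (f k x - g x)) - 0) < \<epsilon>" if "k \<ge> k0" for k
    proof -
      have "norm (LINT x|lborel. u k x * (f k x - g x)) \<le> (LINT x|lborel. norm (u k x * (f k x - g x)))"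
        by (rule integral_norm_bound)
      also have "\<dots> = (LINT x|lborel. u k x * \<bar>f k x - g x\<bar>)" using nn by (simp add: abs_mult)
      finally show ?thesis using k0[OF that, of k] by simp
    qed
    then show "\<exists>k0. \<forall>k\<ge>k0. norm ((LINT x|lborel. u k x * (f k x - g x)) - 0) < \<epsilon>" by blast
  qed
  have 2: "(\<lambda>k. LINT x|lborel. u k x * g x) \<longlonglongrightarrow> (LINT x|lborel. v x * g x)"
    by (rule w[unfolded weak_lim_def, rule_format]) (use gC in auto)
  have "(LINT x|lborel. u k x * f k x) = (LINT x|lborel. u k x * (f k x - g x)) + (LINT x|lborel. u k x * g x)" for k
  proof -
    have "integrable lborel (\<lambda>x. u k x * f k x)" "integrable lborel (\<lambda>x. u k x * g x)"
      using C gC by (auto intro!: integrable_mult_bounded[OF int, where C=C])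
    then show ?thesis by (simp add: right_diff_distrib)
  qed
  then show ?thesis using tendsto_add[OF 1 2] by simp
qed

text \<open>For fixed \<open>x\<close> the inner integral converges, and it is bounded by
  \<open>C * M\<close>, so it is an admissible factor for a second use of
  \<open>weak_lim_mult\<close>. The kernel may vary with \<open>k\<close>, since in the truncated
  problem it will contain the approximating function itself.\<close>

lemma weak_lim_bilinear:
  assumes u: "unif_int u" and w: "weak_lim u v" and v: "integrable lborel v"
    and f[measurable]: "\<And>k. case_prod (f k) \<in> borel_measurable (borel \<Otimes>\<^sub>M borel)" "case_prod g \<in> borel_measurable (borel \<Otimes>\<^sub>M borel)"
    and C: "\<And>k x y. \<bar>f k x y\<bar> \<le> C" and lim: "\<And>x y. (\<lambda>k. f k x y) \<longlonglongrightarrow> g x y"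
  shows "(\<lambda>k. LINT x|lborel. u k x * (LINT y|lborel. u k y * f k x y)) \<longlonglongrightarrow>
         (LINT x|lborel. v x * (LINT y|lborel. v y * g x y))"
proof -
  have int: "integrable lborel (u k)" and nn: "0 \<le> u k x" for k x using u by (auto simp: unif_int_def)
  have [measurable]: "u k \<in> borel_measurable borel" for k using int[of k] by auto
  have [measurable]: "v \<in> borel_measurable borel" using v by auto
  obtain M where M: "0 \<le> M" "\<And>n. (LINT x|lborel. u n x) \<le> M" using unif_int_bounded[OF u] by blast
  have C0: "0 \<le> C" using C[of 0 0 0] by linarith
  show ?thesis
  proof (rule weak_lim_mult[OF u w v, where C="C * M"])
    show "(\<lambda>x. LINT y|lborel. u k y * f k x y) \<in> borel_measurable borel" for k by measurable
    show "(\<lambda>x. LINT y|lborel. v y * g x y) \<in> borel_measurable borel" by measurable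
    show "\<bar>LINT y|lborel. u k y * f k x y\<bar> \<le> C * M" for k x
    proof -
      have "\<bar>LINT y|lborel. u k y * f k x y\<bar> \<le> (LINT y|lborel. C * u k y)"
      proof (rule order_trans[OF integral_abs_bound integral_mono])
        show "integrable lborel (\<lambda>y. \<bar>u k y * f k x y\<bar>)"
          using C by (intro integrable_abs integrable_mult_bounded[OF int, where C=C]) auto
        show "\<bar>u k y * f k x y\<bar> \<le> C * u k y" for y
          using mult_right_mono[OF C[of k x y] nn[of k y]] nn[of k y] by (simp add: abs_mult mult.commute)
      qed (use int in auto)
      also have "\<dots> \<le> C * M" using M C0 by (simp add: mult_left_mono)
      finally show ?thesis .
    qed
    show "(\<lambda>k. LINT y|lborel. u k y * f k x y) \<longlonglongrightarrow> (LINT y|lborel. v y * g x y)" for x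
      using C lim by (intro weak_lim_mult[OF u w v]) auto
  qed
qed

text \<open>Moore-Osgood interchange of two limits, existence included: \<open>S\<close> is Cauchy
  because, for large \<open>k\<close>, each \<open>s n k\<close> is close to the same
  \<open>a n\<close>.\<close>

lemma uniform_approx_tendsto:
  fixes a :: "nat \<Rightarrow> real"
  assumes s: "\<And>k. (\<lambda>n. s n k) \<longlonglongrightarrow> S k"
    and unif: "\<And>\<epsilon>. 0 < \<epsilon> \<Longrightarrow> \<exists>k0. \<forall>k\<ge>k0. \<forall>n. \<bar>a n - s n k\<bar> < \<epsilon>"
  obtains L where "S \<longlonglongrightarrow> L" "a \<longlonglongrightarrow> L"
proof -
  have "Cauchy S"
  proof (rule metric_CauchyI)
    fix \<epsilon> :: real assume e: "0 < \<epsilon>"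
    obtain k0 where k0: "\<And>k n. k \<ge> k0 \<Longrightarrow> \<bar>a n - s n k\<bar> < \<epsilon>/3" using unif[of "\<epsilon>/3"] e by auto
    have "dist (S k) (S l) < \<epsilon>" if "k \<ge> k0" "l \<ge> k0" for k l
    proof -
      have "\<bar>S k - S l\<bar> \<le> 2 * \<epsilon> / 3"
      proof (rule LIMSEQ_le_const2)
        show "(\<lambda>n. \<bar>s n k - s n l\<bar>) \<longlonglongrightarrow> \<bar>S k - S l\<bar>" by (intro tendsto_rabs tendsto_diff s)
        have "\<bar>s n k - s n l\<bar> \<le> 2 * \<epsilon> / 3" for n using k0[OF that(1), of n] k0[OF that(2), of n] by linarith
        then show "\<exists>N. \<forall>n\<ge>N. \<bar>s n k - s n l\<bar> \<le> 2 * \<epsilon> / 3" by blast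
      qed
      then show ?thesis using e by (simp add: dist_real_def)
    qed
    then show "\<exists>M. \<forall>m\<ge>M. \<forall>n\<ge>M. dist (S m) (S n) < \<epsilon>" by blast
  qed
  then obtain L where L: "S \<longlonglongrightarrow> L" using Cauchy_convergent convergent_def by blast
  have "a \<longlonglongrightarrow> L"
  proof (rule LIMSEQ_I)
    fix \<epsilon> :: real assume e: "0 < \<epsilon>"
    obtain k0 where k0: "\<And>k n. k \<ge> k0 \<Longrightarrow> \<bar>a n - s n k\<bar> < \<epsilon>/3" using unif[of "\<epsilon>/3"] e by auto
    obtain k1 where k1: "\<And>k. k \<ge> k1 \<Longrightarrow> \<bar>S k - L\<bar> < \<epsilon>/3" using LIMSEQ_D[OF L, of "\<epsilon>/3"] e by auto
    define k where "k = max k0 k1"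
    obtain n0 where n0: "\<And>n. n \<ge> n0 \<Longrightarrow> \<bar>s n k - S k\<bar> < \<epsilon>/3" using LIMSEQ_D[OF s[of k], of "\<epsilon>/3"] e by auto
    have "norm (a n - L) < \<epsilon>" if "n \<ge> n0" for n
    proof -
      have "\<bar>a n - s n k\<bar> < \<epsilon>/3" "\<bar>S k - L\<bar> < \<epsilon>/3" by (simp_all only: k_def k0 k1 max.cobounded1 max.cobounded2)
      with n0[OF that] show ?thesis unfolding real_norm_def by linarith
    qed
    then show "\<exists>no. \<forall>n\<ge>no. norm (a n - L) < \<epsilon>" by blast
  qed
  with L show thesis by (rule that)
qed

text \<open>The tails \<open>T k\<close> of a disjoint union decrease to the empty set, hence their
  mass under \<open>u n\<close> is small uniformly in \<open>n\<close>. This keeps limits of set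
  functions countably additive, as in the Vitali-Hahn-Saks theorem.\<close>

lemma unif_int_disjoint_UN:
  assumes u: "unif_int u" and E: "range E \<subseteq> sets borel" "disjoint_family E"
    and lim: "\<And>i. (\<lambda>n. LINT x|lborel. u n x * indicator (E i) x) \<longlonglongrightarrow> m i"
  obtains L where "m sums L" "(\<lambda>n. LINT x|lborel. u n x * indicator (\<Union>i. E i) x) \<longlonglongrightarrow> L"
proof -
  have [measurable]: "E i \<in> sets borel" for i using E by auto
  have int: "integrable lborel (u k)" and nn: "0 \<le> u k x" for k x using u by (auto simp: unif_int_def)
  have [measurable]: "u k \<in> borel_measurable borel" for k using int[of k] by auto
  define T where "T k = (\<Union>i\<in>{k..}. E i)" for k
  have [measurable]: "T k \<in> sets borel" for k unfolding T_def by (intro sets.countable_UN') auto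
  have ii: "integrable lborel (\<lambda>x. u n x * indicator A x)" if "A \<in> sets borel" for A n
    using that by (intro integrable_mult_bounded[OF int, where C=1]) (auto simp: indicator_def)
  have split: "(LINT x|lborel. u n x * indicator (\<Union>i. E i) x) =
      (\<Sum>i<k. LINT x|lborel. u n x * indicator (E i) x) + (LINT x|lborel. u n x * indicator (T k) x)" for n k
  proof -
    have "indicator (\<Union>i. E i) x = (\<Sum>i<k. indicator (E i) x) + (indicator (T k) x :: real)" for x
    proof -
      have "UNIV = {..<k} \<union> {k..}" by auto
      then have "(\<Union>i. E i) = (\<Union>i<k. E i) \<union> T k" unfolding T_def
        using UN_Un[of E "{..<k}" "{k..}"] by metis
      moreover have "(\<Union>i<k. E i) \<inter> T k = {}"
      proof -
        have "E i \<inter> E j = {}" if "i < k" "k \<le> j" for i j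
          using E(2) that unfolding disjoint_family_on_def by simp
        then show ?thesis unfolding T_def by blast
      qed
      moreover have "(indicator (\<Union>i<k. E i) x :: real) = (\<Sum>i<k. indicator (E i) x)"
        using E(2) by (intro indicator_UN_disjoint) (auto intro: disjoint_family_on_mono[of _ UNIV])
      moreover have "(indicator (A \<union> B) x :: real) = indicator A x + indicator B x" if "A \<inter> B = {}" for A B
        using that by (auto simp: indicator_def)
      ultimately show ?thesis by simp
    qed
    then have "(LINT x|lborel. u n x * indicator (\<Union>i. E i) x) =
       (LINT x|lborel. (\<Sum>i<k. u n x * indicator (E i) x) + u n x * indicator (T k) x)"
      by (simp add: distrib_left sum_distrib_left)
    also have "\<dots> = (\<Sum>i<k. LINT x|lborel. u n x * indicator (E i) x) + (LINT x|lborel. u n x * indicator (T k) x)"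
    proof -
      have 1: "integrable lborel (\<lambda>x. \<Sum>i<k. u n x * indicator (E i) x)"
        by (intro Bochner_Integration.integrable_sum ii) measurable
      have 2: "(LINT x|lborel. (\<Sum>i<k. u n x * indicator (E i) x)) = (\<Sum>i<k. LINT x|lborel. u n x * indicator (E i) x)"
        by (intro Bochner_Integration.integral_sum ii) measurable
      show ?thesis unfolding 2[symmetric] by (intro Bochner_Integration.integral_add 1 ii) measurable
    qed
    finally show ?thesis .
  qed
  have limT: "(\<lambda>k. indicator (T k) x :: real) \<longlonglongrightarrow> 0" for x
  proof (rule tendsto_eventually)
    show "\<forall>\<^sub>F k in sequentially. indicator (T k) x = (0::real)"
    proof (cases "\<exists>i. x \<in> E i")
      case True
      then obtain i where i: "x \<in> E i" by blast
      have "x \<notin> E j" if "j \<noteq> i" for j using i that E(2) unfolding disjoint_family_on_def by auto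
      then have "x \<notin> T k" if "k \<ge> Suc i" for k using that unfolding T_def by (auto dest: Suc_le_lessD)
      then show ?thesis unfolding eventually_sequentially by (intro exI[of _ "Suc i"]) auto
    next
      case False then show ?thesis unfolding T_def by auto
    qed
  qed
  obtain L where L: "(\<lambda>k. \<Sum>i<k. m i) \<longlonglongrightarrow> L" "(\<lambda>n. LINT x|lborel. u n x * indicator (\<Union>i. E i) x) \<longlonglongrightarrow> L"
  proof (rule uniform_approx_tendsto)
    show "(\<lambda>n. \<Sum>i<k. LINT x|lborel. u n x * indicator (E i) x) \<longlonglongrightarrow> (\<Sum>i<k. m i)" for k
      by (intro tendsto_sum lim)
    fix \<epsilon> :: real assume e: "0 < \<epsilon>"
    obtain k0 where k0: "\<And>n k. k \<ge> k0 \<Longrightarrow> (LINT x|lborel. u n x * \<bar>indicator (T k) x\<bar>) < \<epsilon>"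
    proof (rule unif_int_integral_tendsto_0[where f="\<lambda>k. indicator (T k)" and C=1, OF u _ _ limT e])
      show "(indicator (T k) :: real \<Rightarrow> real) \<in> borel_measurable borel" for k by measurable
    qed (auto simp: indicator_def intro: that)
    have "\<bar>(LINT x|lborel. u n x * indicator (\<Union>i. E i) x) - (\<Sum>i<k. LINT x|lborel. u n x * indicator (E i) x)\<bar> < \<epsilon>" if "k \<ge> k0" for n k
    proof -
      have "0 \<le> (LINT x|lborel. u n x * indicator (T k) x)" using nn by (intro integral_nonneg_AE AE_I2) auto
      moreover have "(LINT x|lborel. u n x * indicator (T k) x) < \<epsilon>" using k0[OF that, of n] by simp
      ultimately show ?thesis unfolding split[of n k] by linarith
    qed
    then show "\<exists>k0. \<forall>k\<ge>k0. \<forall>n. \<bar>(LINT x|lborel. u n x * indicator (\<Union>i. E i) x) - (\<Sum>i<k. LINT x|lborel. u n x * indicator (E i) x)\<bar> < \<epsilon>"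
      by blast
  qed (rule that)
  then show thesis using that by (auto simp: sums_def)
qed

text \<open>A sequential form of the Dunford-Pettis theorem.\<close>

lemma unif_int_weak_subsequence:
  assumes u: "unif_int u"
  obtains \<sigma> v where "strict_mono \<sigma>" "integrable lborel v" "\<And>x. 0 \<le> v x" "weak_lim (\<lambda>n. u (\<sigma> n)) v"
proof -
  have int: "integrable lborel (u k)" and nn: "0 \<le> u k x" for k x using u by (auto simp: unif_int_def)
  have [measurable]: "u k \<in> borel_measurable borel" for k using int[of k] by auto
  have ii: "integrable lborel (\<lambda>x. u n x * indicator A x)" if "A \<in> sets borel" for A n
    using that by (intro integrable_mult_bounded[OF int, where C=1]) (auto simp: indicator_def)
  obtain M where M: "0 \<le> M" "\<And>n. (LINT x|lborel. u n x) \<le> M" using unif_int_bounded[OF u] by blast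
  \<comment> \<open>Half-lines with rational end points form a countable generating pi-system; index
    0 adds the total mass, which complements require. Compactness of a countable product of
    intervals [0, M] replaces a diagonal argument.\<close>
  define H where "H k = (if k = 0 then UNIV else {..from_nat_into (\<rat>::real set) (k - 1)})" for k :: nat
  have [measurable]: "H k \<in> sets borel" for k by (simp add: H_def)
  define X where "X n k = (LINT x|lborel. u n x * indicator (H k) x)" for n k
  have X_in: "X n \<in> (\<Pi>\<^sub>E k\<in>UNIV. {0..M})" for n
  proof -
    have "X n k \<le> (LINT x|lborel. u n x)" for k
      unfolding X_def using nn by (intro integral_mono int ii) (auto simp: indicator_def)
    moreover have "0 \<le> X n k" for k unfolding X_def using nn by (intro integral_nonneg_AE AE_I2) auto
    ultimately show ?thesis using M(2)[of n] by (auto simp: PiE_iff intro: order_trans)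
  qed
  have "compact (\<Pi>\<^sub>E k\<in>(UNIV::nat set). {0..M})"
    using compactin_PiE[of "\<lambda>_. euclidean" UNIV "\<lambda>_. {0..M}"]
    by (simp add: euclidean_product_topology)
  then have "seq_compact (\<Pi>\<^sub>E k\<in>(UNIV::nat set). {0..M})" by (rule compact_imp_seq_compact)
  then obtain l \<sigma> where \<sigma>: "strict_mono \<sigma>" and l: "(\<lambda>n. X (\<sigma> n)) \<longlonglongrightarrow> l"
    by (rule seq_compactE[of _ X]) (use X_in in \<open>auto simp: o_def\<close>)
  define w where "w n = u (\<sigma> n)" for n
  have w: "unif_int w" unfolding w_def by (rule unif_int_compose[OF u])
  have intw: "integrable lborel (w k)" and nnw: "0 \<le> w k x" for k x using w by (auto simp: unif_int_def)
  have [measurable]: "w k \<in> borel_measurable borel" for k using intw[of k] by auto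
  have iw: "integrable lborel (\<lambda>x. w n x * indicator A x)" if "A \<in> sets borel" for A n
    using ii[OF that] by (simp add: w_def)
  have limH: "convergent (\<lambda>n. LINT x|lborel. w n x * indicator (H k) x)" for k
    using continuous_on_tendsto_compose[OF continuous_on_product_coordinates[of k] l]
    by (auto simp: X_def w_def convergent_def)
  \<comment> \<open>The sets on which the masses converge form a Dynkin system that contains the
    half-lines, hence comprise all Borel sets. The limit \<open>m\<close> is then a measure, and its
    density with respect to Lebesgue measure is the weak limit.\<close>
  define cv where "cv A \<longleftrightarrow> convergent (\<lambda>n. LINT x|lborel. w n x * indicator A x)" for A
  define m where "m A = lim (\<lambda>n. LINT x|lborel. w n x * indicator A x)" for A
  have cvm: "(\<lambda>n. LINT x|lborel. w n x * indicator A x) \<longlonglongrightarrow> m A" if "cv A" for A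
    using that by (simp add: cv_def m_def convergent_LIMSEQ_iff)
  have cv_union: "cv (\<Union>i. E i) \<and> (\<lambda>i. m (E i)) sums m (\<Union>i. E i)"
    if E: "range E \<subseteq> sets borel" "disjoint_family E" and cE: "\<And>i. cv (E i)" for E :: "nat \<Rightarrow> real set"
  proof -
    obtain L where "(\<lambda>i. m (E i)) sums L" "(\<lambda>n. LINT x|lborel. w n x * indicator (\<Union>i. E i) x) \<longlonglongrightarrow> L"
      using unif_int_disjoint_UN[OF w E cvm[OF cE]] by blast
    then show ?thesis by (auto simp: cv_def m_def convergent_def limI)
  qed
  have cv_UNIV: "cv UNIV" using limH[of 0] by (simp add: cv_def H_def)
  have cv_compl: "cv (- A)" if "cv A" and Ab: "A \<in> sets borel" for A
  proof -
    have "(LINT x|lborel. w n x * indicator (-A) x) = (LINT x|lborel. w n x * indicator UNIV x) - (LINT x|lborel. w n x * indicator A x)" for n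
    proof -
      have "w n x * indicator (-A) x = w n x * indicator UNIV x - w n x * indicator A x" for x
        by (auto simp: indicator_def)
      then show ?thesis using iw[OF Ab] iw[of UNIV n] by (simp del: indicator_UNIV)
    qed
    then show ?thesis using cv_UNIV \<open>cv A\<close> unfolding cv_def by (simp add: convergent_diff)
  qed
  define G where "G = (\<lambda>q. {..q::real}) ` \<rat>"
  have borelG: "sets borel = sigma_sets UNIV G"
  proof -
    have "borel = sigma UNIV G"
      unfolding G_def
    proof (rule borel_eq_sigmaI1[OF borel_eq_atMost])
      fix A assume "A \<in> range (\<lambda>a::real. {..a})"
      then obtain a where a: "A = {..a}" by auto
      have "{..a} = (\<Inter>q\<in>{q\<in>\<rat>. a \<le> q}. {..q})"
      proof (rule antisym)
        show "(\<Inter>q\<in>{q\<in>\<rat>. a \<le> q}. {..q}) \<subseteq> {..a}"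
        proof
          fix x assume x: "x \<in> (\<Inter>q\<in>{q\<in>\<rat>. a \<le> q}. {..q})"
          show "x \<in> {..a}"
          proof (rule ccontr)
            assume "x \<notin> {..a}"
            then obtain q where "q \<in> \<rat>" "a < q" "q < x" using Rats_dense_in_real[of a x] by auto
            with x show False by force
          qed
        qed
      qed auto
      moreover have "(\<Inter>q\<in>{q\<in>\<rat>. a \<le> q}. {..q}) \<in> sets (sigma UNIV ((\<lambda>q. {..q}) ` \<rat>))"
      proof (rule sets.countable_INT')
        show "countable {q\<in>\<rat>. a \<le> q}" by (rule countable_subset[OF _ countable_rat]) auto
        show "{q\<in>\<rat>. a \<le> q} \<noteq> {}" using Rats_dense_in_real[of a "a+1"] by force
      qed auto
      ultimately show "A \<in> sets (sigma UNIV ((\<lambda>q. {..q}) ` \<rat>))" by (simp add: a)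
    qed auto
    then show ?thesis by (metis sets_measure_of Pow_UNIV top_greatest)
  qed
  have cv: "cv A" if "A \<in> sets borel" for A
  proof -
    have "Int_stable G"
      unfolding Int_stable_def G_def
    proof safe
      fix a b :: real assume "a \<in> \<rat>" "b \<in> \<rat>"
      then show "{..a} \<inter> {..b} \<in> (\<lambda>q. {..q}) ` \<rat>" by (intro image_eqI[of _ _ "min a b"]) (auto simp: min_def)
    qed
    moreover have "G \<subseteq> Pow UNIV" by simp
    moreover have "A \<in> sigma_sets UNIV G" using that borelG by simp
    ultimately show ?thesis
    proof (induction rule: sigma_sets_induct_disjoint)
      case (basic A)
      then obtain q where q: "q \<in> \<rat>" "A = {..q}" by (auto simp: G_def)
      obtain k where "from_nat_into (\<rat>::real set) k = q"
        using from_nat_into_surj[OF countable_rat q(1)] by blast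
      then have "A = H (Suc k)" by (simp add: H_def q)
      then show ?case using limH[of "Suc k"] by (simp add: cv_def)
    next
      case empty then show ?case by (simp add: cv_def convergent_const)
    next
      case (compl A) then show ?case using cv_compl borelG by (simp add: Compl_eq_Diff_UNIV)
    next
      case (union E) then show ?case using cv_union borelG by simp
    qed
  qed
  have m_nonneg: "0 \<le> m A" if "A \<in> sets borel" for A
    by (rule LIMSEQ_le_const[OF cvm[OF cv[OF that]]]) (use nnw in \<open>auto intro!: exI[of _ 0] integral_nonneg_AE AE_I2\<close>)
  define \<mu> where "\<mu> = measure_of UNIV (sets (borel::real measure)) (\<lambda>A. ennreal (m A))"
  have sets\<mu>: "sets \<mu> = sets borel" unfolding \<mu>_def using sets.sigma_sets_eq[of "borel::real measure"] by simp
  have em: "emeasure \<mu> A = ennreal (m A)" if "A \<in> sets borel" for A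
  proof (rule emeasure_measure_of[OF \<mu>_def])
    show "positive (sets \<mu>) (\<lambda>A. ennreal (m A))"
      using m_nonneg by (simp add: positive_def) (simp add: m_def lim_const)
    show "countably_additive (sets \<mu>) (\<lambda>A. ennreal (m A))"
      unfolding countably_additive_def sets\<mu>
    proof (intro allI impI)
      fix E :: "nat \<Rightarrow> real set" assume E: "range E \<subseteq> sets borel" "disjoint_family E"
      then have *: "(\<lambda>i. m (E i)) sums m (\<Union>i. E i)" using cv_union[OF E] cv by auto
      have "(\<Sum>i. ennreal (m (E i))) = ennreal (\<Sum>i. m (E i))"
        using E * by (intro suminf_ennreal2) (auto intro: m_nonneg sums_summable)
      then show "(\<Sum>i. ennreal (m (E i))) = ennreal (m (\<Union>i. E i))" using sums_unique[OF *] by simp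
    qed
  qed (use that sets\<mu> in auto)
  have "absolutely_continuous lborel \<mu>"
    unfolding absolutely_continuous_def
  proof
    fix A assume A: "A \<in> null_sets (lborel :: real measure)"
    then have "A \<in> sets borel" by auto
    moreover have "(LINT x|lborel. w n x * indicator A x) = 0" for n
    proof -
      have "AE x in lborel. w n x * indicator A x = 0" using AE_not_in[OF A] by eventually_elim auto
      then show ?thesis by (rule integral_eq_zero_AE)
    qed
    then have "m A = 0" by (simp add: m_def lim_const)
    ultimately show "A \<in> null_sets \<mu>" using em[of A] sets\<mu> by (auto simp: null_sets_def)
  qed
  then obtain f where f: "f \<in> borel_measurable lborel" "density lborel f = \<mu>"
    using sigma_finite_measure.Radon_Nikodym[OF sigma_finite_lborel, of \<mu>] sets\<mu> by auto
  have [measurable]: "f \<in> borel_measurable borel" using f(1) by simp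
  have nnf: "(\<integral>\<^sup>+x. f x * indicator A x \<partial>lborel) = ennreal (m A)" if "A \<in> sets borel" for A
    using em[OF that] f(2) emeasure_density[of f lborel A] that by simp
  have "AE x in lborel. f x \<noteq> \<infinity>"
    using nnf[of UNIV] by (intro nn_integral_PInf_AE) auto
  then have fv: "AE x in lborel. f x = ennreal (enn2real (f x))"
    by eventually_elim (simp add: less_top)
  define v where "v x = enn2real (f x)" for x
  have [measurable]: "v \<in> borel_measurable borel" unfolding v_def by measurable
  have nnv: "(\<integral>\<^sup>+x. ennreal (v x * indicator A x) \<partial>lborel) = ennreal (m A)" if "A \<in> sets borel" for A
  proof -
    have "(\<integral>\<^sup>+x. ennreal (v x * indicator A x) \<partial>lborel) = (\<integral>\<^sup>+x. f x * indicator A x \<partial>lborel)"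
      using fv by (intro nn_integral_cong_AE) (auto simp: v_def indicator_def)
    with nnf[OF that] show ?thesis by simp
  qed
  have v0: "0 \<le> v x" for x by (simp add: v_def)
  have intv: "integrable lborel v"
    by (rule integrableI_nonneg) (use nnv[of UNIV] v0 in auto)
  have mv: "m A = (LINT x|lborel. v x * indicator A x)" if "A \<in> sets borel" for A
    using that nnv[OF that] v0 m_nonneg[OF that] by (subst integral_eq_nn_integral) (auto simp: indicator_def)
  have "weak_lim w v"
    unfolding weak_lim_def
  proof (intro ballI impI, elim exE)
    fix g :: "real \<Rightarrow> real" and C
    assume [measurable]: "g \<in> borel_measurable borel" and C: "\<forall>x. \<bar>g x\<bar> \<le> C"
    have C0: "0 \<le> C" using C[rule_format, of 0] by linarith
    \<comment> \<open>\<open>g\<close> is rounded down to multiples of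
      \<open>1 / real (Suc k)\<close>. As \<open>g\<close> is bounded, finitely many values remain,
      so convergence on Borel sets applies to \<open>gk k\<close>; the error is uniform in
      \<open>n\<close> because the masses are bounded by \<open>M\<close>.\<close>
    define gk where "gk k x = real_of_int \<lfloor>real (Suc k) * g x\<rfloor> / real (Suc k)" for k x
    have gk: "\<bar>g x - gk k x\<bar> \<le> 1 / real (Suc k)" for k x
    proof -
      have "\<bar>real (Suc k) * g x - real_of_int \<lfloor>real (Suc k) * g x\<rfloor>\<bar> \<le> 1" by linarith
      moreover have "g x - gk k x = (real (Suc k) * g x - real_of_int \<lfloor>real (Suc k) * g x\<rfloor>) / real (Suc k)"
        by (simp add: gk_def field_simps)
      ultimately show ?thesis by (simp add: divide_right_mono)
    qed
    have [measurable]: "gk k \<in> borel_measurable borel" for k unfolding gk_def by measurable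
    define J where "J k = {- \<lceil>real (Suc k) * C\<rceil> - 1 .. \<lceil>real (Suc k) * C\<rceil>}" for k
    define B where "B k j = {x. \<lfloor>real (Suc k) * g x\<rfloor> = j}" for k j
    have [measurable]: "B k j \<in> sets borel" for k j unfolding B_def by measurable
    have gkJ: "gk k x = (\<Sum>j\<in>J k. of_int j / real (Suc k) * indicator (B k j) x)" for k x
    proof -
      have "\<bar>real (Suc k) * g x\<bar> \<le> real (Suc k) * C" using C by (simp add: abs_mult mult_left_mono)
      then have "\<lfloor>real (Suc k) * g x\<rfloor> \<in> J k" unfolding J_def by (simp, linarith)
      moreover have "finite (J k)" by (simp add: J_def)
      ultimately show ?thesis
        by (subst sum.remove[of _ "\<lfloor>real (Suc k) * g x\<rfloor>"]) (auto simp: B_def gk_def intro!: sum.neutral)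
    qed
    have gkC: "\<bar>gk k x\<bar> \<le> C + 1" for k x
    proof -
      have "1 / real (Suc k) \<le> 1" by simp
      then show ?thesis using gk[of x k] C[rule_format, of x] by linarith
    qed
    have simple: "(LINT x|lborel. h x * gk k x) = (\<Sum>j\<in>J k. of_int j / real (Suc k) * (LINT x|lborel. h x * indicator (B k j) x))"
      if "integrable lborel h" for h k
    proof -
      have "integrable lborel (\<lambda>x. h x * indicator (B k j) x)" for j
        by (intro integrable_mult_bounded[OF that, where C=1]) (auto simp: indicator_def)
      then show ?thesis unfolding gkJ
        by (simp add: sum_distrib_left mult.left_commute[of "h _"] Bochner_Integration.integral_sum del: of_nat_Suc)
    qed
    have err: "\<bar>(LINT x|lborel. h x * g x) - (LINT x|lborel. h x * gk k x)\<bar> \<le> (LINT x|lborel. h x) / real (Suc k)"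
      if h: "integrable lborel h" "\<And>x. 0 \<le> h x" for h k
    proof -
      have [measurable]: "h \<in> borel_measurable borel" using h by auto
      have i: "integrable lborel (\<lambda>x. h x * g x)" "integrable lborel (\<lambda>x. h x * gk k x)"
        "integrable lborel (\<lambda>x. h x * (g x - gk k x))"
      proof -
        have *: "\<bar>g x\<bar> \<le> C + 1" "\<bar>g x - gk k x\<bar> \<le> 1" for x
          using C[rule_format, of x] order_trans[OF gk[of x k], of 1] by simp_all
        show "integrable lborel (\<lambda>x. h x * g x)" "integrable lborel (\<lambda>x. h x * gk k x)"
          by (rule integrable_mult_bounded[OF h(1), where C="C+1"]; use * gkC in simp)+
        show "integrable lborel (\<lambda>x. h x * (g x - gk k x))"
          by (rule integrable_mult_bounded[OF h(1), where C=1]) (use * in simp_all)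
      qed
      have "\<bar>LINT x|lborel. h x * (g x - gk k x)\<bar> \<le> (LINT x|lborel. h x * (1 / real (Suc k)))"
      proof (rule order_trans[OF integral_abs_bound integral_mono])
        show "\<bar>h x * (g x - gk k x)\<bar> \<le> h x * (1 / real (Suc k))" for x
          using mult_left_mono[OF gk h(2)] h(2) by (simp add: abs_mult)
      qed (use i h in auto)
      then show ?thesis using i by (simp add: right_diff_distrib)
    qed
    obtain L where L: "(\<lambda>k. LINT x|lborel. v x * gk k x) \<longlonglongrightarrow> L" "(\<lambda>n. LINT x|lborel. w n x * g x) \<longlonglongrightarrow> L"
    proof (rule uniform_approx_tendsto)
      show "(\<lambda>n. LINT x|lborel. w n x * gk k x) \<longlonglongrightarrow> (LINT x|lborel. v x * gk k x)" for k
        unfolding simple[OF intw] simple[OF intv]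
        by (intro tendsto_sum tendsto_mult_left) (simp add: cvm cv flip: mv)
      fix \<epsilon> :: real assume e: "0 < \<epsilon>"
      obtain k0 where k0: "(M + 1) / real (Suc k0) < \<epsilon>"
      proof -
        obtain k0 where "inverse (real (Suc k0)) < \<epsilon> / (M + 1)" using reals_Archimedean[of "\<epsilon> / (M+1)"] e M(1) by auto
        then show thesis using M(1) by (intro that[of k0]) (simp add: field_simps)
      qed
      have "\<bar>(LINT x|lborel. w n x * g x) - (LINT x|lborel. w n x * gk k x)\<bar> < \<epsilon>" if "k \<ge> k0" for k n
      proof -
        have "(LINT x|lborel. w n x) / real (Suc k) \<le> (M + 1) / real (Suc k0)"
          using M that by (intro frac_le) (auto simp: w_def intro: order_trans[OF M(2)])
        then show ?thesis using err[OF intw nnw, of n k] k0 by linarith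
      qed
      then show "\<exists>k0. \<forall>k\<ge>k0. \<forall>n. \<bar>(LINT x|lborel. w n x * g x) - (LINT x|lborel. w n x * gk k x)\<bar> < \<epsilon>" by blast
    qed (rule that)
    have "(\<lambda>k. LINT x|lborel. v x * gk k x) \<longlonglongrightarrow> (LINT x|lborel. v x * g x)"
    proof (rule LIMSEQ_I)
      fix \<epsilon> :: real assume e: "0 < \<epsilon>"
      have "(\<lambda>k. (LINT x|lborel. v x) / real (Suc k)) \<longlonglongrightarrow> 0"
        by (rule LIMSEQ_Suc[OF lim_const_over_n])
      then obtain k0 where k0: "\<And>k. k \<ge> k0 \<Longrightarrow> (LINT x|lborel. v x) / real (Suc k) < \<epsilon>"
        using order_tendstoD(2)[of _ "0::real" sequentially \<epsilon>] e unfolding eventually_sequentially by blast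
      have "norm ((LINT x|lborel. v x * gk k x) - (LINT x|lborel. v x * g x)) < \<epsilon>" if "k \<ge> k0" for k
        using err[OF intv v0, of k] k0[OF that] by (simp add: abs_minus_commute)
      then show "\<exists>no. \<forall>k\<ge>no. norm ((LINT x|lborel. v x * gk k x) - (LINT x|lborel. v x * g x)) < \<epsilon>" by blast
    qed
    with L show "(\<lambda>n. LINT x|lborel. w n x * g x) \<longlonglongrightarrow> (LINT x|lborel. v x * g x)"
      using LIMSEQ_unique by blast
  qed
  then show thesis using that[OF \<sigma> intv v0] unfolding w_def by blast
qed

section \<open>Shear and product integrals\<close>

abbreviation lborel2 :: "(real \<times> real) measure" where
  "lborel2 \<equiv> lborel \<Otimes>\<^sub>M lborel"

lemma sets_lborel2: "sets lborel2 = sets (borel \<Otimes>\<^sub>M borel)"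
  by (intro sets_pair_measure_cong) auto

lemma measurable_lborel2: "measurable lborel2 M = measurable (borel \<Otimes>\<^sub>M borel) M"
  by (intro measurable_cong_sets sets_lborel2) auto

text \<open>For a fixed second coordinate the map is a translation of the first, so Tonelli reduces
  the claim to translation invariance.\<close>

lemma distr_shear: "distr lborel2 lborel2 (\<lambda>z. (fst z + c * snd z, snd z)) = lborel2"
proof (rule measure_eqI)
  fix A assume "A \<in> sets (distr lborel2 lborel2 (\<lambda>z. (fst z + c * snd z, snd z)))"
  then have A[measurable]: "A \<in> sets lborel2" by simp
  have [measurable]: "A \<in> sets (borel \<Otimes>\<^sub>M borel)" using A sets_lborel2 by simp
  have [measurable]: "(\<lambda>z. (fst z + c * snd z, snd z)) \<in> measurable lborel2 lborel2"
    by measurable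
  have "emeasure (distr lborel2 lborel2 (\<lambda>z. (fst z + c * snd z, snd z))) A
      = (\<integral>\<^sup>+z. indicator A (fst z + c * snd z, snd z) \<partial>lborel2)"
  proof -
    have "emeasure (distr lborel2 lborel2 (\<lambda>z. (fst z + c * snd z, snd z))) A
      = (\<integral>\<^sup>+z. indicator A z \<partial>distr lborel2 lborel2 (\<lambda>z. (fst z + c * snd z, snd z)))"
      by simp
    also have "\<dots> = (\<integral>\<^sup>+z. indicator A (fst z + c * snd z, snd z) \<partial>lborel2)"
      by (rule nn_integral_distr) simp_all
    finally show ?thesis .
  qed
  also have "\<dots> = (\<integral>\<^sup>+y. \<integral>\<^sup>+x. indicator A (x + c * y, y) \<partial>lborel \<partial>lborel)"
    by (subst lborel_pair.nn_integral_snd[symmetric]) simp_all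
  also have "\<dots> = (\<integral>\<^sup>+y. \<integral>\<^sup>+x. indicator A (x, y) \<partial>lborel \<partial>lborel)"
  proof (rule nn_integral_cong)
    fix y :: real
    have "(\<lambda>x. indicator A (x, y) :: ennreal) \<in> borel_measurable borel" by measurable
    from nn_integral_real_affine[OF this, of 1 "c * y"]
    show "(\<integral>\<^sup>+x. indicator A (x + c * y, y) \<partial>lborel) = (\<integral>\<^sup>+x. indicator A (x, y) \<partial>lborel)"
      by (simp add: add.commute)
  qed
  also have "\<dots> = emeasure lborel2 A"
    by (subst lborel_pair.nn_integral_snd) simp_all
  finally show "emeasure (distr lborel2 lborel2 (\<lambda>z. (fst z + c * snd z, snd z))) A = emeasure lborel2 A" .
qed simp

lemma distr_swap: "distr lborel2 lborel2 (\<lambda>z. (snd z, fst z)) = lborel2"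
  using lborel_pair.distr_pair_swap[where ?'a=real and ?'b=real, symmetric] unfolding case_prod_unfold .

lemma shear_measurable: "(\<lambda>z. (fst z + c * snd z, snd z)) \<in> measurable lborel2 lborel2"
  and swap_measurable: "(\<lambda>z. (snd z, fst z)) \<in> measurable lborel2 lborel2"
  by measurable

lemma integral_shear:
  fixes F :: "real \<times> real \<Rightarrow> real"
  assumes "integrable lborel2 F"
  shows "integrable lborel2 (\<lambda>z. F (fst z + c * snd z, snd z))"
    and "(LINT z|lborel2. F (fst z + c * snd z, snd z)) = (LINT z|lborel2. F z)"
  using integrable_distr[OF shear_measurable[of c], of F] integral_distr[OF shear_measurable[of c], of F] assms
  by (simp_all add: distr_shear borel_measurable_integrable)

lemma integral_swap:
  fixes F :: "real \<times> real \<Rightarrow> real"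
  assumes "integrable lborel2 F"
  shows "integrable lborel2 (\<lambda>z. F (snd z, fst z))"
    and "(LINT z|lborel2. F (snd z, fst z)) = (LINT z|lborel2. F z)"
  using integrable_distr[OF swap_measurable, of F] integral_distr[OF swap_measurable, of F] assms
  by (simp_all add: distr_swap borel_measurable_integrable)

lemma nn_integral_shear:
  assumes [measurable]: "F \<in> borel_measurable lborel2"
  shows "(\<integral>\<^sup>+z. F (fst z + c * snd z, snd z) \<partial>lborel2) = (\<integral>\<^sup>+z. F z \<partial>lborel2)"
  using nn_integral_distr[OF shear_measurable[of c], of F] assms by (simp add: distr_shear)

lemma AE_shear:
  assumes "AE z in lborel2. P z"
  shows "AE z in lborel2. P (fst z + c * snd z, snd z)"
  by (rule AE_distrD[OF shear_measurable[of c]]) (simp only: distr_shear assms)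

lemma AE_swap:
  assumes "AE z in lborel2. P z"
  shows "AE z in lborel2. P (snd z, fst z)"
  by (rule AE_distrD[OF swap_measurable]) (simp only: distr_swap assms)

lemma
  fixes f g :: "real \<Rightarrow> real"
  assumes f: "integrable lborel f" and g: "integrable lborel g"
  shows integrable_lborel2_product: "integrable lborel2 (\<lambda>z. f (fst z) * g (snd z))"
    and integral_lborel2_product: "(LINT z|lborel2. f (fst z) * g (snd z)) = (LINT x|lborel. f x) * (LINT y|lborel. g y)"
proof -
  have [measurable]: "f \<in> borel_measurable borel" "g \<in> borel_measurable borel" using f g by auto
  show *: "integrable lborel2 (\<lambda>z. f (fst z) * g (snd z))"
  proof (rule lborel_pair.Fubini_integrable)
    show "integrable lborel (\<lambda>x. LINT y|lborel. norm (f (fst (x, y)) * g (snd (x, y))))"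
      using f by (simp add: abs_mult)
  qed (use g in auto)
  show "(LINT z|lborel2. f (fst z) * g (snd z)) = (LINT x|lborel. f x) * (LINT y|lborel. g y)"
    using lborel_pair.integral_fst'[OF *] by simp
qed

text \<open>The convolution-type gain term is integrated against \<open>h\<close> by shearing \<open>(x, y)\<close> to \<open>(x + y, y)\<close>.\<close>

lemma integral_gain:
  fixes F :: "real \<Rightarrow> real \<Rightarrow> real"
  assumes F: "integrable lborel2 (\<lambda>z. F (fst z) (snd z))"
    and h[measurable]: "h \<in> borel_measurable borel" and C: "\<And>x. \<bar>h x\<bar> \<le> C"
  shows "(LINT z|lborel. h z * (LINT y|lborel. F (z - y) y)) = (LINT z|lborel2. F (fst z) (snd z) * h (fst z + snd z))"
proof -
  have i: "integrable lborel2 (\<lambda>z. F (fst z) (snd z) * h (fst z + snd z))"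
    using C by (intro integrable_mult_bounded[OF F, where C=C]) auto
  note s = integral_shear[OF i, of "-1"]
  have "(LINT z|lborel2. F (fst z) (snd z) * h (fst z + snd z)) = (LINT z|lborel2. F (fst z - snd z) (snd z) * h (fst z))"
    using s(2) by simp
  also have "\<dots> = (LINT z|lborel. LINT y|lborel. F (z - y) y * h z)"
    using s(1) by (subst lborel_pair.integral_fst'[symmetric]) simp_all
  also have "\<dots> = (LINT z|lborel. h z * (LINT y|lborel. F (z - y) y))" by (simp add: mult.commute)
  finally show ?thesis by simp
qed

section \<open>Coagulation with sources\<close>

text \<open>Here \<open>K\<close> is a Borel function on the plane, extended by 0 off the open
  quadrant. Symmetry and nonnegativity then hold everywhere and all integrals may run over the whole
  line. A given kernel is brought to this form by
  \<open>borel_kernel_representative\<close>.\<close>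

locale coag =
  fixes lam k1 k2 :: real and K :: "real \<Rightarrow> real \<Rightarrow> real"
  assumes lam: "0 \<le> lam" and k1: "0 < k1" and k12: "k1 < k2"
    and K_meas[measurable]: "case_prod K \<in> borel_measurable (borel \<Otimes>\<^sub>M borel)"
    and K_sym: "K x y = K y x"
    and K_lower: "0 < x \<Longrightarrow> 0 < y \<Longrightarrow> k1 * (x powr lam + y powr lam) \<le> K x y"
    and K_upper: "0 < x \<Longrightarrow> 0 < y \<Longrightarrow> K x y \<le> k2 * (x powr lam + y powr lam)"
    and K_zero: "x \<le> 0 \<or> y \<le> 0 \<Longrightarrow> K x y = 0"
begin

lemma k2: "0 < k2" using k1 k12 by simp

lemma K_nonneg: "0 \<le> K x y"
  using K_lower[of x y] K_zero[of x y] k1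
  by (smt (verit, ccfv_threshold) mult_nonneg_nonneg powr_ge_zero)

text \<open>
  Test functions vanish outside \<open>U\<close>, so clusters whose size leaves \<open>U\<close> disappear; \<open>\<eta>\<close> is a removal
  rate. The weak formulation of the paper is the case \<open>\<eta> = 0\<close>, \<open>U = {0<..}\<close>.
\<close>

definition wsol :: "(real \<Rightarrow> real) \<Rightarrow> real \<Rightarrow> real set \<Rightarrow> (real \<Rightarrow> real) \<Rightarrow> bool" where
  "wsol S \<eta> U \<phi> \<longleftrightarrow>
     integrable lborel \<phi> \<and> integrable lborel (\<lambda>x. x powr lam * \<phi> x) \<and>
     (\<forall>x. 0 \<le> \<phi> x) \<and> (\<forall>x. x \<notin> U \<longrightarrow> \<phi> x = 0) \<and>
     (\<forall>\<theta>\<in>borel_measurable borel. (\<exists>C. \<forall>x. \<bar>\<theta> x\<bar> \<le> C) \<longrightarrow> (\<forall>x. x \<notin> U \<longrightarrow> \<theta> x = 0) \<longrightarrow>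
        (LINT z|lborel2. (\<theta> (fst z) + \<theta> (snd z) - \<theta> (fst z + snd z)) *
            (K (fst z) (snd z) * \<phi> (fst z) * \<phi> (snd z)))
        + 2 * \<eta> * (LINT x|lborel. \<theta> x * \<phi> x) = 2 * (LINT x|lborel. S x * \<theta> x))"

end

section \<open>The truncated problem\<close>

locale coag_trunc = coag +
  fixes R \<eta> N \<delta> :: real and S :: "real \<Rightarrow> real"
  assumes R: "0 < R" and \<eta>: "0 < \<eta>" and N: "0 \<le> N" and \<delta>: "0 < \<delta>"
    and S_meas[measurable]: "S \<in> borel_measurable borel"
    and S_nonneg: "0 \<le> S x" and S_le: "S x \<le> N" and S_zero: "x < \<delta> \<Longrightarrow> S x = 0"
begin

text \<open>
  The choice of \<open>B\<close> and \<open>c\<close> makes \<open>\<Psi>\<close> a supersolution: the source and the gain term are each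
  at most \<open>\<eta> \<Psi> / 2\<close>, because \<open>exp\<close> turns the self-convolution of \<open>\<Psi>\<close> into a multiple of \<open>\<Psi>\<close>.
\<close>

definition "U = {0<..<R}"
definition "\<kappa> = 2 * k2 * R powr lam"
definition "B = \<eta> / (\<kappa> * R)"
definition "c = 2 * N / (\<eta> * B * \<delta>)"
definition "\<Psi> x = (if x \<in> U then B * exp (c * x) else 0)"
definition "Bm = B * exp (c * R)"
definition "KU x y = K x y * indicator U x * indicator U y"
definition "A \<phi> z = \<eta> + (LINT y|lborel. \<phi> y * KU z y)"
definition "\<tau> \<phi> z = indicator U z * ((S z + 1 / 2 * (LINT y|lborel. \<phi> (z - y) * \<phi> y * KU (z - y) y)) / A \<phi> z)"
definition "adm \<phi> \<longleftrightarrow> \<phi> \<in> borel_measurable borel \<and> (\<forall>x. 0 \<le> \<phi> x \<and> \<phi> x \<le> \<Psi> x)"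

section \<open>Bounds for the truncated problem and invariance of the order interval\<close>

lemma U_meas[measurable]: "U \<in> sets borel" by (simp add: U_def)

lemma \<kappa>: "0 < \<kappa>" using k2 R by (simp add: \<kappa>_def)

lemma B: "0 < B" using \<kappa> R \<eta> by (simp add: B_def)

lemma c: "0 \<le> c" using N \<eta> B \<delta> by (simp add: c_def)

lemma Bm: "0 < Bm" using B by (simp add: Bm_def)

lemma \<Psi>_meas[measurable]: "\<Psi> \<in> borel_measurable borel"
  unfolding \<Psi>_def[abs_def] by measurable

lemma \<Psi>_nonneg: "0 \<le> \<Psi> x" using B by (simp add: \<Psi>_def)

lemma \<Psi>_le: "\<Psi> x \<le> Bm * indicator U x"
  using B c by (auto simp: \<Psi>_def Bm_def U_def mult_left_mono)

lemma KU_meas[measurable]: "case_prod KU \<in> borel_measurable (borel \<Otimes>\<^sub>M borel)"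
  unfolding KU_def[abs_def] by measurable

lemma KU_comp[measurable (raw)]:
  assumes [measurable]: "f \<in> borel_measurable M" "g \<in> borel_measurable M"
  shows "(\<lambda>x. KU (f x) (g x)) \<in> borel_measurable M"
proof -
  have "(\<lambda>x. case_prod KU (f x, g x)) \<in> borel_measurable M" by measurable
  then show ?thesis by simp
qed

lemma KU_nonneg: "0 \<le> KU x y" using K_nonneg by (simp add: KU_def)

lemma KU_le: "KU x y \<le> \<kappa>"
proof (cases "x \<in> U \<and> y \<in> U")
  case True
  then have xy: "0 < x" "x < R" "0 < y" "y < R" by (auto simp: U_def)
  have "x powr lam \<le> R powr lam" "y powr lam \<le> R powr lam"
    using xy lam by (auto intro!: powr_mono2)
  then have "k2 * (x powr lam + y powr lam) \<le> k2 * (R powr lam + R powr lam)"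
    using k2 by (intro mult_left_mono) auto
  then show ?thesis using K_upper[of x y] xy True by (simp add: KU_def \<kappa>_def)
qed (use \<kappa> in \<open>auto simp: KU_def\<close>)

lemma KU_abs_le: "\<bar>KU x y\<bar> \<le> \<kappa>" using KU_le[of x y] KU_nonneg[of x y] by simp

lemma KU_sym: "KU x y = KU y x" using K_sym by (simp add: KU_def mult.commute mult.left_commute)

lemma admD[measurable_dest]: "adm \<phi> \<Longrightarrow> \<phi> \<in> borel_measurable borel"
  and adm_nonneg: "adm \<phi> \<Longrightarrow> 0 \<le> \<phi> x"
  and adm_le: "adm \<phi> \<Longrightarrow> \<phi> x \<le> \<Psi> x"
  by (auto simp: adm_def)

lemma adm_le_Bm: "adm \<phi> \<Longrightarrow> \<phi> x \<le> Bm * indicator U x"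
  using adm_le \<Psi>_le order_trans by blast

lemma adm_zero: "adm \<phi> \<Longrightarrow> x \<notin> U \<Longrightarrow> \<phi> x = 0"
  using adm_le_Bm[of \<phi> x] adm_nonneg[of \<phi> x] by simp

lemma integrable_indU: "integrable lborel (indicator U :: real \<Rightarrow> real)"
  using R by (auto simp: U_def integrable_indicator_iff)

lemma adm_integrable: "adm \<phi> \<Longrightarrow> integrable lborel \<phi>"
  by (rule Bochner_Integration.integrable_bound[of _ "\<lambda>x. Bm * indicator U x"])
     (use integrable_indU adm_le_Bm adm_nonneg Bm in \<open>auto intro!: AE_I2\<close>)

lemma \<Psi>_adm: "adm \<Psi>" by (simp add: adm_def \<Psi>_nonneg)

lemma A_ge: "adm \<phi> \<Longrightarrow> \<eta> \<le> A \<phi> z"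
  unfolding A_def using adm_nonneg KU_nonneg by (simp add: integral_nonneg_AE)

lemma A_meas[measurable]:
  assumes "adm \<phi>" shows "A \<phi> \<in> borel_measurable borel"
proof -
  have [measurable]: "\<phi> \<in> borel_measurable borel" using assms by (rule admD)
  show ?thesis unfolding A_def[abs_def] by measurable
qed

lemma A_le: "adm \<phi> \<Longrightarrow> A \<phi> z \<le> \<eta> + \<kappa> * (LINT y|lborel. \<phi> y)"
proof -
  assume a: "adm \<phi>"
  have "(LINT y|lborel. \<phi> y * KU z y) \<le> (LINT y|lborel. \<kappa> * \<phi> y)"
  proof (rule integral_mono)
    show "integrable lborel (\<lambda>y. \<phi> y * KU z y)"
      using a KU_abs_le by (intro integrable_mult_bounded[OF adm_integrable[OF a], where C=\<kappa>]) measurable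
    show "\<phi> y * KU z y \<le> \<kappa> * \<phi> y" for y
      using mult_left_mono[OF KU_le adm_nonneg[OF a]] by (simp add: mult.commute)
  qed (use adm_integrable[OF a] in auto)
  then show ?thesis by (simp add: A_def)
qed

lemma \<tau>_meas[measurable]:
  assumes "adm \<phi>" shows "\<tau> \<phi> \<in> borel_measurable borel"
proof -
  have [measurable]: "\<phi> \<in> borel_measurable borel" "A \<phi> \<in> borel_measurable borel"
    using assms by (simp_all add: admD)
  show ?thesis unfolding \<tau>_def[abs_def] by measurable
qed

lemma \<tau>_adm: assumes a: "adm \<phi>" shows "adm (\<tau> \<phi>)"
  unfolding adm_def
proof (intro conjI allI)
  show "\<tau> \<phi> \<in> borel_measurable borel" using a by simp
  fix z
  have Q0: "0 \<le> (LINT y|lborel. \<phi> (z - y) * \<phi> y * KU (z - y) y)"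
    using adm_nonneg[OF a] KU_nonneg by (intro integral_nonneg_AE AE_I2) simp
  show "0 \<le> \<tau> \<phi> z"
    using Q0 S_nonneg[of z] A_ge[OF a, of z] \<eta> by (auto simp: \<tau>_def intro!: divide_nonneg_nonneg)
  show "\<tau> \<phi> z \<le> \<Psi> z"
  proof (cases "z \<in> U")
    case True
    then have z: "0 < z" "z < R" by (auto simp: U_def)
    have 1: "S z \<le> 1 / 2 * \<eta> * \<Psi> z"
    proof (cases "z < \<delta>")
      case False
      \<comment> \<open>Only sizes from \<open>\<delta>\<close> on remain, since \<open>S\<close>
        vanishes below. There \<open>exp (c * z)\<close> is at least \<open>c * \<delta>\<close>,
        and \<open>c\<close> was chosen to make this \<open>2 * N / (\<eta> * B)\<close>.\<close>
      have "2 * N / (\<eta> * B) = c * \<delta>" using \<delta> by (simp add: c_def)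
      also have "\<dots> \<le> c * z" using False c by (intro mult_left_mono) auto
      also have "\<dots> \<le> exp (c * z)" using exp_ge_add_one_self[of "c * z"] by linarith
      finally have "N \<le> 1 / 2 * \<eta> * (B * exp (c * z))" using \<eta> B by (simp add: field_simps)
      then show ?thesis using S_le[of z] True by (simp add: \<Psi>_def)
    qed (use S_zero \<Psi>_nonneg[of z] \<eta> in auto)
    have 2: "(LINT y|lborel. \<phi> (z - y) * \<phi> y * KU (z - y) y) \<le> \<eta> * \<Psi> z"
    proof -
      have "(LINT y|lborel. \<phi> (z - y) * \<phi> y * KU (z - y) y) \<le> (LINT y|lborel. \<kappa> * B * \<Psi> z * indicator U y)"
      proof (rule integral_mono_AE')
        show "AE y in lborel. \<phi> (z - y) * \<phi> y * KU (z - y) y \<le> \<kappa> * B * \<Psi> z * indicator U y"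
        proof (rule AE_I2)
          fix y
          show "\<phi> (z - y) * \<phi> y * KU (z - y) y \<le> \<kappa> * B * \<Psi> z * indicator U y"
          proof (cases "y \<in> U \<and> z - y \<in> U")
            case u: True
            have "\<phi> (z - y) * \<phi> y * KU (z - y) y \<le> \<Psi> (z - y) * \<Psi> y * \<kappa>"
              by (intro mult_mono adm_le[OF a] KU_le adm_nonneg[OF a] mult_nonneg_nonneg \<Psi>_nonneg KU_nonneg)
            also have "\<dots> = \<kappa> * B * \<Psi> z"
              using u True by (simp add: \<Psi>_def algebra_simps flip: exp_add)
            finally show ?thesis using u by simp
          next
            case False
            then have "\<phi> (z - y) * \<phi> y * KU (z - y) y = 0" using adm_zero[OF a] by auto
            moreover have "0 \<le> \<kappa> * B * \<Psi> z * indicator U y" using \<kappa> B \<Psi>_nonneg[of z] by simp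
            ultimately show ?thesis by linarith
          qed
        qed
      qed (use integrable_indU adm_nonneg[OF a] KU_nonneg \<kappa> B \<Psi>_nonneg in \<open>auto intro!: AE_I2\<close>)
      \<comment> \<open>Integration contributes the length \<open>R\<close> of \<open>U\<close>, and
        \<open>\<kappa> * B * R = \<eta>\<close> is how \<open>B\<close> was chosen.\<close>
      also have "\<dots> = \<kappa> * B * \<Psi> z * R" using R by (simp add: U_def)
      also have "\<dots> = \<eta> * \<Psi> z" using \<kappa> R by (simp add: B_def)
      finally show ?thesis .
    qed
    have "(S z + 1 / 2 * (LINT y|lborel. \<phi> (z - y) * \<phi> y * KU (z - y) y)) / A \<phi> z \<le> (\<eta> * \<Psi> z) / \<eta>"
      using 1 2 A_ge[OF a, of z] \<eta> \<Psi>_nonneg[of z] by (intro frac_le) auto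
    then show ?thesis using True \<eta> by (simp add: \<tau>_def)
  qed (use \<Psi>_nonneg[of z] in \<open>simp add: \<tau>_def\<close>)
qed

section \<open>Weak continuity of the fixed point map\<close>

lemma adm_pair_integrable:
  assumes a: "adm \<phi>"
  shows "integrable lborel2 (\<lambda>z. \<phi> (fst z) * \<phi> (snd z) * KU (fst z) (snd z))"
proof -
  have [measurable]: "\<phi> \<in> borel_measurable borel" using a by (rule admD)
  show ?thesis
    by (rule integrable_mult_bounded[OF integrable_lborel2_product[OF adm_integrable[OF a] adm_integrable[OF a]], where C=\<kappa>])
      (auto simp: KU_abs_le)
qed

lemma gain_test:
  assumes a: "adm \<phi>" and h[measurable]: "h \<in> borel_measurable borel" and C: "\<And>x. \<bar>h x\<bar> \<le> C"
  shows "(LINT z|lborel. h z * (LINT y|lborel. \<phi> (z - y) * \<phi> y * KU (z - y) y)) =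
         (LINT x|lborel. \<phi> x * (LINT y|lborel. \<phi> y * (KU x y * h (x + y))))"
proof -
  have [measurable]: "\<phi> \<in> borel_measurable borel" using a by (rule admD)
  have i: "integrable lborel2 (\<lambda>z. \<phi> (fst z) * \<phi> (snd z) * KU (fst z) (snd z) * h (fst z + snd z))"
    using C by (intro integrable_mult_bounded[OF adm_pair_integrable[OF a], where C=C]) auto
  have "(LINT z|lborel. h z * (LINT y|lborel. \<phi> (z - y) * \<phi> y * KU (z - y) y)) =
     (LINT z|lborel2. \<phi> (fst z) * \<phi> (snd z) * KU (fst z) (snd z) * h (fst z + snd z))"
    using integral_gain[of "\<lambda>x y. \<phi> x * \<phi> y * KU x y", OF adm_pair_integrable[OF a] h C] by simp
  also have "\<dots> = (LINT x|lborel. \<phi> x * (LINT y|lborel. \<phi> y * (KU x y * h (x + y))))"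
    using lborel_pair.integral_fst'[OF i] by (simp add: mult.assoc)
  finally show ?thesis .
qed

lemma adm_unif_int:
  assumes "\<And>n. adm (u n)"
  shows "unif_int u"
  unfolding unif_int_def
proof (intro conjI allI impI)
  fix \<epsilon> :: real assume e: "0 < \<epsilon>"
  have "(if \<bar>x\<bar> \<le> max R Bm \<and> u n x \<le> max R Bm then 0 else u n x) = 0" for n x
  proof (cases "x \<in> U")
    case True
    have "u n x \<le> Bm" using adm_le_Bm[OF assms, of n x] True by simp
    then show ?thesis using True by (auto simp: U_def)
  qed (use adm_zero[OF assms] in auto)
  then show "\<exists>N>0. \<forall>n. (LINT x|lborel. (if \<bar>x\<bar> \<le> N \<and> u n x \<le> N then 0 else u n x)) < \<epsilon>"
    using R e by (intro exI[of _ "max R Bm"]) auto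
qed (use assms adm_integrable adm_nonneg in auto)

text \<open>Shifting the denominator \<open>A \<phi>\<close> onto the test function turns the gain
  into the bilinear expression treated by \<open>weak_lim_bilinear\<close>, at the price of a test
  function that depends on \<open>\<phi>\<close>.\<close>

lemma \<tau>_integral:
  assumes a: "adm \<phi>" and h[measurable]: "h \<in> borel_measurable borel" and C: "\<And>x. \<bar>h x\<bar> \<le> C"
  shows "(LINT z|lborel. \<tau> \<phi> z * h z) = (LINT z|lborel. S z * (h z * indicator U z / A \<phi> z)) +
     1 / 2 * (LINT x|lborel. \<phi> x * (LINT y|lborel. \<phi> y * (KU x y * (h (x + y) * indicator U (x + y) / A \<phi> (x + y)))))"
proof -
  have [measurable]: "\<phi> \<in> borel_measurable borel" "A \<phi> \<in> borel_measurable borel" using a by (simp_all add: admD)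
  define r where "r z = h z * indicator U z / A \<phi> z" for z
  have [measurable]: "r \<in> borel_measurable borel" unfolding r_def[abs_def] by measurable
  have C0: "0 \<le> C" using C[of 0] by linarith
  have r: "\<bar>r z\<bar> \<le> C / \<eta>" for z
    using C[of z] A_ge[OF a, of z] \<eta> C0 by (auto simp: r_def abs_mult indicator_def intro!: frac_le)
  have rU: "r z = indicator U z * r z" for z by (simp add: r_def indicator_def)
  have i1: "integrable lborel (\<lambda>z. S z * r z)"
  proof (rule Bochner_Integration.integrable_bound[of _ "\<lambda>z. N * (C / \<eta>) * indicator U z"])
    show "AE z in lborel. norm (S z * r z) \<le> norm (N * (C / \<eta>) * indicator U z)"
    proof (rule AE_I2)
      fix z
      have "\<bar>S z\<bar> * \<bar>r z\<bar> \<le> N * (C / \<eta>)"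
        using S_nonneg[of z] S_le[of z] r[of z] N by (intro mult_mono) auto
      then show "norm (S z * r z) \<le> norm (N * (C / \<eta>) * indicator U z)"
        using N C0 \<eta> rU[of z] by (auto simp: abs_mult indicator_def)
    qed
  qed (use integrable_indU in auto)
  have i2: "integrable lborel (\<lambda>z. r z * (LINT y|lborel. \<phi> (z - y) * \<phi> y * KU (z - y) y))"
  proof -
    have "integrable lborel2 (\<lambda>z. \<phi> (fst z) * \<phi> (snd z) * KU (fst z) (snd z) * r (fst z + snd z))"
      using r by (intro integrable_mult_bounded[OF adm_pair_integrable[OF a], where C="C / \<eta>"]) auto
    from integral_shear(1)[OF this, of "-1"]
    have "integrable lborel2 (\<lambda>z. \<phi> (fst z - snd z) * \<phi> (snd z) * KU (fst z - snd z) (snd z) * r (fst z))"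
      by (simp only: fst_conv snd_conv mult_minus1 diff_conv_add_uminus[symmetric] diff_add_cancel)
    from lborel_pair.integrable_fst'[OF this]
    have "integrable lborel (\<lambda>z. (LINT y|lborel. \<phi> (z - y) * \<phi> y * KU (z - y) y) * r z)"
      by (simp only: fst_conv snd_conv integral_mult_left_zero)
    then show ?thesis by (simp only: mult.commute[of "r _"])
  qed
  have "(LINT z|lborel. \<tau> \<phi> z * h z) = (LINT z|lborel. S z * r z + 1 / 2 * (r z * (LINT y|lborel. \<phi> (z - y) * \<phi> y * KU (z - y) y)))"
  proof -
    have *: "i * ((s + 1 / 2 * q) / d) * t = s * (t * i / d) + 1 / 2 * (t * i / d * q)" for i s q d t :: real
      by (simp add: add_divide_distrib algebra_simps)
    show ?thesis by (simp only: \<tau>_def r_def *)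
  qed
  also have "\<dots> = (LINT z|lborel. S z * r z) + 1 / 2 * (LINT z|lborel. r z * (LINT y|lborel. \<phi> (z - y) * \<phi> y * KU (z - y) y))"
    using i1 i2 by (subst Bochner_Integration.integral_add) auto
  also have "(LINT z|lborel. r z * (LINT y|lborel. \<phi> (z - y) * \<phi> y * KU (z - y) y))
     = (LINT x|lborel. \<phi> x * (LINT y|lborel. \<phi> y * (KU x y * r (x + y))))"
    by (rule gain_test[OF a _ r]) measurable
  finally show ?thesis by (simp add: r_def)
qed

text \<open>Up to the constant \<open>\<eta>\<close>, \<open>A (u k) z\<close> is the pairing of
  \<open>u k\<close> with the bounded function \<open>KU z\<close>, so it converges at every
  \<open>z\<close>; moreover it stays above \<open>\<eta>\<close>. The modified test functions
  \<open>r (u k)\<close> hence converge pointwise and boundedly, as dominated convergence (for the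
  source) and \<open>weak_lim_bilinear\<close> (for the gain) require.\<close>

lemma \<tau>_weak_cont:
  assumes a: "\<And>k. adm (u k)" "adm v" and w: "weak_lim u v"
    and h[measurable]: "h \<in> borel_measurable borel" and C: "\<And>x. \<bar>h x\<bar> \<le> C"
  shows "(\<lambda>k. LINT z|lborel. \<tau> (u k) z * h z) \<longlonglongrightarrow> (LINT z|lborel. \<tau> v z * h z)"
proof -
  have [measurable]: "v \<in> borel_measurable borel" "A v \<in> borel_measurable borel" using a by (simp_all add: admD)
  have [measurable]: "u k \<in> borel_measurable borel" "A (u k) \<in> borel_measurable borel" for k using a by (simp_all add: admD)
  note ui = adm_unif_int[of u, OF a(1)]
  have C0: "0 \<le> C" using C[of 0] by linarith
  have limA: "(\<lambda>k. A (u k) z) \<longlonglongrightarrow> A v z" for z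
    unfolding A_def using KU_abs_le
    by (intro tendsto_add tendsto_const weak_lim_mult[OF ui w adm_integrable[OF a(2)], where C=\<kappa>]) measurable
  define r where "r \<phi> z = h z * indicator U z / A \<phi> z" for \<phi> z
  have [measurable]: "r v \<in> borel_measurable borel" "r (u k) \<in> borel_measurable borel" for k
    unfolding r_def[abs_def] by measurable
  have limr: "(\<lambda>k. r (u k) z) \<longlonglongrightarrow> r v z" for z
    unfolding r_def using limA[of z] A_ge[OF a(2), of z] \<eta> by (intro tendsto_divide tendsto_const) auto
  have r: "\<bar>r \<phi> z\<bar> \<le> C / \<eta>" if "adm \<phi>" for z \<phi>
    using C[of z] A_ge[OF that, of z] \<eta> C0 by (auto simp: r_def abs_mult indicator_def intro!: frac_le)
  have r': "\<bar>S z * r \<phi> z\<bar> \<le> N * (C / \<eta>) * indicator U z" if "adm \<phi>" for z \<phi>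
  proof -
    have "\<bar>S z\<bar> * \<bar>r \<phi> z\<bar> \<le> N * (C / \<eta>)"
      using S_nonneg[of z] S_le[of z] r[OF that, of z] N by (intro mult_mono) auto
    then show ?thesis by (auto simp: abs_mult indicator_def r_def)
  qed
  have 1: "(\<lambda>k. LINT z|lborel. S z * r (u k) z) \<longlonglongrightarrow> (LINT z|lborel. S z * r v z)"
  proof (rule integral_dominated_convergence[where w="\<lambda>z. N * (C / \<eta>) * indicator U z"])
    show "AE z in lborel. (\<lambda>k. S z * r (u k) z) \<longlonglongrightarrow> S z * r v z"
      by (intro AE_I2 tendsto_mult_left limr)
    show "AE z in lborel. norm (S z * r (u k) z) \<le> N * (C / \<eta>) * indicator U z" for k
      using r'[OF a(1)] by simp
  qed (use integrable_indU in auto)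
  have 2: "(\<lambda>k. LINT x|lborel. u k x * (LINT y|lborel. u k y * (KU x y * r (u k) (x + y))))
      \<longlonglongrightarrow> (LINT x|lborel. v x * (LINT y|lborel. v y * (KU x y * r v (x + y))))"
  proof (rule weak_lim_bilinear[OF ui w adm_integrable[OF a(2)], where C="\<kappa> * (C / \<eta>)"])
    show "\<bar>KU x y * r (u k) (x + y)\<bar> \<le> \<kappa> * (C / \<eta>)" for k x y
      unfolding abs_mult using KU_abs_le r[OF a(1)] \<kappa> by (intro mult_mono) auto
    show "(\<lambda>k. KU x y * r (u k) (x + y)) \<longlonglongrightarrow> KU x y * r v (x + y)" for x y
      by (intro tendsto_mult_left limr)
  qed measurable
  show ?thesis
    unfolding \<tau>_integral[OF a(1) h C] \<tau>_integral[OF a(2) h C] r_def[symmetric]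
    by (intro tendsto_add tendsto_mult_left 1 2)
qed

section \<open>Galerkin approximation by step multiples of \<open>\<Psi>\<close>\<close>

definition "cell n j = {real j * R / real n..<(real j + 1) * R / real n} \<inter> U"
definition "ix n x = nat \<lfloor>x * real n / R\<rfloor>"
definition "step n t x = t (ix n x) * \<Psi> x"

lemma cell_meas[measurable]: "cell n j \<in> sets borel"
  unfolding cell_def by measurable

lemma in_cell_iff:
  assumes "0 < n" "x \<in> U"
  shows "x \<in> cell n j \<longleftrightarrow> j = ix n x"
proof -
  have x: "0 < x" using assms by (simp add: U_def)
  have f: "\<lfloor>x * real n / R\<rfloor> = int j \<longleftrightarrow> real j \<le> x * real n / R \<and> x * real n / R < real j + 1"
    by (auto simp: floor_eq_iff)
  have "0 \<le> \<lfloor>x * real n / R\<rfloor>" using x R by simp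
  then have "j = ix n x \<longleftrightarrow> \<lfloor>x * real n / R\<rfloor> = int j" unfolding ix_def by linarith
  also have "\<dots> \<longleftrightarrow> x \<in> cell n j" unfolding f using assms R by (simp add: cell_def field_simps)
  finally show ?thesis by simp
qed

lemma ix_less: "0 < n \<Longrightarrow> x \<in> U \<Longrightarrow> ix n x < n"
proof -
  assume n: "0 < n" and x: "x \<in> U"
  then have "x * real n / R < real n" using R by (simp add: U_def field_simps)
  then have "\<lfloor>x * real n / R\<rfloor> < int n" by linarith
  then show ?thesis unfolding ix_def using n by linarith
qed

lemma ix_meas[measurable]: "ix n \<in> measurable borel (count_space UNIV)"
  unfolding ix_def[abs_def] by measurable

lemma step_adm:
  assumes "\<And>j. 0 \<le> t j \<and> t j \<le> 1"
  shows "adm (step n t)"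
  unfolding adm_def step_def[abs_def]
  using assms \<Psi>_nonneg by (auto intro!: mult_nonneg_nonneg mult_left_le_one_le)

lemma adm_test_integrable:
  assumes "adm \<phi>" "h \<in> borel_measurable borel" "\<And>x. \<bar>h x\<bar> \<le> C"
  shows "integrable lborel (\<lambda>x. \<phi> x * h x)"
  using assms by (intro integrable_mult_bounded[OF adm_integrable[OF assms(1)], where C=C]) auto

lemma step_weak_lim:
  assumes X: "\<And>k j. 0 \<le> X k j \<and> X k j \<le> 1" and t: "\<And>j. 0 \<le> t j \<and> t j \<le> 1"
    and lim: "\<And>j. j < n \<Longrightarrow> (\<lambda>k. X k j) \<longlonglongrightarrow> t j" and n: "0 < n"
  shows "weak_lim (\<lambda>k. step n (X k)) (step n t)"
  unfolding weak_lim_def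
proof (intro ballI impI, elim exE)
  fix g :: "real \<Rightarrow> real" and C assume [measurable]: "g \<in> borel_measurable borel" and C: "\<forall>x. \<bar>g x\<bar> \<le> C"
  have [measurable]: "step n t \<in> borel_measurable borel" "step n (X k) \<in> borel_measurable borel" for k
    using admD[OF step_adm] X t by auto
  show "(\<lambda>k. LINT x|lborel. step n (X k) x * g x) \<longlonglongrightarrow> (LINT x|lborel. step n t x * g x)"
  proof (rule integral_dominated_convergence[where w="\<lambda>x. C * \<Psi> x"])
    show "AE x in lborel. (\<lambda>k. step n (X k) x * g x) \<longlonglongrightarrow> step n t x * g x"
    proof (rule AE_I2)
      fix x show "(\<lambda>k. step n (X k) x * g x) \<longlonglongrightarrow> step n t x * g x"
      proof (cases "x \<in> U")
        case True
        then show ?thesis unfolding step_def by (intro tendsto_mult_right lim ix_less n)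
      qed (simp add: step_def \<Psi>_def)
    qed
    show "AE x in lborel. norm (step n (X k) x * g x) \<le> C * \<Psi> x" for k
    proof (rule AE_I2)
      fix x
      have "\<bar>step n (X k) x\<bar> * \<bar>g x\<bar> \<le> \<Psi> x * C"
        using adm_le[OF step_adm[of "X k" n], of x] adm_nonneg[OF step_adm[of "X k" n], of x] X C \<Psi>_nonneg[of x]
        by (intro mult_mono) auto
      then show "norm (step n (X k) x * g x) \<le> C * \<Psi> x" by (simp add: abs_mult mult.commute)
    qed
  qed (use adm_integrable[OF \<Psi>_adm] in auto)
qed

text \<open>
  The ansatz \<open>step n t\<close> scales \<open>\<Psi>\<close> by a constant \<open>t j \<in> [0, 1]\<close> on each cell, so the cube \<open>[0, 1]\<^sup>n\<close>
  is mapped to itself.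
\<close>

lemma galerkin:
  assumes n: "0 < n"
  obtains \<phi> where "adm \<phi>"
    "\<And>j. j < n \<Longrightarrow> (LINT x|lborel. \<phi> x * indicator (cell n j) x) = (LINT x|lborel. \<tau> \<phi> x * indicator (cell n j) x)"
proof -
  define p where "p j = (LINT x|lborel. \<Psi> x * indicator (cell n j) x)" for j
  \<comment> \<open>\<open>p j\<close> bounds the mass of every admissible function on the cell.
    Should \<open>p j\<close> be 0, division by zero returns 0, which lies in the cube, and the
    masses to be compared both vanish.\<close>
  define G where "G t j = (LINT x|lborel. \<tau> (step n t) x * indicator (cell n j) x) / p j" for t j
  have ic: "\<bar>indicator (cell n j) x :: real\<bar> \<le> 1" for j x by (simp add: indicator_def)
  have p0: "0 \<le> p j" for j unfolding p_def using \<Psi>_nonneg by (intro integral_nonneg_AE AE_I2) auto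
  have le_p: "0 \<le> (LINT x|lborel. \<phi> x * indicator (cell n j) x)" "(LINT x|lborel. \<phi> x * indicator (cell n j) x) \<le> p j"
    if a: "adm \<phi>" for \<phi> j
  proof -
    show "0 \<le> (LINT x|lborel. \<phi> x * indicator (cell n j) x)"
      using adm_nonneg[OF a] by (intro integral_nonneg_AE AE_I2) auto
    show "(LINT x|lborel. \<phi> x * indicator (cell n j) x) \<le> p j"
      unfolding p_def
      by (intro integral_mono adm_test_integrable[OF a _ ic] adm_test_integrable[OF \<Psi>_adm _ ic] mult_right_mono adm_le[OF a]) auto
  qed
  have cube: "0 \<le> t j \<and> t j \<le> 1" if "t \<in> (\<Pi>\<^sub>E i\<in>UNIV. {0..1::real})" for t and j :: nat
    using that by (auto simp: PiE_iff)
  obtain t where t: "t \<in> (\<Pi>\<^sub>E i\<in>UNIV. {0..1::real})" and fx: "\<And>i. i < n \<Longrightarrow> G t i = t i"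
  proof (rule brouwer_cube_nat[of n G])
    fix t :: "nat \<Rightarrow> real" and i assume "t \<in> (\<Pi>\<^sub>E i\<in>UNIV. {0..1::real})"
    then have "adm (\<tau> (step n t))" by (intro \<tau>_adm step_adm cube)
    from le_p[OF this, of i] show "G t i \<in> {0..1}" unfolding G_def using p0[of i] by (auto simp: divide_le_eq)
  next
    fix X :: "nat \<Rightarrow> nat \<Rightarrow> real" and t :: "nat \<Rightarrow> real" and i
    assume X: "\<And>k. X k \<in> (\<Pi>\<^sub>E i\<in>UNIV. {0..1::real})" and t: "t \<in> (\<Pi>\<^sub>E i\<in>UNIV. {0..1::real})"
      and lim: "\<And>j. j < n \<Longrightarrow> (\<lambda>k. X k j) \<longlonglongrightarrow> t j"
    have "(\<lambda>k. LINT x|lborel. \<tau> (step n (X k)) x * indicator (cell n i) x) \<longlonglongrightarrow> (LINT x|lborel. \<tau> (step n t) x * indicator (cell n i) x)"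
      by (rule \<tau>_weak_cont[OF step_adm step_adm step_weak_lim _ ic]) (use cube X t lim n in auto)
    then show "(\<lambda>k. G (X k) i) \<longlonglongrightarrow> G t i"
      unfolding G_def divide_inverse by (rule tendsto_mult_right)
  qed (rule that)
  have a: "adm (step n t)" by (intro step_adm cube t)
  show thesis
  proof (rule that[OF a])
    fix j assume j: "j < n"
    have "step n t x * indicator (cell n j) x = t j * (\<Psi> x * indicator (cell n j) x)" for x
    proof (cases "x \<in> cell n j")
      case True
      moreover from this have "x \<in> U" by (simp add: cell_def)
      ultimately have "ix n x = j" using in_cell_iff[OF n] by simp
      then show ?thesis by (simp add: step_def)
    qed simp
    then have 1: "(LINT x|lborel. step n t x * indicator (cell n j) x) = t j * p j" unfolding p_def by (simp only: integral_mult_right_zero)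
    show "(LINT x|lborel. step n t x * indicator (cell n j) x) = (LINT x|lborel. \<tau> (step n t) x * indicator (cell n j) x)"
    proof (cases "p j = 0")
      case True
      then show ?thesis using 1 le_p[OF \<tau>_adm[OF a], of j] by simp
    next
      case False
      then show ?thesis using 1 fx[OF j] by (simp add: G_def field_simps)
    qed
  qed
qed

text \<open>Inside \<open>U\<close>, a half-line consists of full cells up to a piece within an
  interval of length \<open>R / real n\<close>. On full cells the masses agree, on the rest the two
  functions differ by at most \<open>Bm\<close>. Half-lines serve as tests because they do not
  depend on \<open>n\<close> and determine a finite measure.\<close>

lemma galerkin_tail_error:
  assumes n: "0 < n" and a: "adm \<phi>"
    and eq: "\<And>j. j < n \<Longrightarrow> (LINT x|lborel. \<phi> x * indicator (cell n j) x) = (LINT x|lborel. \<tau> \<phi> x * indicator (cell n j) x)"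
  shows "\<bar>(LINT x|lborel. \<phi> x * indicator {b<..} x) - (LINT x|lborel. \<tau> \<phi> x * indicator {b<..} x)\<bar> \<le> Bm * R / real n"
proof -
  note a' = \<tau>_adm[OF a]
  have [measurable]: "\<phi> \<in> borel_measurable borel" "\<tau> \<phi> \<in> borel_measurable borel" using a a' by (simp_all add: admD)
  define J where "J = {j. j < n \<and> b < real j * R / real n}"
  have J: "finite J" by (simp add: J_def)
  define \<rho> where "\<rho> x = indicator {b<..} x - (\<Sum>j\<in>J. indicator (cell n j) x :: real)" for x
  have [measurable]: "\<rho> \<in> borel_measurable borel" unfolding \<rho>_def[abs_def] by measurable
  have \<rho>: "\<bar>\<rho> x\<bar> \<le> indicator {b..b + R / real n} x" if x: "x \<in> U" for x
  proof -
    have "indicator (cell n j) x = (if j = ix n x then 1 else (0::real))" for j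
      using in_cell_iff[OF n x, of j] by (simp add: indicator_def)
    then have s: "(\<Sum>j\<in>J. indicator (cell n j) x :: real) = (if ix n x \<in> J then 1 else 0)"
      using J by simp
    have "x \<in> cell n (ix n x)" using in_cell_iff[OF n x] by simp
    then have x1: "real (ix n x) * R / real n \<le> x" "x < real (ix n x) * R / real n + R / real n"
      by (auto simp: cell_def distrib_right add_divide_distrib)
    show ?thesis
    proof (cases "ix n x \<in> J")
      case True
      then have "b < x" using x1 by (simp add: J_def)
      then show ?thesis using True s by (simp add: \<rho>_def)
    next
      case False
      then have "real (ix n x) * R / real n \<le> b" using ix_less[OF n x] by (auto simp: J_def)
      then have "x \<le> b + R / real n" using x1 by linarith
      then show ?thesis using False s by (auto simp: \<rho>_def indicator_def)
    qed
  qed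
  have i: "integrable lborel (\<lambda>x. \<psi> x * indicator E x)" if "adm \<psi>" "E \<in> sets borel" for \<psi> E
    using that by (intro adm_test_integrable[where C=1]) (auto simp: indicator_def)
  have split: "(LINT x|lborel. \<psi> x * indicator {b<..} x) = (LINT x|lborel. \<psi> x * \<rho> x) + (\<Sum>j\<in>J. LINT x|lborel. \<psi> x * indicator (cell n j) x)"
    and i\<rho>: "integrable lborel (\<lambda>x. \<psi> x * \<rho> x)" if "adm \<psi>" for \<psi>
  proof -
    have isum: "integrable lborel (\<lambda>x. \<Sum>j\<in>J. \<psi> x * indicator (cell n j) x)"
      by (intro Bochner_Integration.integrable_sum i that) measurable
    have \<rho>_eq: "(\<lambda>x. \<psi> x * \<rho> x) = (\<lambda>x. \<psi> x * indicator {b<..} x - (\<Sum>j\<in>J. \<psi> x * indicator (cell n j) x))"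
      by (simp add: \<rho>_def right_diff_distrib sum_distrib_left)
    moreover have "integrable lborel (\<lambda>x. \<psi> x * indicator {b<..} x - (\<Sum>j\<in>J. \<psi> x * indicator (cell n j) x))"
      by (intro Bochner_Integration.integrable_diff isum i that) measurable
    ultimately show "integrable lborel (\<lambda>x. \<psi> x * \<rho> x)" by simp
    have "(LINT x|lborel. \<psi> x * \<rho> x) = (LINT x|lborel. \<psi> x * indicator {b<..} x - (\<Sum>j\<in>J. \<psi> x * indicator (cell n j) x))"
      unfolding \<rho>_eq ..
    also have "\<dots> = (LINT x|lborel. \<psi> x * indicator {b<..} x) - (LINT x|lborel. (\<Sum>j\<in>J. \<psi> x * indicator (cell n j) x))"
      by (intro Bochner_Integration.integral_diff isum i that) measurable
    also have "(LINT x|lborel. (\<Sum>j\<in>J. \<psi> x * indicator (cell n j) x)) = (\<Sum>j\<in>J. LINT x|lborel. \<psi> x * indicator (cell n j) x)"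
      by (intro Bochner_Integration.integral_sum i that) measurable
    finally show "(LINT x|lborel. \<psi> x * indicator {b<..} x) = (LINT x|lborel. \<psi> x * \<rho> x) + (\<Sum>j\<in>J. LINT x|lborel. \<psi> x * indicator (cell n j) x)"
      by simp
  qed
  have "(\<Sum>j\<in>J. LINT x|lborel. \<phi> x * indicator (cell n j) x) = (\<Sum>j\<in>J. LINT x|lborel. \<tau> \<phi> x * indicator (cell n j) x)"
    by (intro sum.cong refl eq) (simp add: J_def)
  then have "(LINT x|lborel. \<phi> x * indicator {b<..} x) - (LINT x|lborel. \<tau> \<phi> x * indicator {b<..} x)
      = (LINT x|lborel. \<phi> x * \<rho> x) - (LINT x|lborel. \<tau> \<phi> x * \<rho> x)"
    unfolding split[OF a] split[OF a'] by simp
  also have "\<dots> = (LINT x|lborel. \<phi> x * \<rho> x - \<tau> \<phi> x * \<rho> x)"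
    by (intro Bochner_Integration.integral_diff[symmetric] i\<rho> a a')
  finally have "\<bar>(LINT x|lborel. \<phi> x * indicator {b<..} x) - (LINT x|lborel. \<tau> \<phi> x * indicator {b<..} x)\<bar>
      = \<bar>LINT x|lborel. \<phi> x * \<rho> x - \<tau> \<phi> x * \<rho> x\<bar>" by simp
  also have "\<dots> \<le> (LINT x|lborel. Bm * indicator {b..b + R / real n} x)"
  proof (rule order_trans[OF integral_abs_bound integral_mono])
    show "integrable lborel (\<lambda>x. \<bar>\<phi> x * \<rho> x - \<tau> \<phi> x * \<rho> x\<bar>)"
      by (intro integrable_abs Bochner_Integration.integrable_diff i\<rho> a a')
    show "integrable lborel (\<lambda>x. Bm * indicator {b..b + R / real n} x)"
      using integrable_indicator_Icc by simp
    fix x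
    show "\<bar>\<phi> x * \<rho> x - \<tau> \<phi> x * \<rho> x\<bar> \<le> Bm * indicator {b..b + R / real n} x"
    proof (cases "x \<in> U")
      case True
      have "\<phi> x \<le> Bm" "\<tau> \<phi> x \<le> Bm" using adm_le_Bm[OF a, of x] adm_le_Bm[OF a', of x] True by simp_all
      then have "\<bar>\<phi> x - \<tau> \<phi> x\<bar> \<le> Bm" using adm_nonneg[OF a, of x] adm_nonneg[OF a', of x] by linarith
      then have "\<bar>\<phi> x - \<tau> \<phi> x\<bar> * \<bar>\<rho> x\<bar> \<le> Bm * indicator {b..b + R / real n} x"
        using \<rho>[OF True] Bm by (intro mult_mono) auto
      then show ?thesis by (simp add: abs_mult flip: left_diff_distrib)
    next
      case False
      then show ?thesis using adm_zero[OF a, of x] adm_zero[OF a', of x] Bm by simp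
    qed
  qed
  also have "\<dots> = Bm * R / real n" using R n by simp
  finally show ?thesis .
qed

text \<open>In the limit of the Galerkin scheme \<open>\<phi>\<close> and
  \<open>\<tau> \<phi>\<close> have the same mass on every half-line, hence define the same finite
  measure, and equal measures have densities that agree almost everywhere.\<close>

lemma fixed_point:
  obtains \<phi> where "adm \<phi>" "AE x in lborel. \<phi> x = \<tau> \<phi> x"
proof -
  have "\<exists>\<phi>. adm \<phi> \<and> (\<forall>j<Suc n. (LINT x|lborel. \<phi> x * indicator (cell (Suc n) j) x) = (LINT x|lborel. \<tau> \<phi> x * indicator (cell (Suc n) j) x))" for n
    using galerkin[of "Suc n"] by blast
  then obtain u where u: "\<And>n. adm (u n)"
    and ueq: "\<And>n j. j < Suc n \<Longrightarrow> (LINT x|lborel. u n x * indicator (cell (Suc n) j) x) = (LINT x|lborel. \<tau> (u n) x * indicator (cell (Suc n) j) x)"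
    by metis
  obtain \<sigma> v where \<sigma>: "strict_mono \<sigma>" and v: "integrable lborel v" "\<And>x. 0 \<le> v x" and w: "weak_lim (\<lambda>n. u (\<sigma> n)) v"
    using unif_int_weak_subsequence[OF adm_unif_int[of u, OF u]] by blast
  have [measurable]: "v \<in> borel_measurable borel" using v by auto
  \<comment> \<open>An upper bound survives a weak limit only almost everywhere: testing with the
    set \<open>E\<close> on which it fails shows that \<open>v\<close> has no excess there. Cutting
    \<open>v\<close> back to \<open>\<Psi>\<close> makes the bound hold everywhere, as
    \<open>adm\<close> demands.\<close>
  define E where "E = {x. \<Psi> x < v x}"
  have [measurable]: "E \<in> sets borel" unfolding E_def by measurable
  have E1: "\<bar>indicator E x :: real\<bar> \<le> 1" for x by (simp add: indicator_def)
  have iv: "integrable lborel (\<lambda>x. v x * indicator E x)" by (rule integrable_mult_bounded[OF v(1) _ E1]) simp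
  have i\<Psi>: "integrable lborel (\<lambda>x. \<Psi> x * indicator E x)" by (rule adm_test_integrable[OF \<Psi>_adm _ E1]) simp
  have "(LINT x|lborel. v x * indicator E x) \<le> (LINT x|lborel. \<Psi> x * indicator E x)"
  proof (rule LIMSEQ_le_const2)
    show "(\<lambda>n. LINT x|lborel. u (\<sigma> n) x * indicator E x) \<longlonglongrightarrow> (LINT x|lborel. v x * indicator E x)"
      by (rule w[unfolded weak_lim_def, rule_format]) (use E1 in auto)
    have "(LINT x|lborel. u (\<sigma> n) x * indicator E x) \<le> (LINT x|lborel. \<Psi> x * indicator E x)" for n
      by (intro integral_mono adm_test_integrable[OF u _ E1] i\<Psi> mult_right_mono adm_le[OF u]) auto
    then show "\<exists>N. \<forall>n\<ge>N. (LINT x|lborel. u (\<sigma> n) x * indicator E x) \<le> (LINT x|lborel. \<Psi> x * indicator E x)" by blast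
  qed
  then have "(LINT x|lborel. v x * indicator E x - \<Psi> x * indicator E x) \<le> 0" using iv i\<Psi> by simp
  moreover have nn: "0 \<le> v x * indicator E x - \<Psi> x * indicator E x" for x by (simp add: E_def indicator_def)
  ultimately have "(LINT x|lborel. v x * indicator E x - \<Psi> x * indicator E x) = 0"
    by (intro antisym integral_nonneg_AE AE_I2) auto
  then have "AE x in lborel. v x * indicator E x - \<Psi> x * indicator E x = 0"
    using integral_nonneg_eq_0_iff_AE[of lborel "\<lambda>x. v x * indicator E x - \<Psi> x * indicator E x"] iv i\<Psi> nn by simp
  then have v\<Psi>: "AE x in lborel. v x = min (v x) (\<Psi> x)"
    by eventually_elim (auto simp: E_def indicator_def split: if_splits)
  define \<phi> where "\<phi> x = min (v x) (\<Psi> x)" for x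
  have [measurable]: "\<phi> \<in> borel_measurable borel" unfolding \<phi>_def[abs_def] by measurable
  have a: "adm \<phi>" using v(2) \<Psi>_nonneg by (simp add: adm_def \<phi>_def)
  have w': "weak_lim (\<lambda>n. u (\<sigma> n)) \<phi>"
    unfolding weak_lim_def
  proof (intro ballI impI)
    fix g :: "real \<Rightarrow> real" assume g[measurable]: "g \<in> borel_measurable borel" and C: "\<exists>C. \<forall>x. \<bar>g x\<bar> \<le> C"
    have "(LINT x|lborel. v x * g x) = (LINT x|lborel. \<phi> x * g x)"
      using v\<Psi> by (intro integral_cong_AE) (auto simp: \<phi>_def)
    then show "(\<lambda>n. LINT x|lborel. u (\<sigma> n) x * g x) \<longlonglongrightarrow> (LINT x|lborel. \<phi> x * g x)"
      using w[unfolded weak_lim_def, rule_format, OF g] C by auto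
  qed
  have tail: "(LINT x|lborel. \<phi> x * indicator {b<..} x) = (LINT x|lborel. \<tau> \<phi> x * indicator {b<..} x)" for b
  proof -
    have ib: "\<bar>indicator {b<..} x :: real\<bar> \<le> 1" for x by (simp add: indicator_def)
    have 1: "(\<lambda>n. LINT x|lborel. u (\<sigma> n) x * indicator {b<..} x) \<longlonglongrightarrow> (LINT x|lborel. \<phi> x * indicator {b<..} x)"
      by (rule w'[unfolded weak_lim_def, rule_format]) (use ib in auto)
    have 2: "(\<lambda>n. LINT x|lborel. \<tau> (u (\<sigma> n)) x * indicator {b<..} x) \<longlonglongrightarrow> (LINT x|lborel. \<tau> \<phi> x * indicator {b<..} x)"
      by (rule \<tau>_weak_cont[OF u a w' _ ib]) simp
    have "(\<lambda>n. Bm * R / real (Suc (\<sigma> n))) \<longlonglongrightarrow> 0"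
      using LIMSEQ_subseq_LIMSEQ[OF LIMSEQ_Suc[OF lim_const_over_n[of "Bm * R"]] \<sigma>] by (simp add: o_def)
    then have "(\<lambda>n. (LINT x|lborel. u (\<sigma> n) x * indicator {b<..} x) - (LINT x|lborel. \<tau> (u (\<sigma> n)) x * indicator {b<..} x)) \<longlonglongrightarrow> 0"
      by (rule Lim_null_comparison[rotated])
         (use galerkin_tail_error[OF _ u ueq] in \<open>auto intro!: always_eventually simp del: of_nat_Suc\<close>)
    with tendsto_diff[OF 1 2] show ?thesis using LIMSEQ_unique by fastforce
  qed
  note a' = \<tau>_adm[OF a]
  have [measurable]: "\<tau> \<phi> \<in> borel_measurable borel" using a' by (simp add: admD)
  have em: "emeasure (density lborel (\<lambda>x. ennreal (\<psi> x))) {b<..} = ennreal (LINT x|lborel. \<psi> x * indicator {b<..} x)"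
    if p: "adm \<psi>" for \<psi> b
  proof -
    have [measurable]: "\<psi> \<in> borel_measurable borel" using p by (rule admD)
    have "emeasure (density lborel (\<lambda>x. ennreal (\<psi> x))) {b<..} = (\<integral>\<^sup>+x. ennreal (\<psi> x * indicator {b<..} x) \<partial>lborel)"
      by (subst emeasure_density) (auto intro!: nn_integral_cong simp: indicator_def)
    also have "\<dots> = ennreal (LINT x|lborel. \<psi> x * indicator {b<..} x)"
      using adm_nonneg[OF p] by (intro nn_integral_eq_integral adm_test_integrable[OF p, where C=1]) (auto simp: indicator_def)
    finally show ?thesis .
  qed
  have "density lborel (\<lambda>x. ennreal (\<phi> x)) = density lborel (\<lambda>x. ennreal (\<tau> \<phi> x))"
    by (rule measure_eqI_lessThan) (simp_all add: em[OF a] em[OF a'] tail)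
  then have "AE x in lborel. ennreal (\<phi> x) = ennreal (\<tau> \<phi> x)"
    using sigma_finite_measure.density_unique[OF sigma_finite_lborel, of "\<lambda>x. ennreal (\<phi> x)" "\<lambda>x. ennreal (\<tau> \<phi> x)"] by simp
  then have "AE x in lborel. \<phi> x = \<tau> \<phi> x"
    by eventually_elim (simp add: adm_nonneg[OF a] adm_nonneg[OF a'])
  with a show thesis by (rule that)
qed

text \<open>Testing the fixed point equation with \<open>\<theta> * A \<phi>\<close> cancels the
  denominator. The loss then involves \<open>\<theta>\<close> at one of the two clusters only and is
  symmetrised by exchanging the variables, which accounts for the factors 2 in
  \<open>wsol\<close>.\<close>

lemma truncated_solution: "\<exists>\<phi>. wsol S \<eta> U \<phi>"
proof -
  obtain \<phi> where a: "adm \<phi>" and fp: "AE x in lborel. \<phi> x = \<tau> \<phi> x" by (rule fixed_point)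
  have [measurable]: "\<phi> \<in> borel_measurable borel" "A \<phi> \<in> borel_measurable borel" "\<tau> \<phi> \<in> borel_measurable borel"
    using a by (simp_all add: admD)
  note int = adm_integrable[OF a]
  have int_lam: "integrable lborel (\<lambda>x. x powr lam * \<phi> x)"
  proof (rule Bochner_Integration.integrable_bound[of _ "\<lambda>x. R powr lam * \<phi> x"])
    show "AE x in lborel. norm (x powr lam * \<phi> x) \<le> norm (R powr lam * \<phi> x)"
    proof (rule AE_I2)
      fix x show "norm (x powr lam * \<phi> x) \<le> norm (R powr lam * \<phi> x)"
      proof (cases "x \<in> U")
        case True
        then have "x powr lam \<le> R powr lam" using lam by (intro powr_mono2) (auto simp: U_def)
        then show ?thesis using adm_nonneg[OF a, of x] by (simp add: mult_right_mono)
      qed (use adm_zero[OF a] in simp)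
    qed
  qed (use int in auto)
  have "wsol S \<eta> U \<phi>"
    unfolding wsol_def
  proof (intro conjI ballI impI allI)
    fix \<theta> :: "real \<Rightarrow> real"
    assume [measurable]: "\<theta> \<in> borel_measurable borel" and "\<exists>C. \<forall>x. \<bar>\<theta> x\<bar> \<le> C" and \<theta>0: "\<forall>x. x \<notin> U \<longrightarrow> \<theta> x = 0"
    then obtain C where C: "\<And>x. \<bar>\<theta> x\<bar> \<le> C" by blast
    have \<theta>U: "\<theta> z * indicator U z = \<theta> z" for z using \<theta>0 by (cases "z \<in> U") auto
    have C0: "0 \<le> C" using C[of 0] by linarith
    define D where "D = \<eta> + \<kappa> * (LINT y|lborel. \<phi> y)"
    have A: "\<bar>A \<phi> z\<bar> \<le> D" for z using A_le[OF a, of z] A_ge[OF a, of z] \<eta> by (simp add: D_def)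
    have \<theta>A: "\<bar>\<theta> z * A \<phi> z\<bar> \<le> C * D" for z unfolding abs_mult using C A C0 by (intro mult_mono) auto
    have A0: "A \<phi> z \<noteq> 0" for z using A_ge[OF a, of z] \<eta> by simp
    define P where "P z = \<phi> (fst z) * \<phi> (snd z) * KU (fst z) (snd z)" for z
    have P: "integrable lborel2 P" unfolding P_def[abs_def] by (rule adm_pair_integrable[OF a])
    have P_eq: "K (fst z) (snd z) * \<phi> (fst z) * \<phi> (snd z) = P z" for z
      using adm_zero[OF a, of "fst z"] adm_zero[OF a, of "snd z"] by (auto simp: P_def KU_def indicator_def)
    have iP: "integrable lborel2 (\<lambda>z. P z * \<theta> (fst z))" "integrable lborel2 (\<lambda>z. P z * \<theta> (snd z))"
      "integrable lborel2 (\<lambda>z. P z * \<theta> (fst z + snd z))"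
      using C by (auto intro!: integrable_mult_bounded[OF P, where C=C])
    have 1: "(LINT z|lborel. \<phi> z * (\<theta> z * A \<phi> z)) = (LINT z|lborel. S z * \<theta> z) + 1 / 2 * (LINT z|lborel2. P z * \<theta> (fst z + snd z))"
    proof -
      have "(LINT z|lborel. \<phi> z * (\<theta> z * A \<phi> z)) = (LINT z|lborel. \<tau> \<phi> z * (\<theta> z * A \<phi> z))"
        using fp by (intro integral_cong_AE) auto
      also have "\<dots> = (LINT z|lborel. S z * \<theta> z) + 1 / 2 * (LINT x|lborel. \<phi> x * (LINT y|lborel. \<phi> y * (KU x y * \<theta> (x + y))))"
        by (subst \<tau>_integral[OF a _ \<theta>A]) (simp_all add: A0 \<theta>U mult.assoc)
      also have "(LINT x|lborel. \<phi> x * (LINT y|lborel. \<phi> y * (KU x y * \<theta> (x + y)))) = (LINT z|lborel2. P z * \<theta> (fst z + snd z))"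
        using lborel_pair.integral_fst'[OF iP(3)] by (simp add: P_def mult.assoc)
      finally show ?thesis .
    qed
    have 2: "(LINT z|lborel. \<phi> z * (\<theta> z * A \<phi> z)) = \<eta> * (LINT x|lborel. \<theta> x * \<phi> x) + (LINT z|lborel2. P z * \<theta> (fst z))"
    proof -
      have i1: "integrable lborel (\<lambda>x. \<eta> * (\<phi> x * \<theta> x))" using adm_test_integrable[OF a _ C] by simp
      have i2: "integrable lborel (\<lambda>x. LINT y|lborel. P (x, y) * \<theta> x)"
        using lborel_pair.integrable_fst'[OF iP(1)] by simp
      have "\<phi> z * (\<theta> z * A \<phi> z) = \<eta> * (\<phi> z * \<theta> z) + (LINT y|lborel. P (z, y) * \<theta> z)" for z
      proof -
        have "(LINT y|lborel. P (z, y) * \<theta> z) = \<phi> z * \<theta> z * (LINT y|lborel. \<phi> y * KU z y)"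
          by (simp add: P_def mult.assoc mult.commute[of _ "\<theta> z"] mult.left_commute[of _ "\<theta> z"])
        then show ?thesis by (simp only: A_def distrib_left mult_ac)
      qed
      then have "(LINT z|lborel. \<phi> z * (\<theta> z * A \<phi> z)) = (LINT z|lborel. \<eta> * (\<phi> z * \<theta> z) + (LINT y|lborel. P (z, y) * \<theta> z))"
        by simp
      also have "\<dots> = (LINT z|lborel. \<eta> * (\<phi> z * \<theta> z)) + (LINT z|lborel. LINT y|lborel. P (z, y) * \<theta> z)"
        by (rule Bochner_Integration.integral_add[OF i1 i2])
      also have "(LINT z|lborel. LINT y|lborel. P (z, y) * \<theta> z) = (LINT z|lborel2. P z * \<theta> (fst z))"
        using lborel_pair.integral_fst'[OF iP(1)] by simp
      finally show ?thesis by (simp add: mult.commute)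
    qed
    have 3: "(LINT z|lborel2. P z * \<theta> (snd z)) = (LINT z|lborel2. P z * \<theta> (fst z))"
    proof -
      have "P (snd z, fst z) = P z" for z
        using KU_sym[of "fst z" "snd z"] by (simp add: P_def mult.commute)
      then show ?thesis using integral_swap(2)[OF iP(1)] by simp
    qed
    have "(LINT z|lborel2. (\<theta> (fst z) + \<theta> (snd z) - \<theta> (fst z + snd z)) * (K (fst z) (snd z) * \<phi> (fst z) * \<phi> (snd z)))
       = (LINT z|lborel2. P z * \<theta> (fst z) + P z * \<theta> (snd z) - P z * \<theta> (fst z + snd z))"
      unfolding P_eq by (simp add: algebra_simps)
    also have "\<dots> = (LINT z|lborel2. P z * \<theta> (fst z)) + (LINT z|lborel2. P z * \<theta> (snd z)) - (LINT z|lborel2. P z * \<theta> (fst z + snd z))"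
      using iP by simp
    finally show "(LINT z|lborel2. (\<theta> (fst z) + \<theta> (snd z) - \<theta> (fst z + snd z)) * (K (fst z) (snd z) * \<phi> (fst z) * \<phi> (snd z)))
        + 2 * \<eta> * (LINT x|lborel. \<theta> x * \<phi> x) = 2 * (LINT x|lborel. S x * \<theta> x)"
      using 1 2 3 by linarith
  qed (use int int_lam adm_nonneg[OF a] adm_zero[OF a] in auto)
  then show ?thesis by blast
qed

end

section \<open>A priori estimates\<close>

context coag
begin

lemma K_comp[measurable (raw)]:
  assumes [measurable]: "f \<in> borel_measurable M" "g \<in> borel_measurable M"
  shows "(\<lambda>x. K (f x) (g x)) \<in> borel_measurable M"
proof -
  have "(\<lambda>x. case_prod K (f x, g x)) \<in> borel_measurable M" by measurable
  then show ?thesis by simp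
qed

definition "rate \<phi> z = K (fst z) (snd z) * \<phi> (fst z) * \<phi> (snd z)"

lemma wsol_integrable: "wsol S \<eta> U \<phi> \<Longrightarrow> integrable lborel \<phi>"
  and wsol_integrable_lam: "wsol S \<eta> U \<phi> \<Longrightarrow> integrable lborel (\<lambda>x. x powr lam * \<phi> x)"
  and wsol_nonneg: "wsol S \<eta> U \<phi> \<Longrightarrow> 0 \<le> \<phi> x"
  and wsol_zero: "wsol S \<eta> U \<phi> \<Longrightarrow> x \<notin> U \<Longrightarrow> \<phi> x = 0"
  by (auto simp: wsol_def)

lemma wsol_meas: "wsol S \<eta> U \<phi> \<Longrightarrow> \<phi> \<in> borel_measurable borel"
  using wsol_integrable[of S \<eta> U \<phi>] by auto

lemma wsol_eq:
  assumes "wsol S \<eta> U \<phi>" "\<theta> \<in> borel_measurable borel" "\<And>x. \<bar>\<theta> x\<bar> \<le> C" "\<And>x. x \<notin> U \<Longrightarrow> \<theta> x = 0"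
  shows "(LINT z|lborel2. (\<theta> (fst z) + \<theta> (snd z) - \<theta> (fst z + snd z)) * rate \<phi> z)
        + 2 * \<eta> * (LINT x|lborel. \<theta> x * \<phi> x) = 2 * (LINT x|lborel. S x * \<theta> x)"
  using assms unfolding wsol_def rate_def by blast

lemma
  assumes w: "wsol S \<eta> U \<phi>" and U: "U \<subseteq> {0<..}"
  shows rate_meas: "rate \<phi> \<in> borel_measurable (borel \<Otimes>\<^sub>M borel)"
    and rate_nonneg: "0 \<le> rate \<phi> z"
    and rate_ge: "k1 * (fst z powr lam + snd z powr lam) * (\<phi> (fst z) * \<phi> (snd z)) \<le> rate \<phi> z"
    and rate_le: "rate \<phi> z \<le> k2 * (fst z powr lam + snd z powr lam) * (\<phi> (fst z) * \<phi> (snd z))"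
    and rate_integrable: "integrable lborel2 (rate \<phi>)"
proof -
  have [measurable]: "\<phi> \<in> borel_measurable borel" using w by (rule wsol_meas)
  show rm: "rate \<phi> \<in> borel_measurable (borel \<Otimes>\<^sub>M borel)" unfolding rate_def[abs_def] by measurable
  note nn = wsol_nonneg[OF w]
  show r0: "0 \<le> rate \<phi> z" for z unfolding rate_def using nn K_nonneg by simp
  have pp0: "0 \<le> \<phi> (fst z) * \<phi> (snd z)" for z using nn by simp
  have z: "\<phi> x = 0" if "x \<le> 0" for x using wsol_zero[OF w, of x] U that by force
  show "k1 * (fst z powr lam + snd z powr lam) * (\<phi> (fst z) * \<phi> (snd z)) \<le> rate \<phi> z" for z
  proof (cases "0 < fst z \<and> 0 < snd z")
    case True
    then show ?thesis using mult_right_mono[OF K_lower pp0, of "fst z" "snd z" z] by (simp add: rate_def mult.assoc)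
  next
    case False
    then have "\<phi> (fst z) = 0 \<or> \<phi> (snd z) = 0" using z by force
    then show ?thesis by (auto simp: rate_def)
  qed
  show rl: "rate \<phi> z \<le> k2 * (fst z powr lam + snd z powr lam) * (\<phi> (fst z) * \<phi> (snd z))" for z
  proof (cases "0 < fst z \<and> 0 < snd z")
    case True
    then show ?thesis using mult_right_mono[OF K_upper pp0, of "fst z" "snd z" z] by (simp add: rate_def mult.assoc)
  next
    case False
    then have "\<phi> (fst z) = 0 \<or> \<phi> (snd z) = 0" using z by force
    then show ?thesis by (auto simp: rate_def)
  qed
  note i = wsol_integrable[OF w] and il = wsol_integrable_lam[OF w]
  have ib: "integrable lborel2 (\<lambda>z. k2 * ((fst z powr lam * \<phi> (fst z)) * \<phi> (snd z)) + k2 * (\<phi> (fst z) * (snd z powr lam * \<phi> (snd z))))"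
    using integrable_lborel2_product[OF i il] integrable_lborel2_product[OF il i] by simp
  show "integrable lborel2 (rate \<phi>)"
  proof (rule Bochner_Integration.integrable_bound[OF ib])
    show "rate \<phi> \<in> borel_measurable lborel2" using rm measurable_lborel2 by blast
    have "norm (rate \<phi> z) \<le> norm (k2 * (fst z powr lam * \<phi> (fst z) * \<phi> (snd z)) + k2 * (\<phi> (fst z) * (snd z powr lam * \<phi> (snd z))))" for z
      using rl[of z] r0[of z] by (simp add: algebra_simps)
    then show "AE z in lborel2. norm (rate \<phi> z) \<le> norm (k2 * (fst z powr lam * \<phi> (fst z) * \<phi> (snd z)) + k2 * (\<phi> (fst z) * (snd z powr lam * \<phi> (snd z))))"
      by simp
  qed
qed

lemma rate_test_integrable:
  assumes w: "wsol S \<eta> U \<phi>" and U: "U \<subseteq> {0<..}"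
    and g: "g \<in> borel_measurable (borel \<Otimes>\<^sub>M borel)" and C: "\<And>z. \<bar>g z\<bar> \<le> C"
  shows "integrable lborel2 (\<lambda>z. g z * rate \<phi> z)"
  using integrable_mult_bounded[OF rate_integrable[OF w U], of g C] g C measurable_lborel2
  by (simp add: mult.commute)

text \<open>The common frame of \<open>tail_estimate\<close>, \<open>antimono_estimate\<close> and
  \<open>total_upper\<close>: it remains to choose \<open>\<theta>\<close> and to bound its defect
  \<open>\<theta> x + \<theta> y - \<theta> (x + y)\<close> from below on \<open>U\<close>, because
  \<open>rate\<close> vanishes elsewhere. In each case \<open>f\<close> is built from products of
  functions of one variable, so that its integral factorises.\<close>

lemma wsol_test_ineq:
  assumes w: "wsol S \<eta> U \<phi>" and U: "U \<subseteq> {0<..}"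
    and \<theta>[measurable]: "\<theta> \<in> borel_measurable borel" and C: "\<And>x. \<bar>\<theta> x\<bar> \<le> C" and \<theta>0: "\<And>x. x \<notin> U \<Longrightarrow> \<theta> x = 0"
    and f: "integrable lborel2 f"
    and le: "\<And>z. fst z \<in> U \<Longrightarrow> snd z \<in> U \<Longrightarrow> f z \<le> (\<theta> (fst z) + \<theta> (snd z) - \<theta> (fst z + snd z)) * rate \<phi> z"
    and f0: "\<And>z. fst z \<notin> U \<or> snd z \<notin> U \<Longrightarrow> f z = 0"
  shows "(LINT z|lborel2. f z) + 2 * \<eta> * (LINT x|lborel. \<theta> x * \<phi> x) \<le> 2 * (LINT x|lborel. S x * \<theta> x)"
proof -
  have "(LINT z|lborel2. f z) \<le> (LINT z|lborel2. (\<theta> (fst z) + \<theta> (snd z) - \<theta> (fst z + snd z)) * rate \<phi> z)"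
  proof (rule integral_mono[OF f])
    have "\<bar>\<theta> (fst z) + \<theta> (snd z) - \<theta> (fst z + snd z)\<bar> \<le> 3 * C" for z
      using C[of "fst z"] C[of "snd z"] C[of "fst z + snd z"] by linarith
    then show "integrable lborel2 (\<lambda>z. (\<theta> (fst z) + \<theta> (snd z) - \<theta> (fst z + snd z)) * rate \<phi> z)"
      by (intro rate_test_integrable[OF w U, where C="3 * C"]) auto
    show "f z \<le> (\<theta> (fst z) + \<theta> (snd z) - \<theta> (fst z + snd z)) * rate \<phi> z" for z
    proof (cases "fst z \<in> U \<and> snd z \<in> U")
      case False
      then have "\<phi> (fst z) = 0 \<or> \<phi> (snd z) = 0" using wsol_zero[OF w] by blast
      then show ?thesis using False f0[of z] by (auto simp: rate_def)
    qed (use le in blast)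
  qed
  then show ?thesis using wsol_eq[OF w \<theta> C \<theta>0] by linarith
qed

text \<open>\<open>min x A\<close> is subadditive, and its defect is at least \<open>A\<close> when
  both sizes reach \<open>A\<close>; there \<open>K\<close> is at least
  \<open>2 * k1 * A powr lam\<close>. Keeping only this region leaves the square of the tail. Sums
  that leave \<open>U\<close> only increase the defect.\<close>

lemma tail_estimate:
  assumes w: "wsol S \<eta> U \<phi>" and U: "U \<subseteq> {0<..}" and [measurable]: "U \<in> sets borel"
    and \<eta>: "0 \<le> \<eta>" and A: "0 < A"
  shows "k1 * A powr (1 + lam) * (LINT x|lborel. \<phi> x * indicator {A..} x)\<^sup>2
     \<le> (LINT x|lborel. S x * (min x A * indicator U x))"
proof -
  have [measurable]: "\<phi> \<in> borel_measurable borel" using w by (rule wsol_meas)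
  define \<theta> where "\<theta> x = min x A * indicator U x" for x
  have [measurable]: "\<theta> \<in> borel_measurable borel" unfolding \<theta>_def[abs_def] by measurable
  have \<theta>: "0 \<le> \<theta> x" "\<theta> x \<le> A" for x using U A by (auto simp: \<theta>_def indicator_def)
  define h where "h x = \<phi> x * indicator {A..} x" for x
  have h: "integrable lborel h" unfolding h_def[abs_def]
    by (intro integrable_mult_bounded[OF wsol_integrable[OF w], where C=1]) (auto simp: indicator_def)
  define f where "f z = 2 * k1 * A powr (1 + lam) * (h (fst z) * h (snd z))" for z
  have f: "integrable lborel2 f" unfolding f_def[abs_def]
    using integrable_lborel2_product[OF h h] by simp
  have "(LINT z|lborel2. f z) + 2 * \<eta> * (LINT x|lborel. \<theta> x * \<phi> x) \<le> 2 * (LINT x|lborel. S x * \<theta> x)"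
  proof (rule wsol_test_ineq[OF w U _ _ _ f])
    show "\<bar>\<theta> x\<bar> \<le> A" for x using \<theta> by simp
    show "\<theta> x = 0" if "x \<notin> U" for x using that by (simp add: \<theta>_def)
    show "f z = 0" if "fst z \<notin> U \<or> snd z \<notin> U" for z
      using that wsol_zero[OF w, of "fst z"] wsol_zero[OF w, of "snd z"] by (auto simp: f_def h_def)
    fix z :: "real \<times> real" assume z: "fst z \<in> U" "snd z \<in> U"
    then have pos: "0 < fst z" "0 < snd z" using U by auto
    have le: "\<theta> (fst z + snd z) \<le> min (fst z + snd z) A" using pos A by (simp add: \<theta>_def indicator_def)
    show "f z \<le> (\<theta> (fst z) + \<theta> (snd z) - \<theta> (fst z + snd z)) * rate \<phi> z"
    proof (cases "A \<le> fst z \<and> A \<le> snd z")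
      case True
      have "A powr lam \<le> fst z powr lam" "A powr lam \<le> snd z powr lam" using True A lam by (auto intro!: powr_mono2)
      then have "k1 * (2 * A powr lam) \<le> k1 * (fst z powr lam + snd z powr lam)" using k1 by (intro mult_left_mono) auto
      then have "k1 * (2 * A powr lam) * (\<phi> (fst z) * \<phi> (snd z)) \<le> k1 * (fst z powr lam + snd z powr lam) * (\<phi> (fst z) * \<phi> (snd z))"
        by (rule mult_right_mono) (simp add: wsol_nonneg[OF w])
      also have "\<dots> \<le> rate \<phi> z" by (rule rate_ge[OF w U])
      finally have 1: "k1 * (2 * A powr lam) * (\<phi> (fst z) * \<phi> (snd z)) \<le> rate \<phi> z" .
      have "f z = A * (k1 * (2 * A powr lam) * (\<phi> (fst z) * \<phi> (snd z)))"
        using True A by (simp add: f_def h_def powr_add)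
      also have "\<dots> \<le> A * rate \<phi> z" using 1 A by (intro mult_left_mono) auto
      also have "\<dots> \<le> (\<theta> (fst z) + \<theta> (snd z) - \<theta> (fst z + snd z)) * rate \<phi> z"
        using True z \<theta>(2)[of "fst z + snd z"] rate_nonneg[OF w U, of z] by (intro mult_right_mono) (auto simp: \<theta>_def)
      finally show ?thesis .
    next
      case False
      have "0 \<le> \<theta> (fst z) + \<theta> (snd z) - \<theta> (fst z + snd z)"
      proof -
        have "\<theta> (fst z) = min (fst z) A" "\<theta> (snd z) = min (snd z) A" using z by (simp_all add: \<theta>_def)
        moreover have "min (fst z + snd z) A \<le> min (fst z) A + min (snd z) A" using pos A by (auto simp: min_def)
        ultimately show ?thesis using le by linarith
      qed
      then have "0 \<le> (\<theta> (fst z) + \<theta> (snd z) - \<theta> (fst z + snd z)) * rate \<phi> z"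
        using rate_nonneg[OF w U, of z] by simp
      moreover have "f z = 0" using False by (auto simp: f_def h_def indicator_def)
      ultimately show ?thesis by simp
    qed
  qed measurable
  moreover have "(LINT z|lborel2. f z) = 2 * k1 * A powr (1 + lam) * (LINT x|lborel. h x)\<^sup>2"
    unfolding f_def using integral_lborel2_product[OF h h] by (simp add: power2_eq_square)
  moreover have "0 \<le> 2 * \<eta> * (LINT x|lborel. \<theta> x * \<phi> x)"
    using \<eta> \<theta>(1) wsol_nonneg[OF w] by (intro mult_nonneg_nonneg integral_nonneg_AE AE_I2) auto
  ultimately show ?thesis unfolding h_def \<theta>_def by linarith
qed

text \<open>For nonincreasing \<open>\<theta>\<close> one has
  \<open>\<theta> (x + y) \<le> \<theta> y\<close>, so the defect is at least
  \<open>\<theta> x\<close>, while \<open>K\<close> is at least \<open>k1 * y powr lam\<close>. With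
  the variables separated in this way, the moment of order \<open>lam\<close> appears as a coercive
  factor.\<close>

lemma antimono_estimate:
  assumes w: "wsol S \<eta> U \<phi>" and U: "U \<subseteq> {0<..}" and [measurable]: "U \<in> sets borel"
    and \<theta>m[measurable]: "\<theta> \<in> borel_measurable borel" and \<theta>0: "\<And>x. 0 \<le> \<theta> x" and \<theta>C: "\<And>x. \<theta> x \<le> C"
    and anti: "\<And>x y. 0 < x \<Longrightarrow> x \<le> y \<Longrightarrow> \<theta> y \<le> \<theta> x"
  shows "(k1 * (LINT x|lborel. x powr lam * \<phi> x) + 2 * \<eta>) * (LINT x|lborel. \<theta> x * \<phi> x)
     \<le> 2 * (LINT x|lborel. S x * (\<theta> x * indicator U x))"
proof -
  have [measurable]: "\<phi> \<in> borel_measurable borel" using w by (rule wsol_meas)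
  define t where "t x = \<theta> x * indicator U x" for x
  have [measurable]: "t \<in> borel_measurable borel" unfolding t_def[abs_def] by measurable
  have t\<phi>: "t x * \<phi> x = \<theta> x * \<phi> x" for x using wsol_zero[OF w, of x] by (auto simp: t_def indicator_def)
  have h: "integrable lborel (\<lambda>x. \<theta> x * \<phi> x)"
    using integrable_mult_bounded[OF wsol_integrable[OF w], of \<theta> C] \<theta>0 \<theta>C by (simp add: mult.commute)
  define f where "f z = k1 * ((\<theta> (fst z) * \<phi> (fst z)) * (snd z powr lam * \<phi> (snd z)))" for z
  have f: "integrable lborel2 f" unfolding f_def[abs_def]
    using integrable_lborel2_product[OF h wsol_integrable_lam[OF w]] by simp
  have "(LINT z|lborel2. f z) + 2 * \<eta> * (LINT x|lborel. t x * \<phi> x) \<le> 2 * (LINT x|lborel. S x * t x)"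
  proof (rule wsol_test_ineq[OF w U _ _ _ f])
    show "\<bar>t x\<bar> \<le> C" for x using \<theta>0[of x] \<theta>C[of x] by (auto simp: t_def indicator_def)
    show "t x = 0" if "x \<notin> U" for x using that by (simp add: t_def)
    show "f z = 0" if "fst z \<notin> U \<or> snd z \<notin> U" for z
      using that wsol_zero[OF w, of "fst z"] wsol_zero[OF w, of "snd z"] by (auto simp: f_def)
    fix z :: "real \<times> real" assume z: "fst z \<in> U" "snd z \<in> U"
    then have pos: "0 < fst z" "0 < snd z" using U by auto
    have "t (fst z + snd z) \<le> \<theta> (snd z)" using pos anti[of "snd z" "fst z + snd z"] \<theta>0 by (auto simp: t_def indicator_def)
    then have 1: "\<theta> (fst z) \<le> t (fst z) + t (snd z) - t (fst z + snd z)" using z by (simp add: t_def)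
    have "0 \<le> k1 * (fst z powr lam) * (\<phi> (fst z) * \<phi> (snd z))"
      using k1 wsol_nonneg[OF w] by (intro mult_nonneg_nonneg) auto
    then have "k1 * (snd z powr lam) * (\<phi> (fst z) * \<phi> (snd z)) \<le> rate \<phi> z"
      using rate_ge[OF w U, of z] by (simp add: algebra_simps)
    then have "\<theta> (fst z) * (k1 * (snd z powr lam) * (\<phi> (fst z) * \<phi> (snd z))) \<le> \<theta> (fst z) * rate \<phi> z"
      by (rule mult_left_mono[OF _ \<theta>0])
    also have "\<dots> \<le> (t (fst z) + t (snd z) - t (fst z + snd z)) * rate \<phi> z"
      by (rule mult_right_mono[OF 1 rate_nonneg[OF w U]])
    finally show "f z \<le> (t (fst z) + t (snd z) - t (fst z + snd z)) * rate \<phi> z"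
      by (simp add: f_def mult_ac)
  qed measurable
  moreover have "(LINT z|lborel2. f z) = k1 * ((LINT x|lborel. \<theta> x * \<phi> x) * (LINT x|lborel. x powr lam * \<phi> x))"
    unfolding f_def using integral_lborel2_product[OF h wsol_integrable_lam[OF w]] by simp
  ultimately show ?thesis unfolding t\<phi> by (simp add: t_def algebra_simps)
qed

lemma integral_lam_product:
  assumes w: "wsol S \<eta> U \<phi>"
  shows "integrable lborel2 (\<lambda>z. k * (fst z powr lam + snd z powr lam) * (\<phi> (fst z) * \<phi> (snd z)))"
    and "(LINT z|lborel2. k * (fst z powr lam + snd z powr lam) * (\<phi> (fst z) * \<phi> (snd z)))
      = 2 * k * ((LINT x|lborel. \<phi> x) * (LINT x|lborel. x powr lam * \<phi> x))"
proof -
  note i = wsol_integrable[OF w] and il = wsol_integrable_lam[OF w]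
  note p1 = integrable_lborel2_product[OF i il] integral_lborel2_product[OF i il]
  note p2 = integrable_lborel2_product[OF il i] integral_lborel2_product[OF il i]
  have eq: "(\<lambda>z. k * (fst z powr lam + snd z powr lam) * (\<phi> (fst z) * \<phi> (snd z))) =
     (\<lambda>z. k * ((fst z powr lam * \<phi> (fst z)) * \<phi> (snd z)) + k * (\<phi> (fst z) * (snd z powr lam * \<phi> (snd z))))"
    by (simp add: algebra_simps)
  show "integrable lborel2 (\<lambda>z. k * (fst z powr lam + snd z powr lam) * (\<phi> (fst z) * \<phi> (snd z)))"
    unfolding eq using p1(1) p2(1) by simp
  show "(LINT z|lborel2. k * (fst z powr lam + snd z powr lam) * (\<phi> (fst z) * \<phi> (snd z)))
      = 2 * k * ((LINT x|lborel. \<phi> x) * (LINT x|lborel. x powr lam * \<phi> x))"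
    unfolding eq using p1 p2 by simp
qed

text \<open>For sizes in \<open>U\<close> the defect of \<open>indicator U\<close> is 1 if the
  merged cluster stays in \<open>U\<close> and 2 if it leaves. The value 1 with the lower bound on
  \<open>K\<close> gives this estimate; the value 2 with the upper bound on \<open>K\<close> gives
  \<open>total_lower\<close>.\<close>

lemma total_upper:
  assumes w: "wsol S \<eta> U \<phi>" and U: "U \<subseteq> {0<..}" and [measurable]: "U \<in> sets borel" and \<eta>: "0 \<le> \<eta>"
  shows "k1 * ((LINT x|lborel. \<phi> x) * (LINT x|lborel. x powr lam * \<phi> x)) \<le> (LINT x|lborel. S x * indicator U x)"
proof -
  define f where "f z = k1 * (fst z powr lam + snd z powr lam) * (\<phi> (fst z) * \<phi> (snd z))" for z
  have f: "integrable lborel2 f" unfolding f_def[abs_def] by (rule integral_lam_product[OF w])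
  have "(LINT z|lborel2. f z) + 2 * \<eta> * (LINT x|lborel. indicator U x * \<phi> x) \<le> 2 * (LINT x|lborel. S x * indicator U x)"
  proof (rule wsol_test_ineq[OF w U _ _ _ f])
    show "\<bar>indicator U x :: real\<bar> \<le> 1" for x by (simp add: indicator_def)
    show "f z = 0" if "fst z \<notin> U \<or> snd z \<notin> U" for z
      using that wsol_zero[OF w, of "fst z"] wsol_zero[OF w, of "snd z"] by (auto simp: f_def)
    fix z :: "real \<times> real" assume z: "fst z \<in> U" "snd z \<in> U"
    have "f z \<le> 1 * rate \<phi> z" using rate_ge[OF w U, of z] by (simp add: f_def)
    also have "\<dots> \<le> (indicator U (fst z) + indicator U (snd z) - indicator U (fst z + snd z)) * rate \<phi> z"
      using z rate_nonneg[OF w U, of z] by (intro mult_right_mono) (auto simp: indicator_def)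
    finally show "f z \<le> (indicator U (fst z) + indicator U (snd z) - indicator U (fst z + snd z)) * rate \<phi> z" .
  qed (auto simp: indicator_def)
  moreover have "0 \<le> 2 * \<eta> * (LINT x|lborel. indicator U x * \<phi> x)"
    using \<eta> wsol_nonneg[OF w] by (intro mult_nonneg_nonneg integral_nonneg_AE AE_I2) auto
  ultimately show ?thesis unfolding f_def integral_lam_product[OF w] by linarith
qed

text \<open>Both sinks of clusters occur on the right: mergers, which cost at most two clusters
  each, and removal at rate \<open>\<eta>\<close>. This is what keeps approximate solutions from
  degenerating to zero.\<close>

lemma total_lower:
  assumes w: "wsol S \<eta> U \<phi>" and U: "U \<subseteq> {0<..}" and [measurable]: "U \<in> sets borel"
  shows "(LINT x|lborel. S x * indicator U x) \<le> (2 * k2 * (LINT x|lborel. x powr lam * \<phi> x) + \<eta>) * (LINT x|lborel. \<phi> x)"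
proof -
  have [measurable]: "\<phi> \<in> borel_measurable borel" using w by (rule wsol_meas)
  define g where "g z = (indicator U (fst z) + indicator U (snd z) - indicator U (fst z + snd z) :: real)" for z
  have g: "\<bar>g z\<bar> \<le> 3" "g z \<le> 2" for z by (auto simp: g_def indicator_def)
  have 1: "(LINT z|lborel2. g z * rate \<phi> z) + 2 * \<eta> * (LINT x|lborel. indicator U x * \<phi> x) = 2 * (LINT x|lborel. S x * indicator U x)"
    unfolding g_def by (rule wsol_eq[OF w, where C=1]) (auto simp: indicator_def)
  have "(LINT z|lborel2. g z * rate \<phi> z) \<le> (LINT z|lborel2. 2 * k2 * (fst z powr lam + snd z powr lam) * (\<phi> (fst z) * \<phi> (snd z)))"
  proof (rule integral_mono)
    show "integrable lborel2 (\<lambda>z. g z * rate \<phi> z)"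
      by (rule rate_test_integrable[OF w U _ g(1)]) (unfold g_def[abs_def], measurable)
    show "g z * rate \<phi> z \<le> 2 * k2 * (fst z powr lam + snd z powr lam) * (\<phi> (fst z) * \<phi> (snd z))" for z
      using mult_right_mono[OF g(2)[of z] rate_nonneg[OF w U, of z]] rate_le[OF w U, of z] by simp
  qed (rule integral_lam_product[OF w])
  then have "(LINT z|lborel2. g z * rate \<phi> z) \<le> 4 * k2 * ((LINT x|lborel. \<phi> x) * (LINT x|lborel. x powr lam * \<phi> x))"
    unfolding integral_lam_product[OF w] by simp
  moreover have "(LINT x|lborel. indicator U x * \<phi> x) = (LINT x|lborel. \<phi> x)"
    using wsol_zero[OF w] by (intro Bochner_Integration.integral_cong) (auto simp: indicator_def)
  ultimately show ?thesis using 1 by (simp add: algebra_simps)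
qed

text \<open>
  With \<open>\<theta>\<close> the indicator of \<open>\<phi> > N\<close>, the inequality \<open>\<phi> x * \<theta> (x + y) \<le> (\<phi> x - N)\<^sub>+ + N * \<theta> (x + y)\<close>
  and the monotonicity of \<open>K\<close> bound the gain by half of the loss.
\<close>

lemma superlevel_estimate:
  assumes w: "wsol S \<eta> U \<phi>" and U: "U \<subseteq> {0<..}" and \<eta>: "0 \<le> \<eta>" and N: "0 \<le> N"
    and mono: "AE z in lborel2. K (fst z - snd z) (snd z) \<le> K (fst z) (snd z)"
  shows "k1 * (LINT x|lborel. x powr lam * \<phi> x) * (LINT x|lborel. \<phi> x * indicator {x. N < \<phi> x} x)
     \<le> 2 * (LINT x|lborel. S x * indicator {x. N < \<phi> x} x)"
proof -
  have [measurable]: "\<phi> \<in> borel_measurable borel" using w by (rule wsol_meas)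
  have [measurable]: "rate \<phi> \<in> borel_measurable (borel \<Otimes>\<^sub>M borel)" by (rule rate_meas[OF w U])
  note nn = wsol_nonneg[OF w]
  define \<theta> where "\<theta> x = (indicator {x. N < \<phi> x} x :: real)" for x
  have [measurable]: "\<theta> \<in> borel_measurable borel" unfolding \<theta>_def[abs_def] by measurable
  have \<theta>: "0 \<le> \<theta> x" "\<theta> x \<le> 1" "\<bar>\<theta> x\<bar> \<le> 1" for x by (auto simp: \<theta>_def indicator_def)
  define e where "e x = max (\<phi> x - N) 0" for x
  have [measurable]: "e \<in> borel_measurable borel" unfolding e_def[abs_def] by measurable
  have e0: "0 \<le> e x" for x by (simp add: e_def)
  have eN: "e x + N * \<theta> x = \<phi> x * \<theta> x" for x by (simp add: e_def \<theta>_def indicator_def)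
  \<comment> \<open>The splitting is done with nonnegative integrals, so that no integrability of
    the terms carrying the factor \<open>N\<close> has to be established.\<close>
  have gain: "(\<integral>\<^sup>+z. ennreal (\<theta> (fst z + snd z) * rate \<phi> z) \<partial>lborel2) \<le> (\<integral>\<^sup>+z. ennreal (\<theta> (fst z) * rate \<phi> z) \<partial>lborel2)"
  proof -
    define F where "F z = ennreal (N * K (fst z) (snd z) * \<phi> (snd z) * \<theta> (fst z + snd z))" for z
    have [measurable]: "F \<in> borel_measurable lborel2" unfolding F_def[abs_def] by measurable
    have "(\<integral>\<^sup>+z. ennreal (\<theta> (fst z + snd z) * rate \<phi> z) \<partial>lborel2) \<le>
        (\<integral>\<^sup>+z. ennreal (K (fst z) (snd z) * e (fst z) * \<phi> (snd z)) + F z \<partial>lborel2)"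
    proof (rule nn_integral_mono)
      fix z
      have "\<theta> (fst z + snd z) * \<phi> (fst z) \<le> e (fst z) + N * \<theta> (fst z + snd z)"
        by (auto simp: \<theta>_def e_def indicator_def)
      then have "(\<theta> (fst z + snd z) * \<phi> (fst z)) * (K (fst z) (snd z) * \<phi> (snd z))
          \<le> (e (fst z) + N * \<theta> (fst z + snd z)) * (K (fst z) (snd z) * \<phi> (snd z))"
        using K_nonneg nn by (intro mult_right_mono) auto
      then have "\<theta> (fst z + snd z) * rate \<phi> z \<le> K (fst z) (snd z) * e (fst z) * \<phi> (snd z) + N * K (fst z) (snd z) * \<phi> (snd z) * \<theta> (fst z + snd z)"
        by (simp add: rate_def algebra_simps)
      then show "ennreal (\<theta> (fst z + snd z) * rate \<phi> z) \<le> ennreal (K (fst z) (snd z) * e (fst z) * \<phi> (snd z)) + F z"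
        unfolding F_def using K_nonneg nn e0 \<theta> N
        by (subst ennreal_plus[symmetric]) (auto intro!: ennreal_leI simp del: ennreal_plus)
    qed
    also have "\<dots> = (\<integral>\<^sup>+z. ennreal (K (fst z) (snd z) * e (fst z) * \<phi> (snd z)) \<partial>lborel2) + (\<integral>\<^sup>+z. F z \<partial>lborel2)"
      by (intro nn_integral_add) measurable
    \<comment> \<open>The shear turns \<open>\<theta> (x + y)\<close> into \<open>\<theta> x\<close>
      and \<open>K x y\<close> into \<open>K (x - y) y\<close>, which \<open>mono\<close> bounds by
      \<open>K x y\<close>. Both parts then recombine through \<open>eN\<close> to the loss.\<close>
    also have "(\<integral>\<^sup>+z. F z \<partial>lborel2) = (\<integral>\<^sup>+z. F (fst z + (-1) * snd z, snd z) \<partial>lborel2)"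
      by (rule nn_integral_shear[symmetric]) measurable
    also have "\<dots> \<le> (\<integral>\<^sup>+z. ennreal (N * K (fst z) (snd z) * \<phi> (snd z) * \<theta> (fst z)) \<partial>lborel2)"
    proof (rule nn_integral_mono_AE)
      show "AE z in lborel2. F (fst z + (-1) * snd z, snd z) \<le> ennreal (N * K (fst z) (snd z) * \<phi> (snd z) * \<theta> (fst z))"
        using mono by eventually_elim (use N nn \<theta> in \<open>auto simp: F_def intro!: ennreal_leI mult_right_mono mult_left_mono\<close>)
    qed
    also have "(\<integral>\<^sup>+z. ennreal (K (fst z) (snd z) * e (fst z) * \<phi> (snd z)) \<partial>lborel2) + \<dots>
       = (\<integral>\<^sup>+z. ennreal (K (fst z) (snd z) * e (fst z) * \<phi> (snd z)) + ennreal (N * K (fst z) (snd z) * \<phi> (snd z) * \<theta> (fst z)) \<partial>lborel2)"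
      by (intro nn_integral_add[symmetric]) measurable
    also have "\<dots> = (\<integral>\<^sup>+z. ennreal (\<theta> (fst z) * rate \<phi> z) \<partial>lborel2)"
    proof (rule nn_integral_cong)
      fix z
      have "K (fst z) (snd z) * e (fst z) * \<phi> (snd z) + N * K (fst z) (snd z) * \<phi> (snd z) * \<theta> (fst z)
          = (e (fst z) + N * \<theta> (fst z)) * (K (fst z) (snd z) * \<phi> (snd z))" by (simp add: algebra_simps)
      also have "\<dots> = \<theta> (fst z) * rate \<phi> z" unfolding eN rate_def by (simp add: mult_ac)
      finally show "ennreal (K (fst z) (snd z) * e (fst z) * \<phi> (snd z)) + ennreal (N * K (fst z) (snd z) * \<phi> (snd z) * \<theta> (fst z))
          = ennreal (\<theta> (fst z) * rate \<phi> z)"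
        using K_nonneg nn e0 \<theta> N by (subst ennreal_plus[symmetric]) (auto simp del: ennreal_plus)
    qed
    finally show ?thesis by (simp add: add_mono)
  qed
  have i: "integrable lborel2 (\<lambda>z. \<theta> (fst z) * rate \<phi> z)" "integrable lborel2 (\<lambda>z. \<theta> (snd z) * rate \<phi> z)"
    "integrable lborel2 (\<lambda>z. \<theta> (fst z + snd z) * rate \<phi> z)"
    using \<theta> by (auto intro!: rate_test_integrable[OF w U, where C=1])
  have gain': "(LINT z|lborel2. \<theta> (fst z + snd z) * rate \<phi> z) \<le> (LINT z|lborel2. \<theta> (fst z) * rate \<phi> z)"
    using gain i \<theta> rate_nonneg[OF w U]
    by (subst (asm) (1 2) nn_integral_eq_integral) (auto intro!: ennreal_le_iff[THEN iffD1] integral_nonneg_AE AE_I2)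
  have swap: "(LINT z|lborel2. \<theta> (snd z) * rate \<phi> z) = (LINT z|lborel2. \<theta> (fst z) * rate \<phi> z)"
  proof -
    have "rate \<phi> (snd z, fst z) = rate \<phi> z" for z using K_sym[of "fst z" "snd z"] by (simp add: rate_def)
    then show ?thesis using integral_swap(2)[OF i(1)] by simp
  qed
  have eq: "(LINT z|lborel2. (\<theta> (fst z) + \<theta> (snd z) - \<theta> (fst z + snd z)) * rate \<phi> z)
        + 2 * \<eta> * (LINT x|lborel. \<theta> x * \<phi> x) = 2 * (LINT x|lborel. S x * \<theta> x)"
    using wsol_zero[OF w] N by (intro wsol_eq[OF w _ \<theta>(3)]) (auto simp: \<theta>_def)
  have spl: "(LINT z|lborel2. (\<theta> (fst z) + \<theta> (snd z) - \<theta> (fst z + snd z)) * rate \<phi> z) =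
     (LINT z|lborel2. \<theta> (fst z) * rate \<phi> z) + (LINT z|lborel2. \<theta> (snd z) * rate \<phi> z) - (LINT z|lborel2. \<theta> (fst z + snd z) * rate \<phi> z)"
    using i by (simp add: left_diff_distrib distrib_right)
  have ge: "(LINT z|lborel2. \<theta> (fst z) * rate \<phi> z) \<le> 2 * (LINT x|lborel. S x * \<theta> x)"
  proof -
    have "0 \<le> 2 * \<eta> * (LINT x|lborel. \<theta> x * \<phi> x)"
      using \<eta> \<theta>(1) nn by (intro mult_nonneg_nonneg integral_nonneg_AE AE_I2) auto
    with spl show ?thesis using eq gain' swap by linarith
  qed
  have h: "integrable lborel (\<lambda>x. \<phi> x * \<theta> x)" by (rule integrable_mult_bounded[OF wsol_integrable[OF w] _ \<theta>(3)]) simp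
  note p = integrable_lborel2_product[OF h wsol_integrable_lam[OF w]] integral_lborel2_product[OF h wsol_integrable_lam[OF w]]
  have "(LINT z|lborel2. k1 * (\<phi> (fst z) * \<theta> (fst z) * (snd z powr lam * \<phi> (snd z)))) \<le> (LINT z|lborel2. \<theta> (fst z) * rate \<phi> z)"
  proof (rule integral_mono[OF _ i(1)])
    show "integrable lborel2 (\<lambda>z. k1 * (\<phi> (fst z) * \<theta> (fst z) * (snd z powr lam * \<phi> (snd z))))" using p(1) by simp
    fix z :: "real \<times> real"
    have "0 \<le> k1 * (fst z powr lam) * (\<phi> (fst z) * \<phi> (snd z))"
      using k1 nn by (intro mult_nonneg_nonneg) auto
    then have "k1 * (snd z powr lam) * (\<phi> (fst z) * \<phi> (snd z)) \<le> rate \<phi> z"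
      using rate_ge[OF w U, of z] by (simp add: algebra_simps)
    then have "\<theta> (fst z) * (k1 * (snd z powr lam) * (\<phi> (fst z) * \<phi> (snd z))) \<le> \<theta> (fst z) * rate \<phi> z"
      by (rule mult_left_mono[OF _ \<theta>(1)])
    then show "k1 * (\<phi> (fst z) * \<theta> (fst z) * (snd z powr lam * \<phi> (snd z))) \<le> \<theta> (fst z) * rate \<phi> z" by (simp add: mult_ac)
  qed
  then show ?thesis using ge p(2) by (simp add: \<theta>_def mult_ac)
qed

end

section \<open>Uniform bounds and existence\<close>

locale coag_source = coag +
  fixes S :: "real \<Rightarrow> real"
  assumes lam1: "lam < 1"
    and S_int: "integrable lborel S" and S_nonneg: "0 \<le> S x" and S_zero: "x \<le> 0 \<Longrightarrow> S x = 0"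
    and S_mom: "0 < m \<Longrightarrow> m < 1 \<Longrightarrow> integrable lborel (\<lambda>x. x powr m * S x)"
    and S_pos: "0 < (LINT x|lborel. S x)"
    and mono: "AE z in lborel2. K (fst z - snd z) (snd z) \<le> K (fst z) (snd z)"
begin

lemma S_meas[measurable]: "S \<in> borel_measurable borel" using S_int by auto

text \<open>The class over which the coming bounds are uniform: their constants depend on
  \<open>S\<close> and the kernel bounds only. It contains the data of the truncated problems and,
  by \<open>approx_self\<close>, those of the full one.\<close>

definition approx :: "(real \<Rightarrow> real) \<Rightarrow> real \<Rightarrow> real set \<Rightarrow> bool" where
  "approx S' \<eta> U \<longleftrightarrow> S' \<in> borel_measurable borel \<and> (\<forall>x. 0 \<le> S' x \<and> S' x \<le> S x) \<and>
   0 \<le> \<eta> \<and> \<eta> \<le> (1::real) \<and> U \<subseteq> {0<..} \<and> U \<in> sets borel"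

lemma integral_source_le:
  assumes ap: "approx S' \<eta> U" and [measurable]: "h \<in> borel_measurable borel" and h0: "\<And>x. 0 \<le> h x"
    and g: "integrable lborel g" and le: "\<And>x. S x * h x \<le> g x"
  shows "(LINT x|lborel. S' x * h x) \<le> (LINT x|lborel. g x)"
proof (rule integral_mono_AE')
  have S': "S' x \<le> S x" "0 \<le> S' x" for x using ap by (auto simp: approx_def)
  show "AE x in lborel. S' x * h x \<le> g x"
    using order_trans[OF mult_right_mono[OF S'(1) h0] le] by simp
  have "0 \<le> g x" for x using order_trans[OF mult_nonneg_nonneg[OF S_nonneg h0] le] .
  then show "AE x in lborel. 0 \<le> g x" by simp
qed (rule g)

text \<open>Only moments of \<open>S\<close> of order \<open>m < 1\<close> are at hand, so
  \<open>min x A \<le> A powr (1 - m) * x powr m\<close> is inserted into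
  \<open>tail_estimate\<close>; the tail of \<open>\<phi>\<close> then decays at least like
  \<open>A powr (- (m + lam) / 2)\<close>. Summation over powers of 2 yields moments of order below
  \<open>(m + lam) / 2\<close>, and \<open>m\<close> may be taken close to 1.\<close>

lemma moment_bound:
  assumes \<mu>: "0 \<le> \<mu>" "\<mu> < (1 + lam) / 2"
  obtains C where "0 \<le> C" "\<And>S' \<eta> U \<phi>. approx S' \<eta> U \<Longrightarrow> wsol S' \<eta> U \<phi> \<Longrightarrow>
     (\<integral>\<^sup>+x. ennreal (x powr \<mu> * \<phi> x * indicator {1..} x) \<partial>lborel) \<le> ennreal C"
proof -
  \<comment> \<open>The midpoint between \<open>max 0 (2 * \<mu> - lam)\<close> and 1, so that
    \<open>\<mu> < (m + lam) / 2\<close> and the ratio \<open>q\<close> of the dyadic series is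
    below 1.\<close>
  define m where "m = (1 + max 0 (2 * \<mu> - lam)) / 2"
  have m: "0 < m" "m < 1" "2 * \<mu> - lam < m" using \<mu> by (auto simp: m_def max_def)
  define M where "M = (LINT x|lborel. x powr m * S x)"
  have M0: "0 \<le> M" unfolding M_def using S_nonneg by (intro integral_nonneg_AE AE_I2) auto
  define q where "q = 2 powr (\<mu> - (m + lam) / 2)"
  have q: "0 < q" "q < 1" using m by (auto simp: q_def powr_less_one)
  define C where "C = 2 powr \<mu> * sqrt (M / k1) / (1 - q)"
  have C0: "0 \<le> C" using q M0 k1 by (simp add: C_def)
  have "(\<integral>\<^sup>+x. ennreal (x powr \<mu> * \<phi> x * indicator {1..} x) \<partial>lborel) \<le> ennreal C"
    if ap: "approx S' \<eta> U" and w: "wsol S' \<eta> U \<phi>" for S' \<eta> U \<phi>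
  proof -
    have [measurable]: "\<phi> \<in> borel_measurable borel" using w by (rule wsol_meas)
    note nn = wsol_nonneg[OF w]
    have U: "U \<subseteq> {0<..}" "U \<in> sets borel" and \<eta>: "0 \<le> \<eta>" using ap by (auto simp: approx_def)
    note [measurable] = U(2)
    define T where "T A = (LINT x|lborel. \<phi> x * indicator {A..} x)" for A
    have T0: "0 \<le> T A" for A unfolding T_def using nn by (intro integral_nonneg_AE AE_I2) auto
    have Ti: "integrable lborel (\<lambda>x. \<phi> x * indicator {A..} x)" for A
      by (intro integrable_mult_bounded[OF wsol_integrable[OF w], where C=1]) (auto simp: indicator_def)
    have T: "T A \<le> sqrt (M / k1) * A powr (- (m + lam) / 2)" if A: "0 < A" for A
    proof -
      have "k1 * A powr (1 + lam) * (T A)\<^sup>2 \<le> (LINT x|lborel. S' x * (min x A * indicator U x))"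
        unfolding T_def by (rule tail_estimate[OF w U \<eta> A])
      also have "\<dots> \<le> (LINT x|lborel. A powr (1 - m) * (x powr m * S x))"
      proof (rule integral_source_le[OF ap])
        show "integrable lborel (\<lambda>x. A powr (1 - m) * (x powr m * S x))" using S_mom m by simp
        show "0 \<le> min x A * indicator U x" for x using U A by (auto simp: indicator_def)
        fix x
        show "S x * (min x A * indicator U x) \<le> A powr (1 - m) * (x powr m * S x)"
        proof (cases "0 < x")
          case True
          have "min x A = min x A powr (1 - m) * min x A powr m" using True A by (simp flip: powr_add)
          also have "\<dots> \<le> A powr (1 - m) * x powr m"
            using True A m by (intro mult_mono powr_mono2) auto
          finally have "S x * min x A \<le> S x * (A powr (1 - m) * x powr m)" by (rule mult_left_mono[OF _ S_nonneg])
          moreover have "S x * (min x A * indicator U x) \<le> S x * min x A"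
            using True A S_nonneg[of x] by (auto simp: indicator_def)
          ultimately show ?thesis by (simp add: mult_ac)
        qed (simp add: S_zero)
      qed measurable
      also have "\<dots> = A powr (1 - m) * M" by (simp add: M_def)
      finally have "k1 * A powr (1 + lam) * (T A)\<^sup>2 \<le> A powr (1 - m) * M" .
      then have "(T A)\<^sup>2 \<le> A powr (1 - m) * M / (k1 * A powr (1 + lam))"
        using k1 A by (simp add: field_simps)
      also have "\<dots> = M / k1 * (A powr (1 - m) / A powr (1 + lam))" by simp
      also have "A powr (1 - m) / A powr (1 + lam) = A powr (- (m + lam))" using A by (simp flip: powr_diff)
      also have "\<dots> = (A powr (- (m + lam) / 2))\<^sup>2" using A by (simp add: power2_eq_square flip: powr_add)
      finally have "sqrt ((T A)\<^sup>2) \<le> sqrt (M / k1 * (A powr (- (m + lam) / 2))\<^sup>2)" by (rule real_sqrt_le_mono)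
      then show ?thesis using T0[of A] A by (simp only: real_sqrt_mult real_sqrt_abs abs_of_nonneg powr_ge_zero)
    qed
    \<comment> \<open>A size between \<open>2 powr real k\<close> and
      \<open>2 powr (real k + 1)\<close> is charged to the tail beyond \<open>2 powr real k\<close>,
      with weight \<open>2 powr ((real k + 1) * \<mu>)\<close>; the remaining terms of the series
      are nonnegative.\<close>
    have "(\<integral>\<^sup>+x. ennreal (x powr \<mu> * \<phi> x * indicator {1..} x) \<partial>lborel)
       \<le> (\<integral>\<^sup>+x. (\<Sum>k. ennreal (2 powr ((real k + 1) * \<mu>)) * ennreal (\<phi> x * indicator {2 powr real k..} x)) \<partial>lborel)"
    proof (rule nn_integral_mono)
      fix x :: real
      show "ennreal (x powr \<mu> * \<phi> x * indicator {1..} x) \<le> (\<Sum>k. ennreal (2 powr ((real k + 1) * \<mu>)) * ennreal (\<phi> x * indicator {2 powr real k..} x))"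
      proof (cases "1 \<le> x")
        case True
        define k where "k = nat \<lfloor>log 2 x\<rfloor>"
        have "0 \<le> log 2 x" using True by simp
        then have k: "real k \<le> log 2 x" "log 2 x < real k + 1" unfolding k_def by linarith+
        have 1: "2 powr real k \<le> x" using k(1) True by (simp add: le_log_iff)
        have "x = 2 powr (log 2 x)" using True by simp
        also have "\<dots> \<le> 2 powr (real k + 1)" using k(2) by (intro powr_mono) auto
        finally have "x powr \<mu> \<le> (2 powr (real k + 1)) powr \<mu>" using True \<mu> by (intro powr_mono2) auto
        then have 2: "x powr \<mu> \<le> 2 powr ((real k + 1) * \<mu>)" by (simp add: powr_powr)
        have "ennreal (x powr \<mu> * \<phi> x * indicator {1..} x) \<le> ennreal (2 powr ((real k + 1) * \<mu>) * (\<phi> x * indicator {2 powr real k..} x))"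
          using 1 2 True nn[of x] by (intro ennreal_leI) (auto intro: mult_right_mono)
        also have "\<dots> = (\<Sum>i\<in>{k}. ennreal (2 powr ((real i + 1) * \<mu>)) * ennreal (\<phi> x * indicator {2 powr real i..} x))"
          by (simp add: ennreal_mult')
        also have "\<dots> \<le> (\<Sum>k. ennreal (2 powr ((real k + 1) * \<mu>)) * ennreal (\<phi> x * indicator {2 powr real k..} x))"
          by (rule sum_le_suminf) auto
        finally show ?thesis .
      qed simp
    qed
    also have "\<dots> = (\<Sum>k. \<integral>\<^sup>+x. ennreal (2 powr ((real k + 1) * \<mu>)) * ennreal (\<phi> x * indicator {2 powr real k..} x) \<partial>lborel)"
      by (intro nn_integral_suminf) measurable
    also have "\<dots> = (\<Sum>k. ennreal (2 powr ((real k + 1) * \<mu>) * T (2 powr real k)))"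
    proof (rule suminf_cong)
      fix k
      have "(\<integral>\<^sup>+x. ennreal (\<phi> x * indicator {2 powr real k..} x) \<partial>lborel) = ennreal (T (2 powr real k))"
        unfolding T_def using nn by (intro nn_integral_eq_integral Ti) auto
      then show "(\<integral>\<^sup>+x. ennreal (2 powr ((real k + 1) * \<mu>)) * ennreal (\<phi> x * indicator {2 powr real k..} x) \<partial>lborel)
         = ennreal (2 powr ((real k + 1) * \<mu>) * T (2 powr real k))"
        by (subst nn_integral_cmult) (auto simp: ennreal_mult')
    qed
    also have "\<dots> \<le> (\<Sum>k. ennreal (2 powr \<mu> * sqrt (M / k1) * q ^ k))"
    proof (rule suminf_le)
      fix k
      have "2 powr ((real k + 1) * \<mu>) * T (2 powr real k) \<le> 2 powr ((real k + 1) * \<mu>) * (sqrt (M / k1) * (2 powr real k) powr (- (m + lam) / 2))"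
        by (intro mult_left_mono T) auto
      also have "\<dots> = sqrt (M / k1) * (2 powr ((real k + 1) * \<mu>) * (2 powr real k) powr (- (m + lam) / 2))" by simp
      also have "2 powr ((real k + 1) * \<mu>) * (2 powr real k) powr (- (m + lam) / 2) = 2 powr \<mu> * q ^ k"
        by (simp add: q_def powr_powr powr_power flip: powr_add) (simp add: field_simps)
      finally show "ennreal (2 powr ((real k + 1) * \<mu>) * T (2 powr real k)) \<le> ennreal (2 powr \<mu> * sqrt (M / k1) * q ^ k)"
        by (intro ennreal_leI) (simp add: mult_ac)
    qed auto
    also have "\<dots> = ennreal (\<Sum>k. 2 powr \<mu> * sqrt (M / k1) * q ^ k)"
      using q M0 k1 by (intro suminf_ennreal2 summable_mult summable_geometric) auto
    also have "(\<Sum>k. 2 powr \<mu> * sqrt (M / k1) * q ^ k) = C"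
      using q by (simp add: suminf_mult summable_geometric suminf_geometric C_def)
    finally show ?thesis .
  qed
  with C0 show thesis by (rule that)
qed

text \<open>
  The total mass and the moment of order \<open>lam\<close> have a product bounded below; since the mass of sizes
  below \<open>e\<close> is controlled by the source there, the moment itself cannot become small.
\<close>

lemma lam_moment_lower:
  obtains c where "0 < c" "\<And>S' \<eta> U \<phi>. approx S' \<eta> U \<Longrightarrow> wsol S' \<eta> U \<phi> \<Longrightarrow>
     (LINT x|lborel. S x) / 2 \<le> (LINT x|lborel. S' x * indicator U x) \<Longrightarrow> c \<le> (LINT x|lborel. x powr lam * \<phi> x)"
proof -
  define \<sigma> where "\<sigma> = (LINT x|lborel. S x)"
  have \<sigma>: "0 < \<sigma>" using S_pos by (simp add: \<sigma>_def)
  \<comment> \<open>Chosen so that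
    \<open>2 * k2 * Ml + \<eta> \<le> C1 * (k1 * Ml + 2 * \<eta>)\<close>: the factor of
    \<open>total_lower\<close> is dominated by \<open>q\<close>, that of
    \<open>antimono_estimate\<close>. The mass \<open>a\<close> of small sizes can then be absorbed
    through the product \<open>q * a\<close>, without dividing by \<open>q\<close>.\<close>
  define C1 where "C1 = 2 * k2 / k1 + 1"
  have C1: "0 < C1" using k1 k2 by (simp add: C1_def add_pos_pos)
  have "(\<lambda>n. LINT x|lborel. S x * indicator {..<1 / real (Suc n)} x) \<longlonglongrightarrow> (LINT x::real|lborel. (0::real))"
  proof (rule integral_dominated_convergence[where w=S])
    have "(\<lambda>n. S x * indicator {..<1 / real (Suc n)} x) \<longlonglongrightarrow> 0" for x
    proof (cases "0 < x")
      case True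
      have "\<forall>\<^sub>F n in sequentially. 1 / real (Suc n) < x"
        using True LIMSEQ_Suc[OF lim_const_over_n[of "1::real"]] by (auto dest: order_tendstoD(2))
      then have "\<forall>\<^sub>F n in sequentially. S x * indicator {..<1 / real (Suc n)} x = 0"
        by eventually_elim auto
      then show ?thesis by (rule tendsto_eventually)
    qed (simp add: S_zero)
    then show "AE x in lborel. (\<lambda>n. S x * indicator {..<1 / real (Suc n)} x) \<longlonglongrightarrow> 0" by simp
  qed (use S_int S_nonneg in \<open>auto simp: indicator_def\<close>)
  then have "\<forall>\<^sub>F n in sequentially. (LINT x|lborel. S x * indicator {..<1 / real (Suc n)} x) < \<sigma> / (8 * C1)"
    by (rule order_tendstoD(2)) (use \<sigma> C1 in simp)
  then obtain n where n: "(LINT x|lborel. S x * indicator {..<1 / real (Suc n)} x) < \<sigma> / (8 * C1)"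
    unfolding eventually_sequentially by blast
  \<comment> \<open>Sizes below \<open>e\<close> receive less than
    \<open>\<sigma> / (8 * C1)\<close> of the source, hence account for at most
    \<open>\<sigma> / 4\<close> of the available \<open>\<sigma> / 2\<close>.\<close>
  define e where "e = 1 / real (Suc n)"
  have e: "0 < e" by (simp add: e_def)
  \<comment> \<open>The remaining \<open>\<sigma> / 4 \<le> C1 * e powr (- lam) * (q * Ml)\<close>
    reads \<open>c2 \<le> q * Ml\<close>. As \<open>q \<le> k1 * Ml + 2\<close>, either
    \<open>Ml \<ge> 1\<close> or \<open>c2 \<le> (k1 + 2) * Ml\<close>, which explains
    \<open>c\<close>.\<close>
  define c2 where "c2 = e powr lam * \<sigma> / (4 * C1)"
  have c2: "0 < c2" using e \<sigma> C1 by (simp add: c2_def)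
  define c where "c = min 1 (c2 / (k1 + 2))"
  have c: "0 < c" using c2 k1 by (simp add: c_def)
  have "c \<le> (LINT x|lborel. x powr lam * \<phi> x)"
    if ap: "approx S' \<eta> U" and w: "wsol S' \<eta> U \<phi>" and half: "\<sigma> / 2 \<le> (LINT x|lborel. S' x * indicator U x)" for S' \<eta> U \<phi>
  proof -
    have [measurable]: "\<phi> \<in> borel_measurable borel" using w by (rule wsol_meas)
    note nn = wsol_nonneg[OF w]
    have U: "U \<subseteq> {0<..}" "U \<in> sets borel" and \<eta>: "0 \<le> \<eta>" "\<eta> \<le> 1" using ap by (auto simp: approx_def)
    note [measurable] = U(2)
    define Ml where "Ml = (LINT x|lborel. x powr lam * \<phi> x)"
    have Ml0: "0 \<le> Ml" unfolding Ml_def using nn by (intro integral_nonneg_AE AE_I2) auto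
    define q where "q = k1 * Ml + 2 * \<eta>"
    have q0: "0 \<le> q" using Ml0 \<eta> k1 by (simp add: q_def)
    have M0: "0 \<le> (LINT x|lborel. \<phi> x)" using nn by (intro integral_nonneg_AE AE_I2) auto
    define a where "a = (LINT x|lborel. indicator {..<e} x * \<phi> x)"
    have "q * a \<le> 2 * (LINT x|lborel. S' x * (indicator {..<e} x * indicator U x))"
      unfolding q_def a_def Ml_def
      by (rule antimono_estimate[OF w U, where C=1]) (auto simp: indicator_def)
    also have "(LINT x|lborel. S' x * (indicator {..<e} x * indicator U x)) \<le> (LINT x|lborel. S x * indicator {..<e} x)"
    proof (rule integral_source_le[OF ap])
      show "integrable lborel (\<lambda>x. S x * indicator {..<e} x)"
        by (rule integrable_mult_bounded[OF S_int, where C=1]) (auto simp: indicator_def)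
      show "S x * (indicator {..<e} x * indicator U x) \<le> S x * indicator {..<e} x" for x
        using S_nonneg by (intro mult_left_mono) (auto simp: indicator_def)
    qed auto
    finally have qa: "q * a \<le> \<sigma> / (4 * C1)" using n by (simp add: e_def)
    have split: "(LINT x|lborel. \<phi> x) \<le> a + e powr (- lam) * Ml"
    proof -
      have i1: "integrable lborel (\<lambda>x. indicator {..<e} x * \<phi> x)"
        using integrable_mult_bounded[OF wsol_integrable[OF w], of "indicator {..<e}" 1] by (simp add: mult.commute indicator_def)
      have i2: "integrable lborel (\<lambda>x. e powr (- lam) * (x powr lam * \<phi> x))" using wsol_integrable_lam[OF w] by simp
      have "(LINT x|lborel. \<phi> x) \<le> (LINT x|lborel. indicator {..<e} x * \<phi> x + e powr (- lam) * (x powr lam * \<phi> x))"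
      proof (rule integral_mono[OF wsol_integrable[OF w] Bochner_Integration.integrable_add[OF i1 i2]])
        fix x
        show "\<phi> x \<le> indicator {..<e} x * \<phi> x + e powr (- lam) * (x powr lam * \<phi> x)"
        proof (cases "x < e")
          case False
          have "e powr lam \<le> x powr lam" using False e lam by (intro powr_mono2) auto
          then have "e powr (- lam) * e powr lam \<le> e powr (- lam) * x powr lam" by (intro mult_left_mono) auto
          then have "1 \<le> e powr (- lam) * x powr lam" using e by (simp flip: powr_add)
          then have "1 * \<phi> x \<le> (e powr (- lam) * x powr lam) * \<phi> x" by (rule mult_right_mono[OF _ nn])
          then show ?thesis using False by (simp add: mult.assoc)
        qed (use nn[of x] in simp)
      qed
      also have "\<dots> = a + e powr (- lam) * Ml" using i1 i2 by (simp add: a_def Ml_def)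
      finally show ?thesis .
    qed
    have "2 * k2 * Ml + \<eta> \<le> C1 * q"
    proof -
      have "C1 * q = 2 * k2 * Ml + k1 * Ml + (2 * k2 / k1) * (2 * \<eta>) + 2 * \<eta>"
        using k1 by (simp add: C1_def q_def field_simps)
      moreover have "0 \<le> k1 * Ml" "0 \<le> (2 * k2 / k1) * (2 * \<eta>)" using k1 k2 Ml0 \<eta> by simp_all
      ultimately show ?thesis using \<eta> by linarith
    qed
    then have "(2 * k2 * Ml + \<eta>) * (LINT x|lborel. \<phi> x) \<le> C1 * q * (LINT x|lborel. \<phi> x)"
      by (rule mult_right_mono[OF _ M0])
    also have "\<dots> \<le> C1 * q * (a + e powr (- lam) * Ml)" using split C1 q0 by (intro mult_left_mono) auto
    also have "\<dots> = C1 * (q * a) + C1 * e powr (- lam) * (q * Ml)" by (simp add: algebra_simps)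
    also have "\<dots> \<le> C1 * (\<sigma> / (4 * C1)) + C1 * e powr (- lam) * (q * Ml)"
      using qa C1 by (intro add_right_mono mult_left_mono) auto
    also have "C1 * (\<sigma> / (4 * C1)) = \<sigma> / 4" using C1 by simp
    finally have "\<sigma> / 2 \<le> \<sigma> / 4 + C1 * e powr (- lam) * (q * Ml)"
      using half total_lower[OF w U] unfolding Ml_def by linarith
    then have "\<sigma> / 4 \<le> C1 * e powr (- lam) * (q * Ml)" by simp
    then have "e powr lam * (\<sigma> / 4) \<le> e powr lam * (C1 * e powr (- lam) * (q * Ml))" by (rule mult_left_mono) simp
    also have "\<dots> = (e powr lam * e powr (- lam)) * (C1 * (q * Ml))" by (simp add: mult_ac)
    also have "e powr lam * e powr (- lam) = 1" using e by (simp flip: powr_add)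
    finally have "c2 \<le> q * Ml" using C1 by (simp add: c2_def field_simps)
    also have "\<dots> \<le> (k1 * Ml + 2) * Ml" using \<eta> Ml0 by (intro mult_right_mono) (auto simp: q_def)
    finally have qM: "c2 \<le> (k1 * Ml + 2) * Ml" .
    have "c \<le> Ml"
    proof (cases "1 \<le> Ml")
      case False
      then have "(k1 * Ml + 2) * Ml \<le> (k1 + 2) * Ml" using k1 Ml0 by (intro mult_right_mono) auto
      with qM have "c2 / (k1 + 2) \<le> Ml" using k1 by (simp add: field_simps)
      then show ?thesis by (simp add: c_def)
    qed (simp add: c_def)
    then show ?thesis by (simp add: Ml_def)
  qed
  with c show thesis unfolding \<sigma>_def by (rule that)
qed

text \<open>Large sizes are controlled by a moment of order strictly between \<open>lam\<close> and
  \<open>(1 + lam) / 2\<close>. Large values are controlled by \<open>superlevel_estimate\<close>,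
  since the set \<open>E\<close> where \<open>\<phi> n\<close> exceeds a high level has small
  measure: on \<open>E\<close> the source splits into a part where \<open>S\<close> itself exceeds
  \<open>L\<close> and a part bounded by \<open>L\<close> times the measure of \<open>E\<close>. The
  weight \<open>1 + x powr lam\<close> reflects the growth of \<open>K\<close> in one
  variable.\<close>

lemma weighted_unif_int:
  assumes ap: "\<And>n. approx (S' n) (\<eta> n) (U n)" and w: "\<And>n. wsol (S' n) (\<eta> n) (U n) (\<phi> n)"
    and half: "\<And>n. (LINT x|lborel. S x) / 2 \<le> (LINT x|lborel. S' n x * indicator (U n) x)"
  shows "unif_int (\<lambda>n x. (1 + x powr lam) * \<phi> n x)"
proof -
  have [measurable]: "\<phi> n \<in> borel_measurable borel" for n using wsol_meas[OF w] .
  note nn = wsol_nonneg[OF w]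
  have U: "U n \<subseteq> {0<..}" "U n \<in> sets borel" "0 \<le> \<eta> n" for n using ap[of n] by (auto simp: approx_def)
  have neg0: "\<phi> n x = 0" if "x \<le> 0" for n x using wsol_zero[OF w, of x n] U(1)[of n] that by force
  define \<sigma> where "\<sigma> = (LINT x|lborel. S x)"
  obtain c where c: "0 < c" and cMl: "\<And>n. c \<le> (LINT x|lborel. x powr lam * \<phi> n x)"
    using lam_moment_lower[of thesis] ap w half by blast
  define C0 where "C0 = \<sigma> / (k1 * c)"
  have C0: "0 \<le> C0" using S_pos k1 c by (simp add: C0_def \<sigma>_def)
  have M0: "(LINT x|lborel. \<phi> n x) \<le> C0" for n
  proof -
    have M00: "0 \<le> (LINT x|lborel. \<phi> n x)" using nn by (intro integral_nonneg_AE AE_I2) auto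
    have "k1 * ((LINT x|lborel. \<phi> n x) * c) \<le> k1 * ((LINT x|lborel. \<phi> n x) * (LINT x|lborel. x powr lam * \<phi> n x))"
      using cMl M00 k1 by (intro mult_left_mono) auto
    also have "\<dots> \<le> (LINT x|lborel. S' n x * indicator (U n) x)" by (rule total_upper[OF w U])
    also have "\<dots> \<le> \<sigma>" unfolding \<sigma>_def
      using S_int S_nonneg U(2) by (intro integral_source_le[OF ap]) (auto simp: indicator_def)
    finally show ?thesis using k1 c by (simp add: C0_def field_simps)
  qed
  \<comment> \<open>The midpoint between \<open>lam\<close> and the critical exponent; it exceeds
    \<open>lam\<close> because \<open>lam < 1\<close>.\<close>
  define \<mu> where "\<mu> = (lam + (1 + lam) / 2) / 2"
  have \<mu>: "0 \<le> \<mu>" "\<mu> < (1 + lam) / 2" "lam < \<mu>" using lam lam1 by (auto simp: \<mu>_def)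
  obtain C where C: "0 \<le> C" and CM: "\<And>n. (\<integral>\<^sup>+x. ennreal (x powr \<mu> * \<phi> n x * indicator {1..} x) \<partial>lborel) \<le> ennreal C"
    using moment_bound[OF \<mu>(1,2), of thesis] ap w by blast
  have int: "integrable lborel (\<lambda>x. (1 + x powr lam) * \<phi> n x)" for n
    using wsol_integrable[OF w] wsol_integrable_lam[OF w] by (simp add: distrib_right)
  show ?thesis
    unfolding unif_int_def
  proof (intro conjI allI impI int)
    show "0 \<le> (1 + x powr lam) * \<phi> n x" for n x using nn by simp
    fix \<epsilon> :: real assume \<epsilon>: "0 < \<epsilon>"
    have "((\<lambda>A. 2 * A powr (lam - \<mu>) * C) \<longlongrightarrow> 2 * 0 * C) at_top"
      using \<mu> by (intro tendsto_mult tendsto_const tendsto_neg_powr filterlim_ident) auto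
    then have "\<forall>\<^sub>F A in at_top. 2 * A powr (lam - \<mu>) * C < \<epsilon> / 2"
      by (rule order_tendstoD(2)) (use \<epsilon> in simp)
    moreover have "\<forall>\<^sub>F A in at_top. (1::real) \<le> A" by (rule eventually_ge_at_top)
    ultimately have "\<forall>\<^sub>F A in at_top. 2 * A powr (lam - \<mu>) * C < \<epsilon> / 2 \<and> 1 \<le> A" by eventually_elim simp
    then obtain A where A: "2 * A powr (lam - \<mu>) * C < \<epsilon> / 2" "1 \<le> A"
      unfolding eventually_at_top_linorder by blast
    \<comment> \<open>By \<open>superlevel_estimate\<close>, \<open>B\<close> times the source on a
      superlevel set bounds \<open>1 + A powr lam\<close> times the mass there. The choices are made
      in the order \<open>A\<close>, \<open>B\<close>, \<open>L\<close>, \<open>N'\<close>; the last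
      makes Chebyshev's bound \<open>C0 / N'\<close> for the measure of the set small even after
      multiplication by \<open>L\<close>.\<close>
    define B where "B = (1 + A powr lam) * (2 / (k1 * c))"
    have B: "0 < B" using k1 c by (simp add: B_def add_pos_nonneg)
    have "(\<lambda>n. LINT x|lborel. S x * indicator {x. real n < S x} x) \<longlonglongrightarrow> (LINT x::real|lborel. (0::real))"
    proof (rule integral_dominated_convergence[where w=S])
      have "(\<lambda>n. S x * indicator {x. real n < S x} x) \<longlonglongrightarrow> 0" for x
      proof (rule tendsto_eventually)
        have "\<forall>\<^sub>F n in sequentially. S x \<le> real n"
          using filterlim_real_sequentially by (auto simp: filterlim_at_top)
        then show "\<forall>\<^sub>F n in sequentially. S x * indicator {x. real n < S x} x = 0" by eventually_elim auto
      qed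
      then show "AE x in lborel. (\<lambda>n. S x * indicator {x. real n < S x} x) \<longlonglongrightarrow> 0" by simp
    qed (use S_int S_nonneg in \<open>auto simp: indicator_def\<close>)
    then have "\<forall>\<^sub>F n in sequentially. (LINT x|lborel. S x * indicator {x. real n < S x} x) < \<epsilon> / (8 * B)"
      by (rule order_tendstoD(2)) (use \<epsilon> B in simp)
    then obtain L where L: "(LINT x|lborel. S x * indicator {x. real L < S x} x) < \<epsilon> / (8 * B)"
      unfolding eventually_sequentially by blast
    define N' where "N' = real L * C0 * (8 * B) / \<epsilon> + 1"
    have N': "0 < N'" using C0 B \<epsilon> by (simp add: N'_def add_nonneg_pos)
    have LN: "real L * (C0 / N') \<le> \<epsilon> / (8 * B)"
    proof -
      have "real L * C0 * (8 * B) / \<epsilon> \<le> N'" by (simp add: N'_def)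
      then show ?thesis using N' B \<epsilon> by (simp add: field_simps)
    qed
    \<comment> \<open>If \<open>0 < x \<le> A\<close> and the weighted function exceeds
      \<open>(1 + A powr lam) * N'\<close>, then \<open>\<phi> n x\<close> exceeds
      \<open>N'\<close>. What the truncation at \<open>N\<close> leaves over is therefore covered by
      \<open>tail\<close> and \<open>level\<close>.\<close>
    define N where "N = max A ((1 + A powr lam) * N')"
    have level: "(1 + A powr lam) * (LINT x|lborel. \<phi> n x * indicator {x. N' < \<phi> n x} x) \<le> \<epsilon> / 4" for n
    proof -
      define E where "E = {x. N' < \<phi> n x}"
      have [measurable]: "E \<in> sets borel" unfolding E_def by measurable
      have iE: "integrable lborel (indicator E :: real \<Rightarrow> real)"
      proof (rule Bochner_Integration.integrable_bound[of _ "\<lambda>x. \<phi> n x / N'"])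
        show "AE x in lborel. norm (indicator E x :: real) \<le> norm (\<phi> n x / N')"
          using N' nn by (intro AE_I2) (auto simp: E_def indicator_def field_simps)
      qed (use wsol_integrable[OF w] in auto)
      have mE: "(LINT x|lborel. indicator E x) \<le> C0 / N'"
      proof -
        have "(LINT x|lborel. indicator E x) \<le> (LINT x|lborel. \<phi> n x / N')"
          using N' nn by (intro integral_mono iE integrable_divide wsol_integrable[OF w]) (auto simp: E_def indicator_def field_simps)
        also have "\<dots> \<le> C0 / N'" using M0 N' by (simp add: divide_right_mono)
        finally show ?thesis .
      qed
      have iS: "integrable lborel (\<lambda>x. S x * indicator A x)" if [measurable]: "A \<in> sets borel" for A
        by (rule integrable_mult_bounded[OF S_int, where C=1]) (auto simp: indicator_def)
      have "(LINT x|lborel. S' n x * indicator E x) \<le> (LINT x|lborel. S x * indicator {x. real L < S x} x + real L * indicator E x)"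
      proof (rule integral_source_le[OF ap])
        show "integrable lborel (\<lambda>x. S x * indicator {x. real L < S x} x + real L * indicator E x)"
          using iE by (intro Bochner_Integration.integrable_add iS) auto
        show "S x * indicator E x \<le> S x * indicator {x. real L < S x} x + real L * indicator E x" for x
          using S_nonneg[of x] by (auto simp: indicator_def)
      qed auto
      also have "\<dots> = (LINT x|lborel. S x * indicator {x. real L < S x} x) + real L * (LINT x|lborel. indicator E x)"
        using iE iS[of "{x. real L < S x}"] by (subst Bochner_Integration.integral_add) auto
      also have "\<dots> \<le> \<epsilon> / (8 * B) + real L * (C0 / N')" using L mE by (intro add_mono mult_left_mono) auto
      also have "\<dots> \<le> \<epsilon> / (8 * B) + \<epsilon> / (8 * B)" using LN by simp
      also have "\<dots> = \<epsilon> / (4 * B)" by simp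
      finally have 1: "(LINT x|lborel. S' n x * indicator E x) \<le> \<epsilon> / (4 * B)" .
      define b where "b = (LINT x|lborel. \<phi> n x * indicator E x)"
      have b0: "0 \<le> b" unfolding b_def using nn by (intro integral_nonneg_AE AE_I2) auto
      have "k1 * c * b \<le> k1 * (LINT x|lborel. x powr lam * \<phi> n x) * b"
        using cMl[of n] k1 b0 by (intro mult_right_mono mult_left_mono) auto
      also have "\<dots> \<le> 2 * (LINT x|lborel. S' n x * indicator E x)"
        unfolding b_def E_def using N' by (intro superlevel_estimate[OF w U(1) U(3) _ mono]) auto
      also have "\<dots> \<le> 2 * (\<epsilon> / (4 * B))" using 1 by simp
      finally have "b * (k1 * c) \<le> 2 * (\<epsilon> / (4 * B))" by (simp only: mult.commute)
      then have "b \<le> 2 * (\<epsilon> / (4 * B)) / (k1 * c)" using k1 c by (subst pos_le_divide_eq) auto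
      then have "b \<le> 2 / (k1 * c) * (\<epsilon> / (4 * B))" by (simp only: times_divide_eq_left)
      then have "(1 + A powr lam) * b \<le> (1 + A powr lam) * (2 / (k1 * c) * (\<epsilon> / (4 * B)))"
        by (rule mult_left_mono) simp
      also have "\<dots> = B * (\<epsilon> / (4 * B))" by (simp add: B_def)
      also have "\<dots> = \<epsilon> / 4" using B by simp
      finally show ?thesis by (simp add: b_def E_def)
    qed
    have tail: "(LINT x|lborel. (1 + x powr lam) * \<phi> n x * indicator {A<..} x) \<le> 2 * A powr (lam - \<mu>) * C" for n
    proof -
      have "ennreal (LINT x|lborel. (1 + x powr lam) * \<phi> n x * indicator {A<..} x) = (\<integral>\<^sup>+x. ennreal ((1 + x powr lam) * \<phi> n x * indicator {A<..} x) \<partial>lborel)"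
        using nn by (intro nn_integral_eq_integral[symmetric] integrable_mult_bounded[OF int, where C=1]) (auto simp: indicator_def)
      also have "\<dots> \<le> (\<integral>\<^sup>+x. ennreal (2 * A powr (lam - \<mu>)) * ennreal (x powr \<mu> * \<phi> n x * indicator {1..} x) \<partial>lborel)"
      proof (rule nn_integral_mono)
        fix x :: real
        have "(1 + x powr lam) * \<phi> n x * indicator {A<..} x \<le> 2 * A powr (lam - \<mu>) * (x powr \<mu> * \<phi> n x * indicator {1..} x)"
        proof (cases "A < x")
          case True
          then have x: "1 \<le> x" using A by simp
          have "1 \<le> x powr lam" using x lam by (simp add: ge_one_powr_ge_zero)
          moreover have "x powr lam = x powr (lam - \<mu>) * x powr \<mu>" using x by (simp flip: powr_add)
          moreover have "x powr (lam - \<mu>) \<le> A powr (lam - \<mu>)" using True A \<mu> by (intro powr_mono2') auto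
          then have "x powr (lam - \<mu>) * x powr \<mu> \<le> A powr (lam - \<mu>) * x powr \<mu>" by (rule mult_right_mono) simp
          ultimately have "1 + x powr lam \<le> 2 * A powr (lam - \<mu>) * x powr \<mu>" by linarith
          then have "(1 + x powr lam) * \<phi> n x \<le> (2 * A powr (lam - \<mu>) * x powr \<mu>) * \<phi> n x" by (rule mult_right_mono[OF _ nn])
          then show ?thesis using True x by (simp add: mult.assoc)
        qed (use nn[of n x] in simp)
        then show "ennreal ((1 + x powr lam) * \<phi> n x * indicator {A<..} x) \<le> ennreal (2 * A powr (lam - \<mu>)) * ennreal (x powr \<mu> * \<phi> n x * indicator {1..} x)"
          by (subst ennreal_mult'[symmetric]) (auto intro!: ennreal_leI)
      qed
      also have "\<dots> = ennreal (2 * A powr (lam - \<mu>)) * (\<integral>\<^sup>+x. ennreal (x powr \<mu> * \<phi> n x * indicator {1..} x) \<partial>lborel)"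
        by (rule nn_integral_cmult) measurable
      also have "\<dots> \<le> ennreal (2 * A powr (lam - \<mu>)) * ennreal C" by (intro mult_left_mono CM) simp
      also have "\<dots> = ennreal (2 * A powr (lam - \<mu>) * C)" by (rule ennreal_mult'[symmetric]) simp
      finally show ?thesis using C by (subst (asm) ennreal_le_iff) auto
    qed
    show "\<exists>N>0. \<forall>n. (LINT x|lborel. (if \<bar>x\<bar> \<le> N \<and> (1 + x powr lam) * \<phi> n x \<le> N then 0 else (1 + x powr lam) * \<phi> n x)) < \<epsilon>"
    proof (intro exI[of _ N] conjI allI)
      show "0 < N" using A by (simp add: N_def)
      fix n
      define u where "u x = (1 + x powr lam) * \<phi> n x" for x
      have i1: "integrable lborel (\<lambda>x. u x * indicator {A<..} x)" unfolding u_def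
        by (intro integrable_mult_bounded[OF int, where C=1]) (auto simp: indicator_def)
      have i2: "integrable lborel (\<lambda>x. (1 + A powr lam) * (\<phi> n x * indicator {x. N' < \<phi> n x} x))"
        by (intro integrable_mult_right integrable_mult_bounded[OF wsol_integrable[OF w], where C=1]) (auto simp: indicator_def)
      have "(LINT x|lborel. (if \<bar>x\<bar> \<le> N \<and> u x \<le> N then 0 else u x)) \<le>
        (LINT x|lborel. u x * indicator {A<..} x + (1 + A powr lam) * (\<phi> n x * indicator {x. N' < \<phi> n x} x))"
      proof (rule integral_mono_AE'[OF Bochner_Integration.integrable_add[OF i1 i2]])
        show "AE x in lborel. (if \<bar>x\<bar> \<le> N \<and> u x \<le> N then 0 else u x) \<le> u x * indicator {A<..} x + (1 + A powr lam) * (\<phi> n x * indicator {x. N' < \<phi> n x} x)"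
        proof (rule AE_I2)
          fix x
          have u0: "0 \<le> u x" using nn by (simp add: u_def)
          have r0: "0 \<le> (1 + A powr lam) * (\<phi> n x * indicator {x. N' < \<phi> n x} x)" using nn by simp
          consider "x \<le> 0" | "A < x" | "0 < x" "x \<le> A" by linarith
          then show "(if \<bar>x\<bar> \<le> N \<and> u x \<le> N then 0 else u x) \<le> u x * indicator {A<..} x + (1 + A powr lam) * (\<phi> n x * indicator {x. N' < \<phi> n x} x)"
          proof cases
            case 1 then show ?thesis using neg0[of x n] A by (simp add: u_def)
          next
            case 2 then show ?thesis using u0 r0 by simp
          next
            case 3
            have xN: "\<bar>x\<bar> \<le> N" using 3 by (simp add: N_def)
            have "x powr lam \<le> A powr lam" using 3 lam by (intro powr_mono2) auto
            then have ule: "u x \<le> (1 + A powr lam) * \<phi> n x" unfolding u_def by (intro mult_right_mono nn) auto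
            show ?thesis
            proof (cases "u x \<le> N")
              case False
              then have "(1 + A powr lam) * N' < (1 + A powr lam) * \<phi> n x" using ule by (simp add: N_def)
              then have "N' < \<phi> n x" by (simp add: add_pos_nonneg)
              then show ?thesis using 3 ule False by simp
            qed (use xN u0 r0 in simp)
          qed
        qed
        show "AE x in lborel. 0 \<le> u x * indicator {A<..} x + (1 + A powr lam) * (\<phi> n x * indicator {x. N' < \<phi> n x} x)"
          using nn by (simp add: u_def)
      qed
      also have "\<dots> = (LINT x|lborel. u x * indicator {A<..} x) + (1 + A powr lam) * (LINT x|lborel. \<phi> n x * indicator {x. N' < \<phi> n x} x)"
        unfolding Bochner_Integration.integral_add[OF i1 i2] by simp
      also have "\<dots> < \<epsilon>" using tail[of n] level[of n] A \<epsilon> unfolding u_def by linarith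
      finally show "(LINT x|lborel. (if \<bar>x\<bar> \<le> N \<and> (1 + x powr lam) * \<phi> n x \<le> N then 0 else (1 + x powr lam) * \<phi> n x)) < \<epsilon>"
        unfolding u_def .
    qed
  qed
qed

section \<open>Passage to the limit in the truncated problems\<close>

text \<open>Divided by \<open>(1 + x powr lam) * (1 + y powr lam)\<close>, the kernel is bounded by
  \<open>k2\<close>. The weak limit is therefore taken of the weighted functions, the quadratic term
  converges by \<open>weak_lim_bilinear\<close>, and dividing the weight out of the limit gives the
  solution.\<close>

lemma exists_wsol:
  obtains \<phi> where "wsol S 0 {0<..} \<phi>"
proof -
  \<comment> \<open>One index drives all cutoffs: \<open>e n\<close> is both the removal rate and
    the lower size cutoff of the source, \<open>real (Suc n)\<close> bounds both the source and the
    sizes.\<close>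
  define e where "e n = 1 / real (Suc n)" for n
  define S' where "S' n x = min (S x) (real (Suc n)) * indicator {e n..} x" for n x
  define V where "V n = {0<..<real (Suc n)}" for n
  have e: "0 < e n" "e n \<le> 1" for n by (simp_all add: e_def)
  have [measurable]: "S' n \<in> borel_measurable borel" "V n \<in> sets borel" for n
    unfolding S'_def[abs_def] V_def by measurable
  have ap: "approx (S' n) (e n) (V n)" for n
    using S_nonneg e[of n] unfolding approx_def by (auto simp: S'_def V_def indicator_def)
  have "\<exists>\<phi>. wsol (S' n) (e n) (V n) \<phi>" for n
  proof -
    interpret coag_trunc lam k1 k2 K "real (Suc n)" "e n" "real (Suc n)" "e n" "S' n"
      using S_nonneg e[of n] by unfold_locales (auto simp: S'_def indicator_def min_def)
    have "U = V n" by (simp only: U_def V_def)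
    then show ?thesis using truncated_solution by simp
  qed
  then obtain \<psi> where \<psi>: "\<And>n. wsol (S' n) (e n) (V n) (\<psi> n)" by metis
  have e_ev: "\<forall>\<^sub>F n in sequentially. e n < x" if "0 < x" for x
    using order_tendstoD(2)[OF LIMSEQ_Suc[OF lim_const_over_n[of "1::real"]] that] by (simp add: e_def)
  have n_ev: "\<forall>\<^sub>F n in sequentially. x < real (Suc n)" for x
    using filterlim_at_top_dense[THEN iffD1, OF filterlim_real_sequentially, rule_format, of x]
    by eventually_elim simp
  have S'_lim: "(\<lambda>n. S' n x) \<longlonglongrightarrow> S x" for x
  proof (cases "0 < x")
    case True
    have "\<forall>\<^sub>F n in sequentially. S' n x = S x"
      using e_ev[OF True] n_ev[of "S x"] by eventually_elim (simp add: S'_def)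
    then show ?thesis by (rule tendsto_eventually)
  next
    case False
    then have "S' n x = 0" for n using e[of n] by (simp add: S'_def)
    then show ?thesis using False S_zero[of x] by simp
  qed
  have V_lim: "(\<lambda>n. indicator (V n) x :: real) \<longlonglongrightarrow> indicator {0<..} x" for x
  proof (rule tendsto_eventually)
    show "\<forall>\<^sub>F n in sequentially. (indicator (V n) x :: real) = indicator {0<..} x"
      using n_ev[of x] by eventually_elim (simp add: V_def indicator_def)
  qed
  have S'_le: "0 \<le> S' n x" "S' n x \<le> S x" for n x using ap[of n] by (auto simp: approx_def)
  have source_lim: "(\<lambda>n. LINT x|lborel. S' n x * (h x * indicator (V n) x)) \<longlonglongrightarrow> (LINT x|lborel. S x * h x)"
    if [measurable]: "h \<in> borel_measurable borel" and C: "\<And>x. \<bar>h x\<bar> \<le> C" for h C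
  proof (rule integral_dominated_convergence[where w="\<lambda>x. C * S x"])
    show "AE x in lborel. (\<lambda>n. S' n x * (h x * indicator (V n) x)) \<longlonglongrightarrow> S x * h x"
    proof (rule AE_I2)
      fix x
      have "(\<lambda>n. S' n x * (h x * indicator (V n) x)) \<longlonglongrightarrow> S x * (h x * indicator {0<..} x)"
        by (intro tendsto_mult S'_lim V_lim tendsto_const)
      moreover have "S x * (h x * indicator {0<..} x) = S x * h x" using S_zero[of x] by (cases "0 < x") auto
      ultimately show "(\<lambda>n. S' n x * (h x * indicator (V n) x)) \<longlonglongrightarrow> S x * h x" by simp
    qed
    show "AE x in lborel. norm (S' n x * (h x * indicator (V n) x)) \<le> C * S x" for n
    proof (rule AE_I2)
      fix x
      have "\<bar>h x * indicator (V n) x\<bar> \<le> C" using C[of x] by (auto simp: indicator_def)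
      then have "\<bar>S' n x\<bar> * \<bar>h x * indicator (V n) x\<bar> \<le> S x * C"
        using S'_le[of n x] S_nonneg[of x] by (intro mult_mono) auto
      then show "norm (S' n x * (h x * indicator (V n) x)) \<le> C * S x" by (simp add: abs_mult mult.commute)
    qed
  qed (use S_int in auto)
  \<comment> \<open>\<open>lam_moment_lower\<close> needs at least half of the source to survive the
    truncation. This holds from some \<open>n0\<close> on, hence the shifted index in
    \<open>v\<close>.\<close>
  have "\<forall>\<^sub>F n in sequentially. (LINT x|lborel. S x) / 2 < (LINT x|lborel. S' n x * (1 * indicator (V n) x))"
    by (rule order_tendstoD(1)[OF source_lim[where h="\<lambda>_. 1" and C=1]]) (use S_pos in auto)
  then obtain n0 where n0: "\<And>n. n \<ge> n0 \<Longrightarrow> (LINT x|lborel. S x) / 2 \<le> (LINT x|lborel. S' n x * indicator (V n) x)"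
    unfolding eventually_sequentially by (auto intro: less_imp_le)
  define v where "v n x = (1 + x powr lam) * \<psi> (n + n0) x" for n x
  have ui: "unif_int v"
    unfolding v_def using ap \<psi> n0 by (intro weighted_unif_int) auto
  obtain \<sigma> u where \<sigma>: "strict_mono \<sigma>" and u: "integrable lborel u" "\<And>x. 0 \<le> u x" and w: "weak_lim (\<lambda>n. v (\<sigma> n)) u"
    using unif_int_weak_subsequence[OF ui] by blast
  define s where "s n = \<sigma> n + n0" for n
  have s_ge: "n \<le> s n" for n using seq_suble[OF \<sigma>, of n] by (simp add: s_def)
  have s_lim: "filterlim s at_top sequentially"
    by (rule filterlim_at_top_mono[OF filterlim_ident]) (simp add: s_ge)
  define w' where "w' n x = (1 + x powr lam) * \<psi> (s n) x" for n x
  have ui': "unif_int w'" and wl: "weak_lim w' u"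
  proof -
    have "w' = (\<lambda>n. v (\<sigma> n))" by (intro ext) (simp add: v_def w'_def s_def)
    then show "unif_int w'" "weak_lim w' u" using unif_int_compose[OF ui, of \<sigma>] w by simp_all
  qed
  have [measurable]: "u \<in> borel_measurable borel" using u(1) by auto
  define d where "d x = 1 + x powr lam" for x :: real
  have d: "1 \<le> d x" for x by (simp add: d_def)
  define \<phi> where "\<phi> x = (if 0 < x then u x / d x else 0)" for x
  have [measurable]: "d \<in> borel_measurable borel" unfolding d_def[abs_def] by measurable
  have [measurable]: "\<phi> \<in> borel_measurable borel" unfolding \<phi>_def[abs_def] by measurable
  have \<phi>0: "0 \<le> \<phi> x" for x using u(2)[of x] d[of x] by (simp add: \<phi>_def)
  have int: "integrable lborel \<phi>"
  proof (rule Bochner_Integration.integrable_bound[OF u(1)])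
    have "u x / d x \<le> u x" for x using d[of x] u(2)[of x] by (simp add: divide_le_eq mult_le_cancel_left1)
    then show "AE x in lborel. norm (\<phi> x) \<le> norm (u x)" using u(2) \<phi>0 by (intro AE_I2) (auto simp: \<phi>_def)
  qed measurable
  have int_lam: "integrable lborel (\<lambda>x. x powr lam * \<phi> x)"
  proof (rule Bochner_Integration.integrable_bound[OF u(1)])
    have "x powr lam * (u x / d x) \<le> u x" for x
    proof -
      have "x powr lam * u x \<le> d x * u x" using u(2) by (intro mult_right_mono) (auto simp: d_def)
      then show ?thesis using d[of x] by (simp add: divide_le_eq mult.commute)
    qed
    then show "AE x in lborel. norm (x powr lam * \<phi> x) \<le> norm (u x)" using u(2) \<phi>0 by (intro AE_I2) (auto simp: \<phi>_def abs_mult)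
  qed measurable
  define \<kappa> where "\<kappa> x y = K x y / (d x * d y)" for x y
  have \<kappa>: "\<bar>\<kappa> x y\<bar> \<le> k2" for x y
  proof (cases "0 < x \<and> 0 < y")
    case True
    have "K x y \<le> k2 * (x powr lam + y powr lam)" using True K_upper by simp
    also have "\<dots> \<le> k2 * (d x * d y)" using k2 by (intro mult_left_mono) (auto simp: d_def algebra_simps)
    finally have "K x y / (d x * d y) \<le> k2" using d[of x] d[of y] by (subst pos_divide_le_eq) auto
    moreover have "0 \<le> K x y / (d x * d y)" using K_nonneg d[of x] d[of y] by (intro divide_nonneg_nonneg) auto
    ultimately show ?thesis by (simp add: \<kappa>_def)
  next
    case False
    then have "K x y = 0" by (intro K_zero) auto
    then show ?thesis using k2 by (simp add: \<kappa>_def)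
  qed
  have [measurable]: "case_prod \<kappa> \<in> borel_measurable (borel \<Otimes>\<^sub>M borel)" unfolding \<kappa>_def[abs_def] by measurable
  have rate_\<psi>: "rate (\<psi> (s n)) (x, y) = w' n x * (w' n y * \<kappa> x y)" for n x y
    using d[of x] d[of y] by (simp add: rate_def w'_def \<kappa>_def d_def[symmetric] field_simps)
  have rate_\<phi>: "rate \<phi> (x, y) = u x * (u y * \<kappa> x y)" for x y
    using d[of x] d[of y] K_zero[of x y] by (auto simp: rate_def \<phi>_def \<kappa>_def field_simps)
  have "wsol S 0 {0<..} \<phi>"
    unfolding wsol_def
  proof (intro conjI ballI impI allI int int_lam \<phi>0)
    show "\<phi> x = 0" if "x \<notin> {0<..}" for x using that by (simp add: \<phi>_def)
    fix \<theta> :: "real \<Rightarrow> real"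
    assume [measurable]: "\<theta> \<in> borel_measurable borel" and "\<exists>C. \<forall>x. \<bar>\<theta> x\<bar> \<le> C" and \<theta>0: "\<forall>x. x \<notin> {0<..} \<longrightarrow> \<theta> x = 0"
    then obtain C where C: "\<And>x. \<bar>\<theta> x\<bar> \<le> C" by blast
    have C0: "0 \<le> C" using C[of 0] by linarith
    \<comment> \<open>A test function must vanish outside \<open>V (s n)\<close> to be admissible in
      the truncated problem; the cut-off functions are bounded and converge pointwise, which
      \<open>weak_lim_bilinear\<close> tolerates.\<close>
    define t where "t n x = \<theta> x * indicator (V (s n)) x" for n x
    have [measurable]: "t n \<in> borel_measurable borel" for n unfolding t_def[abs_def] by measurable
    have tC: "\<bar>t n x\<bar> \<le> C" for n x using C[of x] C0 by (auto simp: t_def indicator_def)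
    have t_lim: "(\<lambda>n. t n x) \<longlonglongrightarrow> \<theta> x" for x
    proof -
      have "(\<lambda>n. t n x) \<longlonglongrightarrow> \<theta> x * indicator {0<..} x"
        unfolding t_def by (intro tendsto_mult_left filterlim_compose[OF V_lim s_lim])
      moreover have "\<theta> x * indicator {0<..} x = \<theta> x" using \<theta>0[rule_format, of x] by (cases "0 < x") auto
      ultimately show ?thesis by simp
    qed
    define g where "g n x y = (t n x + t n y - t n (x + y)) * \<kappa> x y" for n x y
    define gl where "gl x y = (\<theta> x + \<theta> y - \<theta> (x + y)) * \<kappa> x y" for x y
    have [measurable]: "case_prod (g n) \<in> borel_measurable (borel \<Otimes>\<^sub>M borel)" for n unfolding g_def[abs_def] by measurable
    have [measurable]: "case_prod gl \<in> borel_measurable (borel \<Otimes>\<^sub>M borel)" unfolding gl_def[abs_def] by measurable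
    have lim1: "(\<lambda>n. LINT x|lborel. w' n x * (LINT y|lborel. w' n y * g n x y)) \<longlonglongrightarrow> (LINT x|lborel. u x * (LINT y|lborel. u y * gl x y))"
    proof (rule weak_lim_bilinear[OF ui' wl u(1), where C="3 * C * k2"])
      show "\<bar>g n x y\<bar> \<le> 3 * C * k2" for n x y
      proof -
        have "\<bar>t n x + t n y - t n (x + y)\<bar> \<le> 3 * C" using tC[of n x] tC[of n y] tC[of n "x + y"] by linarith
        then show ?thesis unfolding g_def abs_mult using \<kappa> C0 by (intro mult_mono) auto
      qed
      show "(\<lambda>n. g n x y) \<longlonglongrightarrow> gl x y" for x y
        unfolding g_def gl_def by (intro tendsto_mult_right tendsto_add tendsto_diff t_lim)
    qed measurable
    have it1: "(LINT z|lborel2. (t n (fst z) + t n (snd z) - t n (fst z + snd z)) * rate (\<psi> (s n)) z)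
        = (LINT x|lborel. w' n x * (LINT y|lborel. w' n y * g n x y))" for n
    proof -
      have "\<bar>t n (fst z) + t n (snd z) - t n (fst z + snd z)\<bar> \<le> 3 * C" for z
        using tC[of n "fst z"] tC[of n "snd z"] tC[of n "fst z + snd z"] by linarith
      then have i: "integrable lborel2 (\<lambda>z. (t n (fst z) + t n (snd z) - t n (fst z + snd z)) * rate (\<psi> (s n)) z)"
        by (intro rate_test_integrable[OF \<psi>, where C="3 * C"]) (auto simp: V_def)
      have eq: "(t n x + t n y - t n (x + y)) * rate (\<psi> (s n)) (x, y) = w' n x * (w' n y * g n x y)" for x y
        unfolding rate_\<psi> g_def by (simp only: mult_ac)
      show ?thesis using lborel_pair.integral_fst'[OF i] by (simp add: eq)
    qed
    have it2: "(LINT z|lborel2. (\<theta> (fst z) + \<theta> (snd z) - \<theta> (fst z + snd z)) * rate \<phi> z)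
        = (LINT x|lborel. u x * (LINT y|lborel. u y * gl x y))"
    proof -
      have "integrable lborel2 (\<lambda>z. (u (fst z) * u (snd z)) * gl (fst z) (snd z))"
      proof (rule integrable_mult_bounded[OF integrable_lborel2_product[OF u(1) u(1)], where C="3 * C * k2"])
        fix z
        have "\<bar>\<theta> (fst z) + \<theta> (snd z) - \<theta> (fst z + snd z)\<bar> \<le> 3 * C"
          using C[of "fst z"] C[of "snd z"] C[of "fst z + snd z"] by linarith
        then show "\<bar>gl (fst z) (snd z)\<bar> \<le> 3 * C * k2" unfolding gl_def abs_mult using \<kappa> C0 by (intro mult_mono) auto
      qed (unfold gl_def[abs_def] \<kappa>_def[abs_def], measurable)
      moreover have eq: "(\<theta> x + \<theta> y - \<theta> (x + y)) * rate \<phi> (x, y) = u x * u y * gl x y" for x y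
        unfolding rate_\<phi> gl_def by (simp only: mult_ac)
      ultimately have i: "integrable lborel2 (\<lambda>z. (\<theta> (fst z) + \<theta> (snd z) - \<theta> (fst z + snd z)) * rate \<phi> z)"
        by (simp flip: eq)
      show ?thesis using lborel_pair.integral_fst'[OF i] by (simp add: eq mult.assoc)
    qed
    have eqn: "(LINT x|lborel. w' n x * (LINT y|lborel. w' n y * g n x y)) + 2 * e (s n) * (LINT x|lborel. t n x * \<psi> (s n) x)
        = 2 * (LINT x|lborel. S' (s n) x * t n x)" for n
      unfolding it1[symmetric] by (rule wsol_eq[OF \<psi> _ tC]) (auto simp: t_def)
    \<comment> \<open>The removal term disappears because \<open>\<psi> (s n) \<le> w' n\<close>, so
      that the masses are bounded, while the rate \<open>e (s n)\<close> tends to 0.\<close>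
    have lim2: "(\<lambda>n. 2 * e (s n) * (LINT x|lborel. t n x * \<psi> (s n) x)) \<longlonglongrightarrow> 0"
    proof -
      obtain M where M: "0 \<le> M" "\<And>n. (LINT x|lborel. w' n x) \<le> M" using unif_int_bounded[OF ui'] by blast
      have b: "\<bar>LINT x|lborel. t n x * \<psi> (s n) x\<bar> \<le> C * M" for n
      proof -
        have wi: "integrable lborel (w' n)" by (rule unif_int_integrable[OF ui'])
        have "\<bar>LINT x|lborel. t n x * \<psi> (s n) x\<bar> \<le> (LINT x|lborel. C * w' n x)"
        proof (rule order_trans[OF integral_abs_bound integral_mono])
          show "integrable lborel (\<lambda>x. \<bar>t n x * \<psi> (s n) x\<bar>)"
            using integrable_mult_bounded[where f="t n", OF wsol_integrable[OF \<psi>[of "s n"]] _ tC[of n]] by (simp add: mult.commute)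
          show "\<bar>t n x * \<psi> (s n) x\<bar> \<le> C * w' n x" for x
          proof -
            have "1 * \<psi> (s n) x \<le> d x * \<psi> (s n) x" using d wsol_nonneg[OF \<psi>] by (intro mult_right_mono)
            then have "\<psi> (s n) x \<le> w' n x" by (simp add: w'_def d_def)
            then have "\<bar>t n x\<bar> * \<psi> (s n) x \<le> C * w' n x" using tC C0 wsol_nonneg[OF \<psi>] by (intro mult_mono)
            then show ?thesis using wsol_nonneg[OF \<psi>, of "s n" x] by (simp add: abs_mult)
          qed
        qed (use wi in auto)
        also have "\<dots> \<le> C * M" using M C0 by (simp add: mult_left_mono)
        finally show ?thesis .
      qed
      have e_lim: "(\<lambda>n. 2 * e (s n) * (C * M)) \<longlonglongrightarrow> 2 * 0 * (C * M)"
      proof (intro tendsto_mult tendsto_const)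
        have "e \<longlonglongrightarrow> 0" unfolding e_def[abs_def] by (rule LIMSEQ_Suc[OF lim_const_over_n])
        then show "(\<lambda>n. e (s n)) \<longlonglongrightarrow> 0" by (rule filterlim_compose[OF _ s_lim])
      qed
      show ?thesis
      proof (rule Lim_null_comparison[OF always_eventually])
        show "\<forall>n. norm (2 * e (s n) * (LINT x|lborel. t n x * \<psi> (s n) x)) \<le> 2 * e (s n) * (C * M)"
          using b e less_imp_le[OF e(1)] by (auto simp: abs_mult intro!: mult_left_mono)
        show "(\<lambda>n. 2 * e (s n) * (C * M)) \<longlonglongrightarrow> 0" using e_lim by simp
      qed
    qed
    have lim3: "(\<lambda>n. 2 * (LINT x|lborel. S' (s n) x * t n x)) \<longlonglongrightarrow> 2 * (LINT x|lborel. S x * \<theta> x)"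
      unfolding t_def by (intro tendsto_mult_left filterlim_compose[OF source_lim[where C=C] s_lim] C) measurable
    have "(LINT x|lborel. u x * (LINT y|lborel. u y * gl x y)) + 0 = 2 * (LINT x|lborel. S x * \<theta> x)"
      by (rule LIMSEQ_unique[OF tendsto_add[OF lim1 lim2]]) (simp only: eqn lim3)
    then show "(LINT z|lborel2. (\<theta> (fst z) + \<theta> (snd z) - \<theta> (fst z + snd z)) * (K (fst z) (snd z) * \<phi> (fst z) * \<phi> (snd z)))
        + 2 * 0 * (LINT x|lborel. \<theta> x * \<phi> x) = 2 * (LINT x|lborel. S x * \<theta> x)"
      using it2 by (simp add: rate_def)
  qed
  then show thesis by (rule that)
qed

section \<open>Moments of solutions of the full problem\<close>

lemma approx_self: "approx S 0 {0<..}"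
  using S_nonneg unfolding approx_def by auto

lemma wsol_moments:
  assumes w: "wsol S 0 {0<..} \<phi>" and \<mu>: "0 \<le> \<mu>" "\<mu> < (1 + lam) / 2"
  shows "integrable lborel (\<lambda>x. x powr \<mu> * \<phi> x)"
proof -
  have [measurable]: "\<phi> \<in> borel_measurable borel" using w by (rule wsol_meas)
  note nn = wsol_nonneg[OF w]
  obtain C where C: "(\<integral>\<^sup>+x. ennreal (x powr \<mu> * \<phi> x * indicator {1..} x) \<partial>lborel) \<le> ennreal C"
    using moment_bound[OF \<mu>, of thesis] approx_self w by blast
  have i: "integrable lborel (\<lambda>x. x powr \<mu> * \<phi> x * indicator {1..} x)"
    by (rule integrableI_nonneg) (use nn C in \<open>auto intro: le_less_trans\<close>)
  show ?thesis
  proof (rule Bochner_Integration.integrable_bound[OF Bochner_Integration.integrable_add[OF wsol_integrable[OF w] i]])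
    show "AE x in lborel. norm (x powr \<mu> * \<phi> x) \<le> norm (\<phi> x + x powr \<mu> * \<phi> x * indicator {1..} x)"
    proof (rule AE_I2)
      fix x
      show "norm (x powr \<mu> * \<phi> x) \<le> norm (\<phi> x + x powr \<mu> * \<phi> x * indicator {1..} x)"
      proof (cases "0 < x \<and> x < 1")
        case True
        then have "x powr \<mu> \<le> 1" using \<mu> by (simp add: powr_le1)
        then show ?thesis using True nn[of x] by (simp add: mult_left_le_one_le)
      next
        case False
        then consider "x \<le> 0" | "1 \<le> x" by linarith
        then show ?thesis
        proof cases
          case 1 then show ?thesis using wsol_zero[OF w, of x] by simp
        next
          case 2 then show ?thesis using nn[of x] by simp
        qed
      qed
    qed
  qed measurable
qed

text \<open>A negative power is nonincreasing but unbounded at 0, so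
  \<open>antimono_estimate\<close> is applied to \<open>min (x powr m) (real n)\<close>. The
  resulting bound does not depend on \<open>n\<close>, because the moment of order
  \<open>lam\<close> is bounded below, and Fatou's lemma removes the truncation.\<close>

lemma wsol_negative_moments:
  assumes w: "wsol S 0 {0<..} \<phi>" and m: "m < 0" and Sm: "integrable lborel (\<lambda>x. x powr m * S x)"
  shows "integrable lborel (\<lambda>x. x powr m * \<phi> x)"
proof -
  have [measurable]: "\<phi> \<in> borel_measurable borel" using w by (rule wsol_meas)
  note nn = wsol_nonneg[OF w]
  obtain c where c: "0 < c" "c \<le> (LINT x|lborel. x powr lam * \<phi> x)"
  proof -
    have "(LINT x|lborel. S x * indicator {0<..} x) = (LINT x|lborel. S x)"
      using S_zero by (intro Bochner_Integration.integral_cong) (auto simp: indicator_def not_less)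
    then have "(LINT x|lborel. S x) / 2 \<le> (LINT x|lborel. S x * indicator {0<..} x)" using S_pos by simp
    then show thesis using lam_moment_lower[of thesis] approx_self w that by blast
  qed
  define \<theta> where "\<theta> n x = (if 0 < x then min (x powr m) (real n) else 0)" for n x
  have [measurable]: "\<theta> n \<in> borel_measurable borel" for n unfolding \<theta>_def[abs_def] by measurable
  have \<theta>0: "0 \<le> \<theta> n x" "\<theta> n x \<le> real n" for n x by (auto simp: \<theta>_def)
  define D where "D = 2 * (LINT x|lborel. x powr m * S x) / (k1 * c)"
  have \<theta>\<phi>i: "integrable lborel (\<lambda>x. \<theta> n x * \<phi> x)" for n
    using integrable_mult_bounded[OF wsol_integrable[OF w], of "\<theta> n" "real n"] \<theta>0 by (simp add: mult.commute)
  have bound: "(LINT x|lborel. \<theta> n x * \<phi> x) \<le> D" for n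
  proof -
    have b0: "0 \<le> (LINT x|lborel. \<theta> n x * \<phi> x)" using nn \<theta>0 by (intro integral_nonneg_AE AE_I2) auto
    have "k1 * c * (LINT x|lborel. \<theta> n x * \<phi> x) \<le> (k1 * (LINT x|lborel. x powr lam * \<phi> x) + 2 * 0) * (LINT x|lborel. \<theta> n x * \<phi> x)"
      using c k1 b0 by (intro mult_right_mono) auto
    also have "\<dots> \<le> 2 * (LINT x|lborel. S x * (\<theta> n x * indicator {0<..} x))"
    proof (rule antimono_estimate[OF w])
      show "\<theta> n y \<le> \<theta> n x" if "0 < x" "x \<le> y" for x y
      proof -
        have "y powr m \<le> x powr m" using that m by (intro powr_mono2') auto
        then show ?thesis using that by (auto simp: \<theta>_def)
      qed
    qed (use \<theta>0 in auto)
    also have "(LINT x|lborel. S x * (\<theta> n x * indicator {0<..} x)) \<le> (LINT x|lborel. x powr m * S x)"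
    proof (rule integral_mono_AE'[OF Sm])
      have "S x * (\<theta> n x * indicator {0<..} x) \<le> x powr m * S x" for x
      proof -
        have "S x * (\<theta> n x * indicator {0<..} x) \<le> S x * x powr m"
          using S_nonneg by (intro mult_left_mono) (auto simp: \<theta>_def)
        then show ?thesis by (simp add: mult.commute)
      qed
      then show "AE x in lborel. S x * (\<theta> n x * indicator {0<..} x) \<le> x powr m * S x" by simp
    qed (use S_nonneg in auto)
    finally have "(LINT x|lborel. \<theta> n x * \<phi> x) * (k1 * c) \<le> 2 * (LINT x|lborel. x powr m * S x)"
      by (simp add: mult_ac)
    then show ?thesis unfolding D_def using k1 c by (subst pos_le_divide_eq) auto
  qed
  have lim: "(\<lambda>n. ennreal (\<theta> n x * \<phi> x)) \<longlonglongrightarrow> ennreal (x powr m * \<phi> x)" for x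
  proof (rule tendsto_eventually)
    have "\<forall>\<^sub>F n in sequentially. x powr m < real n"
      by (rule filterlim_at_top_dense[THEN iffD1, OF filterlim_real_sequentially, rule_format])
    then show "\<forall>\<^sub>F n in sequentially. ennreal (\<theta> n x * \<phi> x) = ennreal (x powr m * \<phi> x)"
      by eventually_elim (use wsol_zero[OF w, of x] in \<open>auto simp: \<theta>_def\<close>)
  qed
  have "(\<integral>\<^sup>+x. ennreal (x powr m * \<phi> x) \<partial>lborel) = (\<integral>\<^sup>+x. liminf (\<lambda>n. ennreal (\<theta> n x * \<phi> x)) \<partial>lborel)"
    by (intro nn_integral_cong lim_imp_Liminf[symmetric] lim) simp
  also have "\<dots> \<le> liminf (\<lambda>n. \<integral>\<^sup>+x. ennreal (\<theta> n x * \<phi> x) \<partial>lborel)"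
    by (rule nn_integral_liminf) measurable
  also have "\<dots> \<le> liminf (\<lambda>n::nat. ennreal D)"
  proof (rule Liminf_mono, rule always_eventually, rule allI)
    fix n
    have "(\<integral>\<^sup>+x. ennreal (\<theta> n x * \<phi> x) \<partial>lborel) = ennreal (LINT x|lborel. \<theta> n x * \<phi> x)"
      using nn \<theta>0 by (intro nn_integral_eq_integral \<theta>\<phi>i) auto
    also have "\<dots> \<le> ennreal D" by (intro ennreal_leI bound)
    finally show "(\<integral>\<^sup>+x. ennreal (\<theta> n x * \<phi> x) \<partial>lborel) \<le> ennreal D" .
  qed
  also have "\<dots> = ennreal D" by (simp add: Liminf_const)
  finally have "(\<integral>\<^sup>+x. ennreal (x powr m * \<phi> x) \<partial>lborel) < \<infinity>" by (auto intro: le_less_trans)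
  then show ?thesis using nn by (intro integrableI_nonneg) auto
qed

end

section \<open>Nonexistence and criticality\<close>

context coag
begin

text \<open>The defect of \<open>min x n\<close> is at most \<open>min x y\<close> and vanishes once
  \<open>n\<close> exceeds \<open>x + y\<close>. Under hypothesis \<open>i\<close>, dominated
  convergence makes the flux to infinity vanish, and nothing is left to balance the mass that the
  source supplies.\<close>

lemma source_vanishes:
  assumes w: "wsol S 0 {0<..} \<phi>" and S: "integrable lborel S" "\<And>x. 0 \<le> S x" "\<And>x. x \<le> 0 \<Longrightarrow> S x = 0"
    and i: "integrable lborel2 (\<lambda>z. min (fst z) (snd z) * (fst z powr lam + snd z powr lam) * (\<phi> (fst z) * \<phi> (snd z)))"
  shows "AE x in lborel. S x = 0"
proof -
  have [measurable]: "\<phi> \<in> borel_measurable borel" using w by (rule wsol_meas)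
  have [measurable]: "S \<in> borel_measurable borel" using S by auto
  have U: "({0<..} :: real set) \<subseteq> {0<..}" by simp
  have [measurable]: "rate \<phi> \<in> borel_measurable (borel \<Otimes>\<^sub>M borel)" by (rule rate_meas[OF w U])
  define \<theta> where "\<theta> n x = min x (real n) * indicator {0<..} x" for n x
  have [measurable]: "\<theta> n \<in> borel_measurable borel" for n unfolding \<theta>_def[abs_def] by measurable
  have \<theta>0: "0 \<le> \<theta> n x" "\<theta> n x \<le> real n" for n x by (auto simp: \<theta>_def indicator_def)
  define g where "g n z = (\<theta> n (fst z) + \<theta> n (snd z) - \<theta> n (fst z + snd z)) * rate \<phi> z" for n z
  have rate0: "rate \<phi> z = 0" if "\<not> (0 < fst z \<and> 0 < snd z)" for z
    using that wsol_zero[OF w, of "fst z"] wsol_zero[OF w, of "snd z"] by (auto simp: rate_def)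
  have eq: "(LINT z|lborel2. g n z) = 2 * (LINT x|lborel. S x * \<theta> n x)" for n
    using wsol_eq[OF w, of "\<theta> n" "real n"] \<theta>0 by (simp add: g_def \<theta>_def)
  have "(\<lambda>n. LINT z|lborel2. g n z) \<longlonglongrightarrow> (LINT z|lborel2. (0::real))"
  proof (rule integral_dominated_convergence[where
      w="\<lambda>z. k2 * (min (fst z) (snd z) * (fst z powr lam + snd z powr lam) * (\<phi> (fst z) * \<phi> (snd z)))"])
    have "(\<lambda>n. g n z) \<longlonglongrightarrow> 0" for z
    proof (rule tendsto_eventually)
      have "\<forall>\<^sub>F n in sequentially. \<bar>fst z\<bar> + \<bar>snd z\<bar> < real n"
        by (rule filterlim_at_top_dense[THEN iffD1, OF filterlim_real_sequentially, rule_format])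
      then show "\<forall>\<^sub>F n in sequentially. g n z = 0"
      proof eventually_elim
        case (elim n)
        show ?case
        proof (cases "0 < fst z \<and> 0 < snd z")
          case True
          then show ?thesis using elim by (simp add: g_def \<theta>_def)
        qed (simp add: g_def rate0)
      qed
    qed
    then show "AE z in lborel2. (\<lambda>n. g n z) \<longlonglongrightarrow> 0" by simp
    show "AE z in lborel2. norm (g n z) \<le> k2 * (min (fst z) (snd z) * (fst z powr lam + snd z powr lam) * (\<phi> (fst z) * \<phi> (snd z)))" for n
    proof (rule AE_I2)
      fix z
      show "norm (g n z) \<le> k2 * (min (fst z) (snd z) * (fst z powr lam + snd z powr lam) * (\<phi> (fst z) * \<phi> (snd z)))"
      proof (cases "0 < fst z \<and> 0 < snd z")
        case True
        then have "\<bar>\<theta> n (fst z) + \<theta> n (snd z) - \<theta> n (fst z + snd z)\<bar> \<le> min (fst z) (snd z)"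
          by (auto simp: \<theta>_def min_def)
        then have "\<bar>g n z\<bar> \<le> min (fst z) (snd z) * rate \<phi> z"
          unfolding g_def abs_mult using rate_nonneg[OF w U, of z] by (simp add: mult_right_mono)
        also have "\<dots> \<le> min (fst z) (snd z) * (k2 * (fst z powr lam + snd z powr lam) * (\<phi> (fst z) * \<phi> (snd z)))"
          using True by (intro mult_left_mono rate_le[OF w U]) auto
        finally show ?thesis by (simp add: mult_ac)
      next
        case False
        then have "\<phi> (fst z) * \<phi> (snd z) = 0" using wsol_zero[OF w, of "fst z"] wsol_zero[OF w, of "snd z"] by auto
        then show ?thesis using rate0[OF False] by (auto simp: g_def)
      qed
    qed
  qed (use i in \<open>auto simp: g_def measurable_lborel2\<close>)
  then have lim: "(\<lambda>n. 2 * (LINT x|lborel. S x * \<theta> n x)) \<longlonglongrightarrow> 0" by (simp add: eq)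
  have iS: "integrable lborel (\<lambda>x. S x * \<theta> n x)" for n
    by (rule integrable_mult_bounded[OF S(1), where C="real n"]) (use \<theta>0 in auto)
  have nn: "0 \<le> S x * \<theta> 1 x" for x using S(2) \<theta>0 by simp
  \<comment> \<open>The integrals increase with \<open>n\<close> and tend to 0, so already the one
    for \<open>n = 1\<close> vanishes; \<open>\<theta> 1\<close> is positive on
    \<open>{0<..}\<close>.\<close>
  have "2 * (LINT x|lborel. S x * \<theta> 1 x) \<le> 0"
  proof (rule LIMSEQ_le_const[OF lim], rule exI[of _ 1], intro allI impI)
    fix n :: nat assume "1 \<le> n"
    then have "\<theta> 1 x \<le> \<theta> n x" for x by (auto simp: \<theta>_def indicator_def)
    then show "2 * (LINT x|lborel. S x * \<theta> 1 x) \<le> 2 * (LINT x|lborel. S x * \<theta> n x)"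
      by (intro mult_left_mono integral_mono iS S) auto
  qed
  then have "(LINT x|lborel. S x * \<theta> 1 x) = 0" using nn by (intro antisym integral_nonneg_AE AE_I2) auto
  then have "AE x in lborel. S x * \<theta> 1 x = 0"
    using integral_nonneg_eq_0_iff_AE[OF iS[of 1]] nn by simp
  then show ?thesis
  proof eventually_elim
    case (elim x)
    then show ?case using S(3)[of x] by (cases "0 < x") (auto simp: \<theta>_def min_def split: if_splits)
  qed
qed

text \<open>Let \<open>p = (1 + lam) / 2\<close> and \<open>x \<le> y\<close>. Then
  \<open>x * (x powr lam + y powr lam)\<close> is at most
  \<open>2 * x powr p * x powr (1 - p) * y powr lam\<close>, and the last two factors are at most
  \<open>y powr p\<close> because \<open>p \<le> 1\<close> and \<open>1 - p + lam = p\<close>. So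
  the weight in \<open>source_vanishes\<close> is dominated by a product of critical
  weights.\<close>

lemma source_vanishes_of_critical_moment:
  assumes w: "wsol S 0 {0<..} \<phi>" and S: "integrable lborel S" "\<And>x. 0 \<le> S x" "\<And>x. x \<le> 0 \<Longrightarrow> S x = 0"
    and lam1: "lam < 1" and i: "integrable lborel (\<lambda>x. x powr ((1 + lam) / 2) * \<phi> x)"
  shows "AE x in lborel. S x = 0"
proof (rule source_vanishes[OF w S])
  have [measurable]: "\<phi> \<in> borel_measurable borel" using w by (rule wsol_meas)
  define p where "p = (1 + lam) / 2"
  have key: "x * (x powr lam + y powr lam) \<le> 2 * (x powr p * y powr p)" if "0 < x" "x \<le> y" for x y
  proof -
    have "x powr lam \<le> y powr lam" using that lam by (intro powr_mono2) auto
    then have "x * (x powr lam + y powr lam) \<le> x * (2 * y powr lam)" using that by (intro mult_left_mono) auto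
    also have "\<dots> = 2 * (x powr p * (x powr (1 - p) * y powr lam))"
      using that by (simp add: mult.left_commute flip: powr_add mult.assoc)
    also have "\<dots> \<le> 2 * (x powr p * (y powr (1 - p) * y powr lam))"
      using that lam1 by (intro mult_left_mono mult_right_mono powr_mono2) (auto simp: p_def)
    also have "y powr (1 - p) * y powr lam = y powr p" by (simp add: p_def field_simps flip: powr_add)
    finally show ?thesis .
  qed
  show "integrable lborel2 (\<lambda>z. min (fst z) (snd z) * (fst z powr lam + snd z powr lam) * (\<phi> (fst z) * \<phi> (snd z)))"
  proof (rule Bochner_Integration.integrable_bound[of _ "\<lambda>z. 2 * ((fst z powr p * \<phi> (fst z)) * (snd z powr p * \<phi> (snd z)))"])
    show "integrable lborel2 (\<lambda>z. 2 * ((fst z powr p * \<phi> (fst z)) * (snd z powr p * \<phi> (snd z))))"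
      using integrable_lborel2_product[OF i i] by (simp add: p_def)
    show "AE z in lborel2. norm (min (fst z) (snd z) * (fst z powr lam + snd z powr lam) * (\<phi> (fst z) * \<phi> (snd z)))
        \<le> norm (2 * ((fst z powr p * \<phi> (fst z)) * (snd z powr p * \<phi> (snd z))))"
    proof (rule AE_I2)
      fix z :: "real \<times> real"
      show "norm (min (fst z) (snd z) * (fst z powr lam + snd z powr lam) * (\<phi> (fst z) * \<phi> (snd z)))
        \<le> norm (2 * ((fst z powr p * \<phi> (fst z)) * (snd z powr p * \<phi> (snd z))))"
      proof (cases "0 < fst z \<and> 0 < snd z")
        case True
        have "min (fst z) (snd z) * (fst z powr lam + snd z powr lam) \<le> 2 * (fst z powr p * snd z powr p)"
          using key[of "fst z" "snd z"] key[of "snd z" "fst z"] True by (auto simp: min_def add.commute mult.commute)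
        then have "min (fst z) (snd z) * (fst z powr lam + snd z powr lam) * (\<phi> (fst z) * \<phi> (snd z))
          \<le> 2 * (fst z powr p * snd z powr p) * (\<phi> (fst z) * \<phi> (snd z))"
          by (rule mult_right_mono) (simp add: wsol_nonneg[OF w])
        then show ?thesis using True wsol_nonneg[OF w] by (simp add: abs_mult mult_ac)
      next
        case False
        then have "\<phi> (fst z) = 0 \<or> \<phi> (snd z) = 0" using wsol_zero[OF w, of "fst z"] wsol_zero[OF w, of "snd z"] by auto
        then show ?thesis by auto
      qed
    qed
  qed (simp add: measurable_lborel2)
qed

text \<open>\<open>min x y\<close> is estimated by the variable that does not carry the power
  \<open>lam\<close>; the first moment needed for this is finite, since
  \<open>x \<le> 1 + x powr lam\<close> for \<open>lam \<ge> 1\<close>.\<close>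

lemma source_vanishes_superlinear:
  assumes w: "wsol S 0 {0<..} \<phi>" and S: "integrable lborel S" "\<And>x. 0 \<le> S x" "\<And>x. x \<le> 0 \<Longrightarrow> S x = 0"
    and lam1: "1 \<le> lam"
  shows "AE x in lborel. S x = 0"
proof (rule source_vanishes[OF w S])
  have [measurable]: "\<phi> \<in> borel_measurable borel" using w by (rule wsol_meas)
  note il = wsol_integrable_lam[OF w]
  have i1: "integrable lborel (\<lambda>x. x * \<phi> x)"
  proof (rule Bochner_Integration.integrable_bound[OF Bochner_Integration.integrable_add[OF wsol_integrable[OF w] il]])
    show "AE x in lborel. norm (x * \<phi> x) \<le> norm (\<phi> x + x powr lam * \<phi> x)"
    proof (rule AE_I2)
      fix x
      show "norm (x * \<phi> x) \<le> norm (\<phi> x + x powr lam * \<phi> x)"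
      proof (cases "0 < x")
        case True
        have "x \<le> 1 + x powr lam"
        proof (cases "x \<le> 1")
          case False
          then have "x powr 1 \<le> x powr lam" using lam1 by (intro powr_mono) auto
          then show ?thesis using True by simp
        qed (simp add: add_increasing2)
        then have "x * \<phi> x \<le> (1 + x powr lam) * \<phi> x" by (rule mult_right_mono[OF _ wsol_nonneg[OF w]])
        then show ?thesis using True wsol_nonneg[OF w, of x] by (simp add: abs_mult distrib_right)
      qed (use wsol_zero[OF w, of x] in simp)
    qed
  qed measurable
  show "integrable lborel2 (\<lambda>z. min (fst z) (snd z) * (fst z powr lam + snd z powr lam) * (\<phi> (fst z) * \<phi> (snd z)))"
  proof (rule Bochner_Integration.integrable_bound[of _ "\<lambda>z. (fst z powr lam * \<phi> (fst z)) * (snd z * \<phi> (snd z)) + (fst z * \<phi> (fst z)) * (snd z powr lam * \<phi> (snd z))"])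
    show "integrable lborel2 (\<lambda>z. (fst z powr lam * \<phi> (fst z)) * (snd z * \<phi> (snd z)) + (fst z * \<phi> (fst z)) * (snd z powr lam * \<phi> (snd z)))"
      by (rule Bochner_Integration.integrable_add[OF integrable_lborel2_product[OF il i1] integrable_lborel2_product[OF i1 il]])
    show "AE z in lborel2. norm (min (fst z) (snd z) * (fst z powr lam + snd z powr lam) * (\<phi> (fst z) * \<phi> (snd z)))
        \<le> norm ((fst z powr lam * \<phi> (fst z)) * (snd z * \<phi> (snd z)) + (fst z * \<phi> (fst z)) * (snd z powr lam * \<phi> (snd z)))"
    proof (rule AE_I2)
      fix z :: "real \<times> real"
      show "norm (min (fst z) (snd z) * (fst z powr lam + snd z powr lam) * (\<phi> (fst z) * \<phi> (snd z)))
        \<le> norm ((fst z powr lam * \<phi> (fst z)) * (snd z * \<phi> (snd z)) + (fst z * \<phi> (fst z)) * (snd z powr lam * \<phi> (snd z)))"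
      proof (cases "0 < fst z \<and> 0 < snd z")
        case True
        have "min (fst z) (snd z) * (fst z powr lam + snd z powr lam) \<le> snd z * fst z powr lam + fst z * snd z powr lam"
          unfolding distrib_left by (intro add_mono mult_right_mono) auto
        then have "min (fst z) (snd z) * (fst z powr lam + snd z powr lam) * (\<phi> (fst z) * \<phi> (snd z))
          \<le> (snd z * fst z powr lam + fst z * snd z powr lam) * (\<phi> (fst z) * \<phi> (snd z))"
          by (rule mult_right_mono) (simp add: wsol_nonneg[OF w])
        also have "\<dots> = (fst z powr lam * \<phi> (fst z)) * (snd z * \<phi> (snd z)) + (fst z * \<phi> (fst z)) * (snd z powr lam * \<phi> (snd z))"
          by (simp add: algebra_simps)
        finally show ?thesis using True wsol_nonneg[OF w] by (simp add: abs_mult)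
      next
        case False
        then have "\<phi> (fst z) = 0 \<or> \<phi> (snd z) = 0" using wsol_zero[OF w, of "fst z"] wsol_zero[OF w, of "snd z"] by auto
        then show ?thesis by auto
      qed
    qed
  qed (simp add: measurable_lborel2)
qed

text \<open>Without a source, \<open>total_upper\<close> forces the total mass or the moment of
  order \<open>lam\<close> to vanish; each has an integrand that is positive wherever
  \<open>\<phi>\<close> is.\<close>

lemma solution_vanishes:
  assumes w: "wsol S 0 {0<..} \<phi>" and S: "AE x in lborel. S x = 0"
  shows "AE x in lborel. \<phi> x = 0"
proof -
  have [measurable]: "\<phi> \<in> borel_measurable borel" using w by (rule wsol_meas)
  note nn = wsol_nonneg[OF w]
  have "k1 * ((LINT x|lborel. \<phi> x) * (LINT x|lborel. x powr lam * \<phi> x)) \<le> (LINT x|lborel. S x * indicator {0<..} x)"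
    by (rule total_upper[OF w]) auto
  also have "\<dots> = 0" using S by (intro integral_eq_zero_AE) auto
  finally have "(LINT x|lborel. \<phi> x) * (LINT x|lborel. x powr lam * \<phi> x) \<le> 0" using k1 by (simp add: mult_le_0_iff)
  moreover have "0 \<le> (LINT x|lborel. \<phi> x)" "0 \<le> (LINT x|lborel. x powr lam * \<phi> x)"
    using nn by (auto intro!: integral_nonneg_AE AE_I2)
  ultimately consider "(LINT x|lborel. \<phi> x) = 0" | "(LINT x|lborel. x powr lam * \<phi> x) = 0"
    by (auto simp: mult_le_0_iff)
  then show ?thesis
  proof cases
    case 1
    then show ?thesis using integral_nonneg_eq_0_iff_AE[OF wsol_integrable[OF w]] nn by simp
  next
    case 2
    then have "AE x in lborel. x powr lam * \<phi> x = 0"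
      using integral_nonneg_eq_0_iff_AE[OF wsol_integrable_lam[OF w]] nn by simp
    then show ?thesis
    proof eventually_elim
      case (elim x) then show ?case using wsol_zero[OF w, of x] by (cases "0 < x") auto
    qed
  qed
qed

end

section \<open>Passage to Borel representatives\<close>

lemma borel_measurable_completion_cong_AE:
  fixes f g :: "'a \<Rightarrow> real"
  assumes g: "g \<in> borel_measurable M" and eq: "AE x in M. f x = g x"
  shows "f \<in> borel_measurable (completion M)"
proof (rule borel_measurableI)
  fix A :: "real set" assume "open A"
  then have "g -` A \<inter> space M \<in> sets (completion M)" using g by (auto intro: measurable_sets)
  moreover have "AE x in completion M. (x \<in> g -` A \<inter> space M) = (x \<in> f -` A \<inter> space M)"
    using AE_completion[OF eq] by eventually_elim auto
  ultimately show "f -` A \<inter> space (completion M) \<in> sets (completion M)"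
    using complete_measure.in_sets_AE[OF completion.complete_measure_axioms, of "g -` A \<inter> space M" "f -` A \<inter> space M"]
    by simp
qed

lemma
  fixes f g :: "real \<Rightarrow> real"
  assumes [measurable]: "g \<in> borel_measurable borel" and eq: "AE x in lborel. 0 < x \<longrightarrow> f x = g x"
  shows set_integral_lebesgue_cong: "(LINT x:{0<..}|lebesgue. f x) = (LINT x|lborel. indicator {0<..} x * g x)"
    and set_integrable_lebesgue_cong: "set_integrable lebesgue {0<..} f \<longleftrightarrow> integrable lborel (\<lambda>x. indicator {0<..} x * g x)"
proof -
  have eq': "AE x in lborel. indicator {0<..} x *\<^sub>R f x = indicator {0<..} x * g x"
    using eq by eventually_elim (auto simp: indicator_def)
  have gm: "(\<lambda>x. indicator {0<..} x * g x) \<in> borel_measurable lborel" by measurable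
  have fm: "(\<lambda>x. indicator {0<..} x *\<^sub>R f x) \<in> borel_measurable lebesgue"
    by (rule borel_measurable_completion_cong_AE[OF gm eq'])
  have "(LINT x:{0<..}|lebesgue. f x) = (LINT x|lebesgue. indicator {0<..} x * g x)"
    unfolding set_lebesgue_integral_def
    by (rule integral_cong_AE[OF fm measurable_completion[OF gm] AE_completion[OF eq']])
  then show "(LINT x:{0<..}|lebesgue. f x) = (LINT x|lborel. indicator {0<..} x * g x)"
    by (simp add: integral_completion[OF gm])
  have "set_integrable lebesgue {0<..} f \<longleftrightarrow> integrable lebesgue (\<lambda>x. indicator {0<..} x * g x)"
    unfolding set_integrable_def
    by (rule integrable_cong_AE[OF fm measurable_completion[OF gm] AE_completion[OF eq']])
  then show "set_integrable lebesgue {0<..} f \<longleftrightarrow> integrable lborel (\<lambda>x. indicator {0<..} x * g x)"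
    by (simp add: integrable_completion[OF gm])
qed

lemma borel_representative:
  fixes f :: "real \<Rightarrow> real"
  assumes "(\<lambda>x. indicator {0<..} x *\<^sub>R f x) \<in> borel_measurable lebesgue"
  obtains g where "g \<in> borel_measurable borel" "AE x in lborel. 0 < x \<longrightarrow> f x = g x"
proof -
  obtain g where g: "g \<in> borel_measurable lborel" "AE x in lborel. indicator {0<..} x *\<^sub>R f x = g x"
    using completion_ex_borel_measurable_real[OF assms] by blast
  have "AE x in lborel. 0 < x \<longrightarrow> f x = g x" using g(2) by eventually_elim auto
  with g(1) show thesis using that by simp
qed

lemma AE_lborel_shift:
  assumes "AE t in lborel. P t"
  shows "AE y in lborel. P (x + y :: real)"
proof -
  have "AE t in distr lborel borel ((+) x). P t" using assms by (simp only: lborel_distr_plus)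
  then show ?thesis by (rule AE_distrD[rotated]) simp
qed

lemma wL1_iff:
  assumes [measurable]: "g \<in> borel_measurable borel" and eq: "AE x in lborel. 0 < x \<longrightarrow> f x = g x" and g0: "\<And>x. x \<le> 0 \<Longrightarrow> g x = 0"
  shows "f \<in> wL1 m \<longleftrightarrow> integrable lborel (\<lambda>x. x powr m * g x)"
proof -
  have "f \<in> wL1 m \<longleftrightarrow> integrable lborel (\<lambda>x. indicator {0<..} x * (x powr m * g x))"
    unfolding wL1_def mem_Collect_eq
    by (rule set_integrable_lebesgue_cong) (use eq in auto)
  also have "(\<lambda>x. indicator {0<..} x * (x powr m * g x)) = (\<lambda>x. x powr m * g x)"
  proof
    fix x show "indicator {0<..} x * (x powr m * g x) = x powr m * g x"
      using g0[of x] by (cases "0 < x") auto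
  qed
  finally show ?thesis .
qed

lemma pos_cone_representative:
  assumes "f \<in> pos_cone A" "A \<subseteq> wL1 m"
  obtains g where "g \<in> borel_measurable borel" "AE x in lborel. 0 < x \<longrightarrow> f x = g x"
    "\<And>x. x \<le> 0 \<Longrightarrow> g x = 0" "\<And>x. 0 \<le> g x"
proof -
  have "f \<in> wL1 m" and pos: "AE x\<in>{0<..} in lebesgue. 0 \<le> f x" using assms by (auto simp: pos_cone_def)
  then have "(\<lambda>x. indicator {0<..} x *\<^sub>R (x powr m * f x)) \<in> borel_measurable lebesgue"
    unfolding wL1_def set_integrable_def by auto
  then obtain h where h[measurable]: "h \<in> borel_measurable borel" and hf: "AE x in lborel. 0 < x \<longrightarrow> x powr m * f x = h x"
    by (rule borel_representative)
  \<comment> \<open>Membership in \<open>wL1 m\<close> only makes \<open>x powr m * f x\<close>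
    measurable, so the weight is divided out of a representative of that product;
    \<open>max 0\<close> makes nonnegativity hold everywhere.\<close>
  define g where "g x = (if 0 < x then max 0 (x powr (- m) * h x) else 0)" for x
  have "g \<in> borel_measurable borel" unfolding g_def[abs_def] by measurable
  moreover have "AE x in lborel. 0 < x \<longrightarrow> f x = g x"
    using hf pos[unfolded AE_completion_iff]
  proof eventually_elim
    case (elim x)
    show ?case
    proof
      assume x: "0 < x"
      have "x powr (- m) * h x = (x powr (- m) * x powr m) * f x" using elim(1) x by (metis mult.assoc)
      also have "x powr (- m) * x powr m = 1" using x by (simp flip: powr_add)
      finally show "f x = g x" using elim(2) x by (simp add: g_def)
    qed
  qed
  ultimately show thesis using that by (simp add: g_def)
qed

lemma L_infty_representative:
  assumes "\<theta> \<in> L_infty"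
  obtains t C where "t \<in> borel_measurable borel" "AE x in lborel. 0 < x \<longrightarrow> \<theta> x = t x"
    "\<And>x. x \<notin> {0<..} \<Longrightarrow> t x = 0" "\<And>x. \<bar>t x\<bar> \<le> C"
proof -
  obtain C where C: "AE x\<in>{0<..} in lebesgue. \<bar>\<theta> x\<bar> \<le> C"
    and "(\<lambda>x. indicator {0<..} x *\<^sub>R \<theta> x) \<in> borel_measurable lebesgue"
    using assms unfolding L_infty_def set_borel_measurable_def by auto
  then obtain h where h[measurable]: "h \<in> borel_measurable borel" and hf: "AE x in lborel. 0 < x \<longrightarrow> \<theta> x = h x"
    using borel_representative[of \<theta> thesis] by blast
  define t where "t x = (if 0 < x then max (- \<bar>C\<bar>) (min \<bar>C\<bar> (h x)) else 0)" for x
  have "t \<in> borel_measurable borel" unfolding t_def[abs_def] by measurable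
  moreover have "AE x in lborel. 0 < x \<longrightarrow> \<theta> x = t x"
    using hf C[unfolded AE_completion_iff] by eventually_elim (auto simp: t_def)
  moreover have "t x = 0" if "x \<notin> {0<..}" for x using that by (simp add: t_def)
  moreover have "\<bar>t x\<bar> \<le> \<bar>C\<bar>" for x by (auto simp: t_def)
  ultimately show thesis by (rule that)
qed

text \<open>Exceptional sets enter in three ways: the planar one of the kernel meets almost every
  vertical line in a null set, those of \<open>\<phi>0\<close> and \<open>S0\<close> are null sets
  of the line, and \<open>\<theta> (x + y)\<close> is altered on a translated null set for each
  \<open>x\<close>. The sign changes because \<open>chi\<close> is minus the defect used in
  \<open>wsol\<close>.\<close>

lemma (in coag) stationary_solution_iff:
  assumes K0: "AE z in lborel2. 0 < fst z \<and> 0 < snd z \<longrightarrow> K0 (fst z) (snd z) = K (fst z) (snd z)"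
    and \<phi>m[measurable]: "\<phi> \<in> borel_measurable borel" and \<phi>: "AE x in lborel. 0 < x \<longrightarrow> \<phi>0 x = \<phi> x" "\<And>x. x \<le> 0 \<Longrightarrow> \<phi> x = 0" "\<And>x. 0 \<le> \<phi> x"
    and Sm[measurable]: "S \<in> borel_measurable borel" and S: "AE x in lborel. 0 < x \<longrightarrow> S0 x = S x" "\<And>x. x \<le> 0 \<Longrightarrow> S x = 0"
  shows "stationary_solution lam K0 S0 \<phi>0 \<longleftrightarrow> wsol S 0 {0<..} \<phi>"
proof -
  have rm[measurable]: "rate \<phi> \<in> borel_measurable (borel \<Otimes>\<^sub>M borel)" unfolding rate_def[abs_def] by measurable
  have eq0: "(\<lambda>x. x powr 0 * \<phi> x) = \<phi>" using \<phi>(2) by (auto simp: powr_def)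
  have cone: "\<phi>0 \<in> pos_cone (wL1 0 \<inter> wL1 lam) \<longleftrightarrow> integrable lborel \<phi> \<and> integrable lborel (\<lambda>x. x powr lam * \<phi> x)"
  proof -
    have "AE x\<in>{0<..} in lebesgue. 0 \<le> \<phi>0 x"
      unfolding AE_completion_iff using \<phi>(1) by eventually_elim (simp add: \<phi>(3))
    moreover have "\<phi>0 \<in> wL1 0 \<longleftrightarrow> integrable lborel \<phi>" "\<phi>0 \<in> wL1 lam \<longleftrightarrow> integrable lborel (\<lambda>x. x powr lam * \<phi> x)"
      using wL1_iff[OF \<phi>m \<phi>(1,2), of 0] wL1_iff[OF \<phi>m \<phi>(1,2), of lam] by (simp_all only: eq0)
    ultimately show ?thesis by (simp add: pos_cone_def)
  qed
  have source: "(LINT x:{0<..}|lebesgue. S0 x * \<theta> x) = (LINT x|lborel. S x * t x)"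
    if [measurable]: "t \<in> borel_measurable borel" and t: "AE x in lborel. 0 < x \<longrightarrow> \<theta> x = t x" for \<theta> t
  proof -
    have "(LINT x:{0<..}|lebesgue. S0 x * \<theta> x) = (LINT x|lborel. indicator {0<..} x * (S x * t x))"
    proof (rule set_integral_lebesgue_cong)
      show "AE x in lborel. 0 < x \<longrightarrow> S0 x * \<theta> x = S x * t x" using S(1) t by eventually_elim simp
    qed measurable
    also have "\<dots> = (LINT x|lborel. S x * t x)"
      using S(2) by (intro Bochner_Integration.integral_cong) (auto simp: indicator_def not_less)
    finally show ?thesis .
  qed
  have double: "(LINT x:{0<..}|lebesgue. (LINT y:{0<..}|lebesgue. chi \<theta> x y * K0 x y * \<phi>0 x * \<phi>0 y))
      = - (LINT z|lborel2. (t (fst z) + t (snd z) - t (fst z + snd z)) * rate \<phi> z)"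
    if tm[measurable]: "t \<in> borel_measurable borel" and t: "AE x in lborel. 0 < x \<longrightarrow> \<theta> x = t x" and C: "\<And>x. \<bar>t x\<bar> \<le> C"
      and i\<phi>: "integrable lborel \<phi>" "integrable lborel (\<lambda>x. x powr lam * \<phi> x)" for \<theta> t C
  proof -
    define g where "g x y = (t (x + y) - t x - t y) * rate \<phi> (x, y)" for x y
    have [measurable]: "case_prod g \<in> borel_measurable (borel \<Otimes>\<^sub>M borel)" unfolding g_def[abs_def] by measurable
    have g0: "g x y = 0" if "x \<le> 0 \<or> y \<le> 0" for x y using that \<phi>(2) by (auto simp: g_def rate_def)
    have ir: "integrable lborel2 (rate \<phi>)"
    proof (rule Bochner_Integration.integrable_bound[of _ "\<lambda>z. k2 * ((fst z powr lam * \<phi> (fst z)) * \<phi> (snd z)) + k2 * (\<phi> (fst z) * (snd z powr lam * \<phi> (snd z)))"])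
      show "integrable lborel2 (\<lambda>z. k2 * ((fst z powr lam * \<phi> (fst z)) * \<phi> (snd z)) + k2 * (\<phi> (fst z) * (snd z powr lam * \<phi> (snd z))))"
        using integrable_lborel2_product[OF i\<phi>] integrable_lborel2_product[OF i\<phi>(2,1)] by simp
      have "norm (rate \<phi> z) \<le> norm (k2 * ((fst z powr lam * \<phi> (fst z)) * \<phi> (snd z)) + k2 * (\<phi> (fst z) * (snd z powr lam * \<phi> (snd z))))" for z
      proof (cases "0 < fst z \<and> 0 < snd z")
        case True
        have "rate \<phi> z \<le> k2 * (fst z powr lam + snd z powr lam) * (\<phi> (fst z) * \<phi> (snd z))"
          unfolding rate_def mult.assoc[of "K _ _"] using True \<phi>(3) by (intro mult_right_mono K_upper) auto
        moreover have "0 \<le> rate \<phi> z" unfolding rate_def using \<phi>(3) K_nonneg by simp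
        ultimately show ?thesis by (simp add: algebra_simps)
      next
        case False
        then have "\<phi> (fst z) = 0 \<or> \<phi> (snd z) = 0" using \<phi>(2) by force
        then show ?thesis by (auto simp: rate_def)
      qed
      then show "AE z in lborel2. norm (rate \<phi> z) \<le> norm (k2 * ((fst z powr lam * \<phi> (fst z)) * \<phi> (snd z)) + k2 * (\<phi> (fst z) * (snd z powr lam * \<phi> (snd z))))"
        by simp
    qed (simp add: measurable_lborel2)
    have ig: "integrable lborel2 (\<lambda>z. rate \<phi> z * (t (fst z + snd z) - t (fst z) - t (snd z)))"
    proof (rule integrable_mult_bounded[OF ir, where C="3 * C"])
      fix z show "\<bar>t (fst z + snd z) - t (fst z) - t (snd z)\<bar> \<le> 3 * C"
        using C[of "fst z"] C[of "snd z"] C[of "fst z + snd z"] by linarith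
    qed measurable
    have inner: "AE x in lborel. 0 < x \<longrightarrow> (LINT y:{0<..}|lebesgue. chi \<theta> x y * K0 x y * \<phi>0 x * \<phi>0 y) = (LINT y|lborel. g x y)"
      using lborel_pair.AE_pair[OF K0] \<phi>(1) t
    proof eventually_elim
      case (elim x)
      show ?case
      proof
        assume x: "0 < x"
        have "(LINT y:{0<..}|lebesgue. chi \<theta> x y * K0 x y * \<phi>0 x * \<phi>0 y) = (LINT y|lborel. indicator {0<..} y * g x y)"
        proof (rule set_integral_lebesgue_cong)
          show "AE y in lborel. 0 < y \<longrightarrow> chi \<theta> x y * K0 x y * \<phi>0 x * \<phi>0 y = g x y"
            using elim(1) \<phi>(1) t AE_lborel_shift[OF t, of x]
          proof eventually_elim
            case e: (elim y)
            show ?case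
            proof
              assume y: "0 < y"
              have "chi \<theta> x y = t (x + y) - t x - t y" using x y elim e by (simp add: chi_def)
              moreover have "K0 x y = K x y" "\<phi>0 x = \<phi> x" "\<phi>0 y = \<phi> y" using x y elim e by auto
              ultimately show "chi \<theta> x y * K0 x y * \<phi>0 x * \<phi>0 y = g x y" by (simp add: g_def rate_def mult.assoc)
            qed
          qed
        qed measurable
        also have "\<dots> = (LINT y|lborel. g x y)"
          using g0 by (intro Bochner_Integration.integral_cong) (auto simp: indicator_def not_less)
        finally show "(LINT y:{0<..}|lebesgue. chi \<theta> x y * K0 x y * \<phi>0 x * \<phi>0 y) = (LINT y|lborel. g x y)" .
      qed
    qed
    have "(LINT x:{0<..}|lebesgue. (LINT y:{0<..}|lebesgue. chi \<theta> x y * K0 x y * \<phi>0 x * \<phi>0 y))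
        = (LINT x|lborel. indicator {0<..} x * (LINT y|lborel. g x y))"
      by (rule set_integral_lebesgue_cong[OF _ inner]) measurable
    also have "\<dots> = (LINT x|lborel. (LINT y|lborel. g x y))"
    proof (rule Bochner_Integration.integral_cong)
      fix x
      have "g x = (\<lambda>_. 0)" if "x \<le> 0" using g0 that by auto
      then show "indicator {0<..} x * (LINT y|lborel. g x y) = (LINT y|lborel. g x y)"
        by (cases "0 < x") auto
    qed simp
    also have "\<dots> = (LINT z|lborel2. rate \<phi> z * (t (fst z + snd z) - t (fst z) - t (snd z)))"
      using lborel_pair.integral_fst'[OF ig] by (simp add: g_def mult.commute)
    also have "\<dots> = (LINT z|lborel2. - ((t (fst z) + t (snd z) - t (fst z + snd z)) * rate \<phi> z))"
      by (intro Bochner_Integration.integral_cong) (auto simp: algebra_simps)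
    finally show ?thesis by simp
  qed
  show ?thesis
  proof
    assume st: "stationary_solution lam K0 S0 \<phi>0"
    then have i\<phi>: "integrable lborel \<phi>" "integrable lborel (\<lambda>x. x powr lam * \<phi> x)"
      using cone unfolding stationary_solution_def by auto
    show "wsol S 0 {0<..} \<phi>"
      unfolding wsol_def
    proof (intro conjI ballI impI allI i\<phi>)
      show "0 \<le> \<phi> x" for x by (rule \<phi>(3))
      show "\<phi> x = 0" if "x \<notin> {0<..}" for x using that \<phi>(2) by simp
      fix t :: "real \<Rightarrow> real" assume t[measurable]: "t \<in> borel_measurable borel" and "\<exists>C. \<forall>x. \<bar>t x\<bar> \<le> C"
      then obtain C where C: "\<And>x. \<bar>t x\<bar> \<le> C" by blast
      have tt: "AE x in lborel. 0 < x \<longrightarrow> t x = t x" by simp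
      have "(\<lambda>x. indicator {0<..} x *\<^sub>R t x) \<in> borel_measurable lebesgue"
        by (rule measurable_completion) measurable
      then have "t \<in> L_infty" unfolding L_infty_def set_borel_measurable_def using C by auto
      then have "1 / 2 * (LINT x:{0<..}|lebesgue. (LINT y:{0<..}|lebesgue. chi t x y * K0 x y * \<phi>0 x * \<phi>0 y))
        + (LINT x:{0<..}|lebesgue. S0 x * t x) = 0"
        using st unfolding stationary_solution_def by blast
      then show "(LINT z|lborel2. (t (fst z) + t (snd z) - t (fst z + snd z)) * (K (fst z) (snd z) * \<phi> (fst z) * \<phi> (snd z)))
        + 2 * 0 * (LINT x|lborel. t x * \<phi> x) = 2 * (LINT x|lborel. S x * t x)"
        unfolding double[OF t tt C i\<phi>] source[OF t tt] rate_def by simp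
    qed
  next
    assume w: "wsol S 0 {0<..} \<phi>"
    note i\<phi> = wsol_integrable[OF w] wsol_integrable_lam[OF w]
    show "stationary_solution lam K0 S0 \<phi>0"
      unfolding stationary_solution_def
    proof (intro conjI ballI)
      show "\<phi>0 \<in> pos_cone (wL1 0 \<inter> wL1 lam)" using cone i\<phi> by simp
      fix \<theta> assume "\<theta> \<in> L_infty"
      then obtain t C where t: "t \<in> borel_measurable borel" "AE x in lborel. 0 < x \<longrightarrow> \<theta> x = t x"
        "\<And>x. x \<notin> {0<..} \<Longrightarrow> t x = 0" "\<And>x. \<bar>t x\<bar> \<le> C" using L_infty_representative[of \<theta> thesis] by blast
      show "1 / 2 * (LINT x:{0<..}|lebesgue. (LINT y:{0<..}|lebesgue. chi \<theta> x y * K0 x y * \<phi>0 x * \<phi>0 y))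
        + (LINT x:{0<..}|lebesgue. S0 x * \<theta> x) = 0"
        unfolding double[OF t(1,2,4) i\<phi>] source[OF t(1,2)] using wsol_eq[OF w t(1,4,3)] by simp
    qed
  qed
qed

lemma borel_kernel_representative:
  assumes lam: "0 \<le> lam" and k: "0 < k1" "k1 < k2" and ck: "coagulation_kernel K"
    and bounds: "\<And>x y. 0 < x \<Longrightarrow> 0 < y \<Longrightarrow> k1 * (x powr lam + y powr lam) \<le> K x y \<and> K x y \<le> k2 * (x powr lam + y powr lam)"
  obtains K' where "coag lam k1 k2 K'" "AE z in lborel2. 0 < fst z \<and> 0 < snd z \<longrightarrow> K (fst z) (snd z) = K' (fst z) (snd z)"
proof -
  have sym: "K x y = K y x" if "0 < x" "0 < y" for x y using ck that by (auto simp: coagulation_kernel_def)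
  have "(\<lambda>z. indicator ({0<..} \<times> {0<..}) z *\<^sub>R (case z of (x, y) \<Rightarrow> K x y)) \<in> borel_measurable (completion lborel2)"
    using ck unfolding coagulation_kernel_def set_borel_measurable_def lborel_prod by blast
  then obtain G where G: "G \<in> borel_measurable lborel2"
    and KG: "AE z in lborel2. indicator ({0<..} \<times> {0<..}) z *\<^sub>R (case z of (x, y) \<Rightarrow> K x y) = G z"
    using completion_ex_borel_measurable_real by blast
  have [measurable]: "G \<in> borel_measurable (borel \<Otimes>\<^sub>M borel)" using G by (simp add: measurable_lborel2)
  define p where "p x y = x powr lam + y powr lam" for x y :: real
  \<comment> \<open>\<open>G\<close> agrees with the kernel almost everywhere on the quadrant but
    need be neither symmetric nor within the bounds; averaging and clipping repair both and change
    nothing at almost every point there.\<close>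
  define K' where "K' x y = (if 0 < x \<and> 0 < y then max (k1 * p x y) (min (k2 * p x y) ((G (x, y) + G (y, x)) / 2)) else 0)" for x y
  have p: "0 \<le> p x y" "p x y = p y x" for x y by (simp_all add: p_def)
  have kp: "k1 * p x y \<le> k2 * p x y" for x y using k p(1) by (intro mult_right_mono) auto
  have "coag lam k1 k2 K'"
  proof
    show "case_prod K' \<in> borel_measurable (borel \<Otimes>\<^sub>M borel)" unfolding K'_def[abs_def] p_def by measurable
    show "K' x y = K' y x" for x y by (simp add: K'_def p(2)[of x y] add.commute conj_commute)
    show "k1 * (x powr lam + y powr lam) \<le> K' x y" if "0 < x" "0 < y" for x y
      using that by (simp add: K'_def p_def)
    show "K' x y \<le> k2 * (x powr lam + y powr lam)" if "0 < x" "0 < y" for x y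
      using that kp[of x y] by (simp add: K'_def p_def)
    show "K' x y = 0" if "x \<le> 0 \<or> y \<le> 0" for x y using that by (auto simp: K'_def)
  qed (use lam k in auto)
  moreover have "AE z in lborel2. 0 < fst z \<and> 0 < snd z \<longrightarrow> K (fst z) (snd z) = K' (fst z) (snd z)"
    using KG AE_swap[OF KG]
  proof eventually_elim
    case (elim z)
    show ?case
    proof
      assume z: "0 < fst z \<and> 0 < snd z"
      have "G (fst z, snd z) = K (fst z) (snd z)" using elim(1) z by (cases z) simp
      moreover have "G (snd z, fst z) = K (snd z) (fst z)" using elim(2) z by (cases z) simp
      ultimately have "(G (fst z, snd z) + G (snd z, fst z)) / 2 = K (fst z) (snd z)" using sym z by simp
      then show "K (fst z) (snd z) = K' (fst z) (snd z)"
        using bounds[of "fst z" "snd z"] z by (simp add: K'_def p_def)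
    qed
  qed
  ultimately show thesis by (rule that)
qed

theorem theorem1p2:
  fixes lam :: real and K :: "real \<Rightarrow> real \<Rightarrow> real" and S :: "real \<Rightarrow> real"
  assumes "0 \<le> lam"
    and "coagulation_kernel K"
    and "\<exists>k1 k2. 0 < k1 \<and> k1 < k2 \<and>
           (\<forall>x>0. \<forall>y>0. k1 * (x powr lam + y powr lam) \<le> K x y \<and>
                        K x y \<le> k2 * (x powr lam + y powr lam))"
    and "S \<in> pos_cone (wL1 0)"
  shows "((\<forall>x y. 0 < y \<and> y < x \<longrightarrow> K (x - y) y \<le> K x y) \<and>
          S \<in> (\<Inter>m\<in>{0<..<1}. wL1 m) \<and>
          \<not> (AE x\<in>{0<..} in lebesgue. S x = 0) \<and>
          lam < 1 \<longrightarrow>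
            (\<exists>\<phi>. stationary_solution lam K S \<phi> \<and>
                 (\<forall>m. 0 \<le> m \<and> m < (1 + lam) / 2 \<longrightarrow> \<phi> \<in> wL1 m) \<and>
                 \<phi> \<notin> wL1 ((1 + lam) / 2) \<and>
                 (\<forall>m<0. S \<in> wL1 m \<longrightarrow> \<phi> \<in> wL1 m)))
       \<and> (\<forall>\<phi>. 1 \<le> lam \<and> stationary_solution lam K S \<phi> \<longrightarrow>
            (AE x\<in>{0<..} in lebesgue. \<phi> x = 0) \<and>
            (AE x\<in>{0<..} in lebesgue. S x = 0))"
proof -
  obtain k1 k2 where k: "0 < k1" "k1 < k2"
    and bounds: "\<And>x y. 0 < x \<Longrightarrow> 0 < y \<Longrightarrow> k1 * (x powr lam + y powr lam) \<le> K x y \<and> K x y \<le> k2 * (x powr lam + y powr lam)"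
    using assms(3) by blast
  obtain K' where K': "coag lam k1 k2 K'"
    and KK': "AE z in lborel2. 0 < fst z \<and> 0 < snd z \<longrightarrow> K (fst z) (snd z) = K' (fst z) (snd z)"
    using borel_kernel_representative[OF assms(1) k assms(2) bounds, of thesis] by blast
  interpret coag lam k1 k2 K' by (rule K')
  obtain S' where S'm[measurable]: "S' \<in> borel_measurable borel" and SS': "AE x in lborel. 0 < x \<longrightarrow> S x = S' x"
    and S'0: "\<And>x. x \<le> 0 \<Longrightarrow> S' x = 0" and S'nn: "\<And>x. 0 \<le> S' x"
    using pos_cone_representative[OF assms(4) order_refl, of thesis] by blast
  note S_wL1 = wL1_iff[OF S'm SS' S'0]
  have "S \<in> wL1 0" using assms(4) by (simp add: pos_cone_def)
  moreover have "(\<lambda>x. x powr 0 * S' x) = S'" using S'0 by (auto simp: powr_def)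
  ultimately have S'i: "integrable lborel S'" using S_wL1[of 0] by simp
  have S'_zero: "(AE x\<in>{0<..} in lebesgue. S x = 0) \<longleftrightarrow> (AE x in lborel. S' x = 0)"
  proof
    assume "AE x\<in>{0<..} in lebesgue. S x = 0"
    with SS' show "AE x in lborel. S' x = 0"
      unfolding AE_completion_iff
    proof eventually_elim
      case (elim x) then show ?case using S'0[of x] by (cases "0 < x") auto
    qed
  next
    assume "AE x in lborel. S' x = 0"
    with SS' show "AE x\<in>{0<..} in lebesgue. S x = 0"
      unfolding AE_completion_iff by eventually_elim auto
  qed
  show ?thesis
  proof (intro conjI impI allI)
    assume hyp: "(\<forall>x y. 0 < y \<and> y < x \<longrightarrow> K (x - y) y \<le> K x y) \<and>
          S \<in> (\<Inter>m\<in>{0<..<1}. wL1 m) \<and> \<not> (AE x\<in>{0<..} in lebesgue. S x = 0) \<and> lam < 1"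
    interpret coag_source lam k1 k2 K' S'
    proof
      show "lam < 1" using hyp by simp
      show "integrable lborel (\<lambda>x. x powr m * S' x)" if "0 < m" "m < 1" for m
        using hyp S_wL1[of m] that by auto
      have "0 \<le> (LINT x|lborel. S' x)" using S'nn by (intro integral_nonneg_AE AE_I2)
      moreover have "(LINT x|lborel. S' x) \<noteq> 0"
        using integral_nonneg_eq_0_iff_AE[OF S'i] S'nn S'_zero hyp by simp
      ultimately show "0 < (LINT x|lborel. S' x)" by simp
      \<comment> \<open>For \<open>0 < snd z < fst z\<close> this is the monotonicity hypothesis,
        transferred to \<open>K'\<close> at the sheared point by \<open>AE_shear\<close>; otherwise
        an argument on the left is not positive and the left side is 0.\<close>
      show "AE z in lborel2. K' (fst z - snd z) (snd z) \<le> K' (fst z) (snd z)"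
        using KK' AE_shear[OF KK', of "-1"]
      proof eventually_elim
        case (elim z)
        show ?case
        proof (cases "0 < snd z \<and> snd z < fst z")
          case True
          then have "K (fst z - snd z) (snd z) \<le> K (fst z) (snd z)" using hyp by blast
          then show ?thesis using elim True by simp
        next
          case False
          then have "K' (fst z - snd z) (snd z) = 0" by (intro K_zero) auto
          then show ?thesis using K_nonneg by simp
        qed
      qed
    qed (use S'i S'nn S'0 in auto)
    obtain \<phi> where w: "wsol S' 0 {0<..} \<phi>" by (rule exists_wsol)
    note \<phi>m = wsol_meas[OF w] and \<phi>nn = wsol_nonneg[OF w]
    have \<phi>0: "\<phi> x = 0" if "x \<le> 0" for x using wsol_zero[OF w, of x] that by simp
    have \<phi>\<phi>: "AE x in lborel. 0 < x \<longrightarrow> \<phi> x = \<phi> x" by simp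
    note \<phi>_wL1 = wL1_iff[OF \<phi>m \<phi>\<phi> \<phi>0]
    show "\<exists>\<phi>. stationary_solution lam K S \<phi> \<and>
                 (\<forall>m. 0 \<le> m \<and> m < (1 + lam) / 2 \<longrightarrow> \<phi> \<in> wL1 m) \<and>
                 \<phi> \<notin> wL1 ((1 + lam) / 2) \<and>
                 (\<forall>m<0. S \<in> wL1 m \<longrightarrow> \<phi> \<in> wL1 m)"
    proof (intro exI[of _ \<phi>] conjI allI impI)
      show "stationary_solution lam K S \<phi>"
        using stationary_solution_iff[OF KK' \<phi>m \<phi>\<phi> \<phi>0 \<phi>nn S'm SS' S'0] w by blast
      show "\<phi> \<in> wL1 m" if "0 \<le> m \<and> m < (1 + lam) / 2" for m
        using wsol_moments[OF w] that \<phi>_wL1 by simp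
      show "\<phi> \<notin> wL1 ((1 + lam) / 2)"
      proof
        assume "\<phi> \<in> wL1 ((1 + lam) / 2)"
        then have "AE x in lborel. S' x = 0"
          using \<phi>_wL1 hyp by (intro source_vanishes_of_critical_moment[OF w S'i S'nn S'0]) auto
        then show False using hyp S'_zero by blast
      qed
      show "\<phi> \<in> wL1 m" if "m < 0" "S \<in> wL1 m" for m
        using wsol_negative_moments[OF w that(1)] that(2) \<phi>_wL1 S_wL1 by simp
    qed
  next
    fix \<phi> assume st: "1 \<le> lam \<and> stationary_solution lam K S \<phi>"
    have "\<phi> \<in> pos_cone (wL1 0 \<inter> wL1 lam)" using st by (simp add: stationary_solution_def)
    then obtain \<phi>' where \<phi>': "\<phi>' \<in> borel_measurable borel" "AE x in lborel. 0 < x \<longrightarrow> \<phi> x = \<phi>' x"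
      "\<And>x. x \<le> 0 \<Longrightarrow> \<phi>' x = 0" "\<And>x. 0 \<le> \<phi>' x"
      using pos_cone_representative[of \<phi> "wL1 0 \<inter> wL1 lam" 0 thesis] by blast
    have w: "wsol S' 0 {0<..} \<phi>'"
      using stationary_solution_iff[OF KK' \<phi>' S'm SS' S'0] st by blast
    have S'z: "AE x in lborel. S' x = 0"
      using st by (intro source_vanishes_superlinear[OF w S'i S'nn S'0]) auto
    then show "AE x\<in>{0<..} in lebesgue. S x = 0" using S'_zero by simp
    show "AE x\<in>{0<..} in lebesgue. \<phi> x = 0"
      unfolding AE_completion_iff
      using solution_vanishes[OF w S'z] \<phi>'(2) by eventually_elim auto
  qed
qed

end
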